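(* Let $\alpha$ be a regular cardinal and $\mathcal T$ a non-zero $\alpha$-compactly generated triangulated category. Suppose that $\beta$ is a cardinal satisfying one of the following hypotheses: (1) $\beta=(\gamma^{<\delta})^+$ for some $\gamma\ge\mathrm{card}\,\mathcal T^\alpha$ and some regular cardinal $\delta\ge\alpha$; (2) $\beta>\mathrm{card}\,\mathcal T^\alpha$ is inaccessible. Then $\mathcal T^\beta$ is the full subcategory of $\mathcal T$ of objects $Z$ such that $\mathrm{card}\,\mathcal T(Y,Z)<\beta$ for any $Y$ in $\mathcal T^\alpha$.
   Context: For a regular cardinal $\alpha$ and a triangulated category $\mathcal T$ with coproducts, an object $S$ is $\alpha$-small if any morphism $S\to\coprod_{i\in I}X_i$ factors through $\coprod_{i\in I'}X_i$ for some $I'\subset I$ with $\mathrm{card}\,I'<\alpha$. $\mathcal T$ is $\alpha$-compactly generated if there is a set $\mathcal S$ of $\alpha$-small objects such that (a) $X=0$ if and only if $\mathcal T(S,X)=0$ for all $S\in\mathcal S$, and (b) for every set $\{f_i\colon X_i\to Y_i\}_{i\in I}$ of morphisms such that $\mathcal T(S,f_i)$ is surjective for all $i\in I$, $S\in\mathcal S$, the map $\mathcal T(S,\coprod_if_i)$ is surjective for all $S\in\mathcal S$. $\mathcal T^\alpha$ is the unique maximal full subcategory formed by $\alpha$-small objects such that any morphism $S\to\coprod_{i\in I}X_i$ with $S\in\mathcal T^\alpha$ factors through a coproduct $\coprod_if_i\colon\coprod_iS_i\to\coprod_iX_i$ with all $S_i\in\mathcal T^\alpha$; it is essentially small. The cardinal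 of an essentially small category is the cardinal of $\coprod_{x,y\in\mathcal S}\mathrm{Hom}(x,y)$, where $\mathcal S$ is a set of representatives of isomorphism classes of objects. $\gamma^{<\delta}=\sup_{\lambda<\delta}\gamma^\lambda$, $\lambda^+$ is the successor cardinal, and inaccessible means uncountable, regular and strong limit. *)

theory Defs
  imports "HOL-Algebra.Group"
begin

unbundle cardinal_syntax

section \<open>Cardinals\<close>

text \<open>
  Cardinals are the cardinal orders of the HOL library. Size is measured by a fixed inaccessible
  cardinal \<open>\<kappa>\<close> of a type \<^typ>\<open>'u rel\<close>, which plays the role of a
  Grothendieck universe (or of the class of all ordinals): a set is small, that is, a genuine set
  as opposed to a proper class, if it has fewer than \<open>\<kappa>\<close> elements.
  As \<open>\<kappa>\<close> is a relation on \<^typ>\<open>'u\<close>, every small set is in bijection with a subset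
  of \<^typ>\<open>'u\<close>, and every small cardinal is represented by some \<^typ>\<open>'u rel\<close>; hence
  index sets of type \<^typ>\<open>'u set\<close> and cardinals of type \<^typ>\<open>'u rel\<close> suffice.
\<close>

definition regular_cardinal :: "'a rel \<Rightarrow> bool" where
  "regular_cardinal r \<longleftrightarrow> Cinfinite r \<and> regularCard r"

definition inaccessible :: "'a rel \<Rightarrow> bool" where
  "inaccessible r \<longleftrightarrow> regular_cardinal r \<and> natLeq <o r \<and>
     (\<forall>s::'a rel. Card_order s \<and> s <o r \<longrightarrow> ctwo ^c s <o r)"

definition is_cardinal_sup :: "'b rel set \<Rightarrow> 'a rel \<Rightarrow> bool" where
  "is_cardinal_sup A m \<longleftrightarrow> Card_order m \<and> (\<forall>r\<in>A. r \<le>o m) \<and>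
     (\<forall>n::'a rel. Card_order n \<and> (\<forall>r\<in>A. r \<le>o n) \<longrightarrow> m \<le>o n)"

text \<open>\<open>is_weak_power \<gamma> \<delta> \<mu>\<close> says that \<open>\<mu>\<close> represents \<open>\<gamma>\<close> to the power \<open>< \<delta>\<close>.\<close>

definition is_weak_power :: "'a rel \<Rightarrow> 'a rel \<Rightarrow> 'a rel \<Rightarrow> bool" where
  "is_weak_power \<gamma> \<delta> \<mu> \<longleftrightarrow>
     is_cardinal_sup {\<gamma> ^c l | l::'a rel. Card_order l \<and> l <o \<delta>} \<mu>"


section \<open>Categories and coproducts\<close>

record ('o, 'm) category_data =
  Obj :: "'o set"
  Hom :: "'o \<Rightarrow> 'o \<Rightarrow> 'm set"
  Comp :: "'m \<Rightarrow> 'm \<Rightarrow> 'm"  (infixr "\<odot>\<index>" 75)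
  Ident :: "'o \<Rightarrow> 'm"

locale category =
  fixes C :: "('o, 'm, 'z) category_data_scheme" (structure)
  assumes Hom_disjoint:
      "\<lbrakk>x \<in> Obj C; y \<in> Obj C; x' \<in> Obj C; y' \<in> Obj C; f \<in> Hom C x y; f \<in> Hom C x' y'\<rbrakk>
       \<Longrightarrow> x = x' \<and> y = y'"
    and Comp_closed:
      "\<lbrakk>x \<in> Obj C; y \<in> Obj C; z \<in> Obj C; f \<in> Hom C x y; g \<in> Hom C y z\<rbrakk>
       \<Longrightarrow> g \<odot> f \<in> Hom C x z"
    and Comp_assoc:
      "\<lbrakk>w \<in> Obj C; x \<in> Obj C; y \<in> Obj C; z \<in> Obj C;
        f \<in> Hom C w x; g \<in> Hom C x y; h \<in> Hom C y z\<rbrakk>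
       \<Longrightarrow> (h \<odot> g) \<odot> f = h \<odot> (g \<odot> f)"
    and Ident_closed: "x \<in> Obj C \<Longrightarrow> Ident C x \<in> Hom C x x"
    and Comp_Ident: "\<lbrakk>x \<in> Obj C; y \<in> Obj C; f \<in> Hom C x y\<rbrakk> \<Longrightarrow> f \<odot> Ident C x = f"
    and Ident_Comp: "\<lbrakk>x \<in> Obj C; y \<in> Obj C; f \<in> Hom C x y\<rbrakk> \<Longrightarrow> Ident C y \<odot> f = f"

definition locally_small :: "'u rel \<Rightarrow> ('o, 'm, 'z) category_data_scheme \<Rightarrow> bool" where
  "locally_small \<kappa> C \<longleftrightarrow> (\<forall>x\<in>Obj C. \<forall>y\<in>Obj C. |Hom C x y| <o \<kappa> )"

definition is_iso :: "('o, 'm, 'z) category_data_scheme \<Rightarrow> 'o \<Rightarrow> 'o \<Rightarrow> 'm \<Rightarrow> bool" where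
  "is_iso C x y f \<longleftrightarrow> f \<in> Hom C x y \<and>
     (\<exists>g\<in>Hom C y x. g \<odot>\<^bsub>C\<^esub> f = Ident C x \<and> f \<odot>\<^bsub>C\<^esub> g = Ident C y)"

definition isomorphic :: "('o, 'm, 'z) category_data_scheme \<Rightarrow> 'o \<Rightarrow> 'o \<Rightarrow> bool" where
  "isomorphic C x y \<longleftrightarrow> (\<exists>f. is_iso C x y f)"

definition is_coproduct ::
  "('o, 'm, 'z) category_data_scheme \<Rightarrow> 'i set \<Rightarrow> ('i \<Rightarrow> 'o) \<Rightarrow> 'o \<Rightarrow> ('i \<Rightarrow> 'm) \<Rightarrow> bool" where
  "is_coproduct C I X P \<iota> \<longleftrightarrow>
     P \<in> Obj C \<and> (\<forall>i\<in>I. X i \<in> Obj C \<and> \<iota> i \<in> Hom C (X i) P) \<and>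
     (\<forall>Z\<in>Obj C. \<forall>f. (\<forall>i\<in>I. f i \<in> Hom C (X i) Z) \<longrightarrow>
        (\<exists>!h. h \<in> Hom C P Z \<and> (\<forall>i\<in>I. h \<odot>\<^bsub>C\<^esub> \<iota> i = f i)))"

definition has_small_coproducts :: "'u rel \<Rightarrow> ('o, 'm, 'z) category_data_scheme \<Rightarrow> bool" where
  "has_small_coproducts \<kappa> C \<longleftrightarrow>
     (\<forall>(I::'u set) X. |I| <o \<kappa> \<and> (\<forall>i\<in>I. X i \<in> Obj C) \<longrightarrow> (\<exists>P \<iota>. is_coproduct C I X P \<iota>))"

text \<open>
  \<open>h\<close> is the coproduct of the morphisms \<open>f i\<close>, from \<open>P\<close> with injections \<open>\<iota>\<close>
  to \<open>Q\<close> with injections \<open>\<iota>'\<close>.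
\<close>

definition is_coproduct_map ::
  "('o, 'm, 'z) category_data_scheme \<Rightarrow> 'i set \<Rightarrow> ('i \<Rightarrow> 'm) \<Rightarrow> 'o \<Rightarrow> ('i \<Rightarrow> 'm) \<Rightarrow> 'o \<Rightarrow> ('i \<Rightarrow> 'm)
     \<Rightarrow> 'm \<Rightarrow> bool" where
  "is_coproduct_map C I f P \<iota> Q \<iota>' h \<longleftrightarrow>
     h \<in> Hom C P Q \<and> (\<forall>i\<in>I. h \<odot>\<^bsub>C\<^esub> \<iota> i = \<iota>' i \<odot>\<^bsub>C\<^esub> f i)"

definition is_representative_set ::
  "('o, 'm, 'z) category_data_scheme \<Rightarrow> 'o set \<Rightarrow> 'o set \<Rightarrow> bool" where
  "is_representative_set C A R \<longleftrightarrow> R \<subseteq> A \<and> (\<forall>x\<in>A. \<exists>!y. y \<in> R \<and> isomorphic C x y)"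

text \<open>
  The cardinal of the full subcategory on the objects \<open>A\<close>; up to \<open>=o\<close> it does not
  depend on the chosen representatives.
\<close>

definition category_card ::
  "('o, 'm, 'z) category_data_scheme \<Rightarrow> 'o set \<Rightarrow> (('o \<times> 'o) \<times> 'm) rel" where
  "category_card C A =
     (let R = (SOME R. is_representative_set C A R) in |SIGMA (x, y) : R \<times> R. Hom C x y| )"


section \<open>Additive and triangulated categories\<close>

record ('o, 'm) preadditive_data = "('o, 'm) category_data" +
  Add :: "'m \<Rightarrow> 'm \<Rightarrow> 'm"
  Zero :: "'o \<Rightarrow> 'o \<Rightarrow> 'm"

definition hom_group ::
  "('o, 'm, 'z) preadditive_data_scheme \<Rightarrow> 'o \<Rightarrow> 'o \<Rightarrow> 'm monoid" where
  "hom_group C x y = \<lparr>carrier = Hom C x y, mult = Add C, one = Zero C x y\<rparr>"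

definition is_zero_object :: "('o, 'm, 'z) preadditive_data_scheme \<Rightarrow> 'o \<Rightarrow> bool" where
  "is_zero_object C z \<longleftrightarrow> z \<in> Obj C \<and>
     (\<forall>x\<in>Obj C. Hom C x z = {Zero C x z} \<and> Hom C z x = {Zero C z x})"

locale additive_category = category C
  for C :: "('o, 'm, 'z) preadditive_data_scheme" (structure) +
  assumes hom_comm_group: "\<lbrakk>x \<in> Obj C; y \<in> Obj C\<rbrakk> \<Longrightarrow> comm_group (hom_group C x y)"
    and Comp_Add:
      "\<lbrakk>x \<in> Obj C; y \<in> Obj C; z \<in> Obj C; f \<in> Hom C x y; f' \<in> Hom C x y; g \<in> Hom C y z\<rbrakk>
       \<Longrightarrow> g \<odot> Add C f f' = Add C (g \<odot> f) (g \<odot> f')"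
    and Add_Comp:
      "\<lbrakk>x \<in> Obj C; y \<in> Obj C; z \<in> Obj C; f \<in> Hom C x y; g \<in> Hom C y z; g' \<in> Hom C y z\<rbrakk>
       \<Longrightarrow> Add C g g' \<odot> f = Add C (g \<odot> f) (g' \<odot> f)"
    and zero_object_exists: "\<exists>z. is_zero_object C z"
    and binary_coproduct_exists:
      "\<lbrakk>x \<in> Obj C; y \<in> Obj C\<rbrakk>
       \<Longrightarrow> \<exists>P \<iota>. is_coproduct C (UNIV :: bool set) (\<lambda>b. if b then x else y) P \<iota>"

record ('o, 'm) triangulated_data = "('o, 'm) preadditive_data" +
  ShiftO :: "'o \<Rightarrow> 'o"
  ShiftM :: "'m \<Rightarrow> 'm"
  Triangles :: "('m \<times> 'm \<times> 'm) set"

definition candidate_triangle ::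
  "('o, 'm, 'z) triangulated_data_scheme \<Rightarrow> 'o \<Rightarrow> 'o \<Rightarrow> 'o \<Rightarrow> 'm \<Rightarrow> 'm \<Rightarrow> 'm \<Rightarrow> bool" where
  "candidate_triangle T x y z f g h \<longleftrightarrow> x \<in> Obj T \<and> y \<in> Obj T \<and> z \<in> Obj T \<and>
     f \<in> Hom T x y \<and> g \<in> Hom T y z \<and> h \<in> Hom T z (ShiftO T x)"

definition exact_triangle ::
  "('o, 'm, 'z) triangulated_data_scheme \<Rightarrow> 'o \<Rightarrow> 'o \<Rightarrow> 'o \<Rightarrow> 'm \<Rightarrow> 'm \<Rightarrow> 'm \<Rightarrow> bool" where
  "exact_triangle T x y z f g h \<longleftrightarrow>
     candidate_triangle T x y z f g h \<and> (f, g, h) \<in> Triangles T"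

text \<open>
  Verdier's axioms, including the octahedral axiom; the shift is an additive self-equivalence,
  not necessarily an automorphism.
\<close>

locale triangulated_category = additive_category T
  for T :: "('o, 'm, 'z) triangulated_data_scheme" (structure) +
  assumes ShiftO_closed: "x \<in> Obj T \<Longrightarrow> ShiftO T x \<in> Obj T"
    and ShiftM_bij:
      "\<lbrakk>x \<in> Obj T; y \<in> Obj T\<rbrakk>
       \<Longrightarrow> bij_betw (ShiftM T) (Hom T x y) (Hom T (ShiftO T x) (ShiftO T y))"
    and ShiftM_Ident: "x \<in> Obj T \<Longrightarrow> ShiftM T (Ident T x) = Ident T (ShiftO T x)"
    and ShiftM_Comp:
      "\<lbrakk>x \<in> Obj T; y \<in> Obj T; z \<in> Obj T; f \<in> Hom T x y; g \<in> Hom T y z\<rbrakk>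
       \<Longrightarrow> ShiftM T (g \<odot> f) = ShiftM T g \<odot> ShiftM T f"
    and ShiftM_Add:
      "\<lbrakk>x \<in> Obj T; y \<in> Obj T; f \<in> Hom T x y; f' \<in> Hom T x y\<rbrakk>
       \<Longrightarrow> ShiftM T (Add T f f') = Add T (ShiftM T f) (ShiftM T f')"
    and ShiftO_ess_surj: "y \<in> Obj T \<Longrightarrow> \<exists>x\<in>Obj T. isomorphic T (ShiftO T x) y"
    and Triangles_candidate:
      "(f, g, h) \<in> Triangles T \<Longrightarrow> \<exists>x y z. candidate_triangle T x y z f g h"
    and Triangles_iso_closed:
      "\<lbrakk>exact_triangle T x y z f g h; candidate_triangle T x' y' z' f' g' h';
        is_iso T x x' u; is_iso T y y' v; is_iso T z z' w;
        v \<odot> f = f' \<odot> u; w \<odot> g = g' \<odot> v; ShiftM T u \<odot> h = h' \<odot> w\<rbrakk>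
       \<Longrightarrow> (f', g', h') \<in> Triangles T"
    and TR1_Ident:
      "\<lbrakk>x \<in> Obj T; is_zero_object T z\<rbrakk>
       \<Longrightarrow> (Ident T x, Zero T x z, Zero T z (ShiftO T x)) \<in> Triangles T"
    and TR1_cone:
      "\<lbrakk>x \<in> Obj T; y \<in> Obj T; f \<in> Hom T x y\<rbrakk> \<Longrightarrow> \<exists>z g h. exact_triangle T x y z f g h"
    and TR2_rotate:
      "candidate_triangle T x y z f g h \<Longrightarrow>
       (f, g, h) \<in> Triangles T \<longleftrightarrow>
       (g, h, inv\<^bsub>hom_group T (ShiftO T x) (ShiftO T y)\<^esub> (ShiftM T f)) \<in> Triangles T"
    and TR3_fill:
      "\<lbrakk>exact_triangle T x y z f g h; exact_triangle T x' y' z' f' g' h';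
        u \<in> Hom T x x'; v \<in> Hom T y y'; v \<odot> f = f' \<odot> u\<rbrakk>
       \<Longrightarrow> \<exists>w\<in>Hom T z z'. w \<odot> g = g' \<odot> v \<and> ShiftM T u \<odot> h = h' \<odot> w"
    and TR4_octahedral:
      "\<lbrakk>exact_triangle T x y a f f1 f2; exact_triangle T y z b g g1 g2;
        exact_triangle T x z d (g \<odot> f) k1 k2\<rbrakk>
       \<Longrightarrow> \<exists>u v. exact_triangle T a d b u v (ShiftM T f1 \<odot> g2) \<and>
             u \<odot> f1 = k1 \<odot> g \<and> k2 \<odot> u = f2 \<and> v \<odot> k1 = g1 \<and> g2 \<odot> v = ShiftM T f \<odot> k2"


section \<open>Small objects and compact generation\<close>

definition small_object ::
  "'u rel \<Rightarrow> 'u rel \<Rightarrow> ('o, 'm, 'z) category_data_scheme \<Rightarrow> 'o \<Rightarrow> bool" where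
  "small_object \<kappa> \<alpha> C S \<longleftrightarrow> S \<in> Obj C \<and>
     (\<forall>(I::'u set) X P \<iota> f. |I| <o \<kappa> \<and> is_coproduct C I X P \<iota> \<and> f \<in> Hom C S P \<longrightarrow>
        (\<exists>I' Q \<iota>' h g. I' \<subseteq> I \<and> |I'| <o \<alpha> \<and> is_coproduct C I' X Q \<iota>' \<and>
           h \<in> Hom C Q P \<and> (\<forall>i\<in>I'. h \<odot>\<^bsub>C\<^esub> \<iota>' i = \<iota> i) \<and> g \<in> Hom C S Q \<and> f = h \<odot>\<^bsub>C\<^esub> g))"

definition hom_surjective ::
  "('o, 'm, 'z) category_data_scheme \<Rightarrow> 'o \<Rightarrow> 'o \<Rightarrow> 'o \<Rightarrow> 'm \<Rightarrow> bool" where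
  "hom_surjective C S x y f \<longleftrightarrow> (\<lambda>g. f \<odot>\<^bsub>C\<^esub> g) ` Hom C S x = Hom C S y"

definition compactly_generated ::
  "'u rel \<Rightarrow> 'u rel \<Rightarrow> ('o, 'm, 'z) preadditive_data_scheme \<Rightarrow> bool" where
  "compactly_generated \<kappa> \<alpha> C \<longleftrightarrow>
     (\<exists>\<S>. |\<S>| <o \<kappa> \<and> (\<forall>S\<in>\<S>. small_object \<kappa> \<alpha> C S) \<and>
        (\<forall>X\<in>Obj C. is_zero_object C X \<longleftrightarrow> (\<forall>S\<in>\<S>. Hom C S X = {Zero C S X})) \<and>
        (\<forall>(I::'u set) X Y f P \<iota> Q \<iota>' h.
           |I| <o \<kappa> \<and> (\<forall>i\<in>I. f i \<in> Hom C (X i) (Y i)) \<and>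
           is_coproduct C I X P \<iota> \<and> is_coproduct C I Y Q \<iota>' \<and>
           is_coproduct_map C I f P \<iota> Q \<iota>' h \<and>
           (\<forall>i\<in>I. \<forall>S\<in>\<S>. hom_surjective C S (X i) (Y i) (f i)) \<longrightarrow>
           (\<forall>S\<in>\<S>. hom_surjective C S P Q h)))"

text \<open>Full subcategories are identified with their sets (possibly proper classes) of objects.\<close>

definition coproduct_factoring ::
  "'u rel \<Rightarrow> 'u rel \<Rightarrow> ('o, 'm, 'z) category_data_scheme \<Rightarrow> 'o set \<Rightarrow> bool" where
  "coproduct_factoring \<kappa> \<alpha> C A \<longleftrightarrow>
     (\<forall>S\<in>A. small_object \<kappa> \<alpha> C S) \<and>
     (\<forall>S\<in>A. \<forall>(I::'u set) X P \<iota> f. |I| <o \<kappa> \<and> is_coproduct C I X P \<iota> \<and> f \<in> Hom C S P \<longrightarrow>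
        (\<exists>S' Q \<iota>' p h g. (\<forall>i\<in>I. S' i \<in> A \<and> p i \<in> Hom C (S' i) (X i)) \<and>
           is_coproduct C I S' Q \<iota>' \<and> is_coproduct_map C I p Q \<iota>' P \<iota> h \<and>
           g \<in> Hom C S Q \<and> f = h \<odot>\<^bsub>C\<^esub> g))"

definition compact_objects ::
  "'u rel \<Rightarrow> 'u rel \<Rightarrow> ('o, 'm, 'z) category_data_scheme \<Rightarrow> 'o set" where
  "compact_objects \<kappa> \<alpha> C =
     (THE A. coproduct_factoring \<kappa> \<alpha> C A \<and>
        (\<forall>B. coproduct_factoring \<kappa> \<alpha> C B \<and> A \<subseteq> B \<longrightarrow> B = A))"

text \<open>There is indeed a unique maximal such subcategory, namely the union of all of them.\<close>

lemma coproduct_factoring_Union: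
  fixes \<kappa> \<alpha> :: "'u rel"
  assumes "\<And>A. A \<in> \<A> \<Longrightarrow> coproduct_factoring \<kappa> \<alpha> C A"
  shows "coproduct_factoring \<kappa> \<alpha> C (\<Union>\<A>)"
  unfolding coproduct_factoring_def
proof (intro conjI ballI allI impI)
  fix S assume "S \<in> \<Union>\<A>"
  then show "small_object \<kappa> \<alpha> C S" using assms unfolding coproduct_factoring_def by blast
next
  fix S X P \<iota> f and I :: "'u set"
  assume "S \<in> \<Union>\<A>" and *: "|I| <o \<kappa> \<and> is_coproduct C I X P \<iota> \<and> f \<in> Hom C S P"
  then obtain A where A: "A \<in> \<A>" "S \<in> A" by blast
  with assms * obtain S' Q \<iota>' p h g where **: "(\<forall>i\<in>I. S' i \<in> A \<and> p i \<in> Hom C (S' i) (X i)) \<and>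
       is_coproduct C I S' Q \<iota>' \<and> is_coproduct_map C I p Q \<iota>' P \<iota> h \<and>
       g \<in> Hom C S Q \<and> f = h \<odot>\<^bsub>C\<^esub> g"
    unfolding coproduct_factoring_def by blast
  with A have "\<forall>i\<in>I. S' i \<in> \<Union>\<A> \<and> p i \<in> Hom C (S' i) (X i)" by blast
  with ** show "\<exists>S' Q \<iota>' p h g. (\<forall>i\<in>I. S' i \<in> \<Union>\<A> \<and> p i \<in> Hom C (S' i) (X i)) \<and>
       is_coproduct C I S' Q \<iota>' \<and> is_coproduct_map C I p Q \<iota>' P \<iota> h \<and>
       g \<in> Hom C S Q \<and> f = h \<odot>\<^bsub>C\<^esub> g"
    by blast
qed

lemma compact_objects_eq_Union:
  "compact_objects \<kappa> \<alpha> C = \<Union>{A. coproduct_factoring \<kappa> \<alpha> C A}"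
  unfolding compact_objects_def
proof (rule the_equality)
  let ?U = "\<Union>{A. coproduct_factoring \<kappa> \<alpha> C A}"
  have U: "coproduct_factoring \<kappa> \<alpha> C ?U" by (rule coproduct_factoring_Union) simp
  show "coproduct_factoring \<kappa> \<alpha> C ?U \<and>
      (\<forall>B. coproduct_factoring \<kappa> \<alpha> C B \<and> ?U \<subseteq> B \<longrightarrow> B = ?U)"
    using U by blast
  fix A assume "coproduct_factoring \<kappa> \<alpha> C A \<and>
      (\<forall>B. coproduct_factoring \<kappa> \<alpha> C B \<and> A \<subseteq> B \<longrightarrow> B = A)"
  then show "A = ?U" using U by blast
qed

end

theory Submission
  imports Defs
begin

text \<open>
  Write \<open>Cpt \<nu>\<close> for the class of \<open>\<nu>\<close>-compact objects, and call \<open>Z\<close> hom-bounded if \<open>Hom(Y, Z)\<close> has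
  fewer than \<open>\<beta>\<close> elements for every \<open>Y\<close> in \<open>Cpt \<alpha>\<close>.

  \<open>Cpt \<nu>\<close> is the largest class \<open>A\<close> such that every morphism from a member of \<open>A\<close> to a coproduct
  \<open>\<Coprod>X\<^sub>i\<close> factors through a coproduct of fewer than \<open>\<nu>\<close> morphisms \<open>S\<^sub>i \<rightarrow> X\<^sub>i\<close> with \<open>S\<^sub>i\<close> in \<open>A\<close>: being small
  and factoring through members of \<open>A\<close> merge into this single condition (\<open>coproduct_factoring_iff\<close>).
  Hence membership is proved by coinduction, also up to coproducts (\<open>Cpt_coinduct_coprod\<close>), and one
  finds that \<open>Cpt \<nu>\<close> is closed under retracts, coproducts of fewer than \<open>\<nu>\<close> objects, shifts in both
  directions and cones, that it grows with \<open>\<nu>\<close>, and that \<open>Cpt \<alpha>\<close> contains the given generators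
  (\<open>generators_compact\<close>, where condition (b) on generators enters). So \<open>Cpt \<alpha>\<close> detects zero
  objects, and surjectivity of \<open>Hom(S, -)\<close> for all \<open>S\<close> in \<open>Cpt \<alpha>\<close> passes to coproducts of morphisms.

  The engine is a homotopy colimit argument (\<open>generation\<close>). Given \<open>Z\<close>, build \<open>X\<^sub>0 \<rightarrow> X\<^sub>1 \<rightarrow> \<dots>\<close> over \<open>Z\<close>
  by covering \<open>Z\<close> with \<open>X\<^sub>0\<close> and then coning off a cover of the fibre of \<open>X\<^sub>n \<rightarrow> Z\<close>; then \<open>Z\<close> is a
  retract of the homotopy colimit. For uncountable \<open>\<alpha>\<close> the functor \<open>Hom(S, -)\<close> need not commute
  with the colimit. What replaces this is exactness of coproducts as seen by \<open>Cpt \<alpha>\<close>: the sequence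
  \<open>0 \<rightarrow> \<Coprod>X\<^sub>n \<rightarrow> \<Coprod>X\<^sub>n \<rightarrow> Z \<rightarrow> 0\<close> with first map \<open>1 - shift\<close> becomes short exact under \<open>Hom(S, -)\<close>,
  by comparison with the split sequence of the constant system \<open>Z\<close> (\<open>hocolim_retract\<close>).

  This argument is applied twice. If \<open>Z\<close> is hom-bounded, the covers need fewer than \<open>\<beta>\<close> summands, so
  the construction stays inside \<open>Cpt \<beta>\<close>. Conversely, the objects \<open>z\<close> such that every morphism from
  a \<open>\<beta>\<close>-compact object to \<open>z\<close> factors through a hom-bounded \<open>\<beta>\<close>-compact object are closed under
  cones and all small coproducts, so they are all objects; applied to the identity of a
  \<open>\<beta>\<close>-compact \<open>Z\<close>, this exhibits \<open>Z\<close> as a retract of a hom-bounded object.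

  The hypotheses on \<open>\<beta>\<close> enter through four consequences: \<open>\<beta>\<close> is regular, \<open>\<alpha> < \<beta>\<close>, up to isomorphism
  \<open>Cpt \<alpha>\<close> has fewer than \<open>\<beta>\<close> objects and morphisms, and a set with fewer than \<open>\<beta>\<close> elements has fewer than \<open>\<beta>\<close> subsets of size less than \<open>\<alpha>\<close>. The last one bounds
  the number of morphisms from a compact object to a coproduct (\<open>hom_bounded_coprod\<close>). It is clear
  if \<open>\<beta>\<close> is inaccessible; if \<open>\<beta>\<close> is the successor of \<open>\<mu> = \<gamma>^(<\<delta>)\<close>, it holds because
  \<open>\<mu>^(<\<delta>) = \<mu>\<close> for regular \<open>\<delta>\<close> (\<open>few_subsets_weak_power\<close>). The inequality \<open>\<alpha> < \<beta>\<close> follows from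
  \<open>T \<noteq> 0\<close>, which forces \<open>Cpt \<alpha>\<close> to have at least \<open>\<alpha>\<close> morphisms (\<open>card_Cpt_ge\<close>).
\<close>

section \<open>Arrows of a category\<close>

context category
begin

text \<open>
  Hom sets are disjoint, so an arrow determines its source and target. Rules about composites that
  are conditional on \<open>arr\<close>, \<open>dm\<close> and \<open>cd\<close> have no variables in the premises other than those on
  the left-hand side, and the simplifier can bring composites into right-associated normal form.
\<close>

definition arr :: "'m \<Rightarrow> bool" where
  "arr f \<longleftrightarrow> (\<exists>x\<in>Obj C. \<exists>y\<in>Obj C. f \<in> Hom C x y)"

definition dm :: "'m \<Rightarrow> 'o" where
  "dm f = (THE x. x \<in> Obj C \<and> (\<exists>y\<in>Obj C. f \<in> Hom C x y))"

definition cd :: "'m \<Rightarrow> 'o" where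
  "cd f = (THE y. y \<in> Obj C \<and> (\<exists>x\<in>Obj C. f \<in> Hom C x y))"

definition hom :: "'m \<Rightarrow> 'o \<Rightarrow> 'o \<Rightarrow> bool"  (\<open>_ : _ ~> _\<close> [51, 51, 51] 50) where
  "f : x ~> y \<longleftrightarrow> arr f \<and> dm f = x \<and> cd f = y"

lemma hom_iff: "f : x ~> y \<longleftrightarrow> x \<in> Obj C \<and> y \<in> Obj C \<and> f \<in> Hom C x y"
proof -
  have *: "dm f = x \<and> cd f = y" if "x \<in> Obj C" "y \<in> Obj C" "f \<in> Hom C x y" for x y
    unfolding dm_def cd_def
  proof (intro conjI the_equality)
    show "x' = x" if "x' \<in> Obj C \<and> (\<exists>y\<in>Obj C. f \<in> Hom C x' y)" for x'
      using that Hom_disjoint[of x y x'] \<open>x \<in> Obj C\<close> \<open>y \<in> Obj C\<close> \<open>f \<in> Hom C x y\<close> by blast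
    show "y' = y" if "y' \<in> Obj C \<and> (\<exists>x\<in>Obj C. f \<in> Hom C x y')" for y'
      using that Hom_disjoint[of x y _ y'] \<open>x \<in> Obj C\<close> \<open>y \<in> Obj C\<close> \<open>f \<in> Hom C x y\<close> by blast
  qed (use that in blast)+
  show ?thesis unfolding hom_def arr_def using * by blast
qed

lemma homI: "x \<in> Obj C \<Longrightarrow> y \<in> Obj C \<Longrightarrow> f \<in> Hom C x y \<Longrightarrow> f : x ~> y"
  by (simp add: hom_iff)

lemma homD: "f : x ~> y \<Longrightarrow> arr f" "f : x ~> y \<Longrightarrow> dm f = x" "f : x ~> y \<Longrightarrow> cd f = y"
  by (simp_all add: hom_def)

lemma hom_Obj: "f : x ~> y \<Longrightarrow> x \<in> Obj C" "f : x ~> y \<Longrightarrow> y \<in> Obj C"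
  "f : x ~> y \<Longrightarrow> f \<in> Hom C x y"
  by (simp_all add: hom_iff)

lemma arr_hom: "arr f \<Longrightarrow> f : dm f ~> cd f" by (simp add: hom_def)

lemma arr_Obj [simp]: "arr f \<Longrightarrow> dm f \<in> Obj C" "arr f \<Longrightarrow> cd f \<in> Obj C"
  using arr_hom hom_Obj by blast+

lemma comp_hom: "f : x ~> y \<Longrightarrow> g : y ~> z \<Longrightarrow> g \<odot> f : x ~> z"
  by (auto simp: hom_iff intro: Comp_closed)

lemma arr_comp [simp]:
  assumes "arr g" "arr f" "dm g = cd f"
  shows "arr (g \<odot> f)" "dm (g \<odot> f) = dm f" "cd (g \<odot> f) = cd g"
  using comp_hom[of f "dm f" "cd f" g "cd g"] assms arr_hom[of f] arr_hom[of g]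
  by (auto simp: hom_def)

lemma comp_assoc [simp]:
  assumes "arr h" "arr g" "arr f" "dm h = cd g" "dm g = cd f"
  shows "(h \<odot> g) \<odot> f = h \<odot> (g \<odot> f)"
proof (rule Comp_assoc[of "dm f" "cd f" "cd g" "cd h"])
  show "f \<in> Hom C (dm f) (cd f)" "g \<in> Hom C (cd f) (cd g)" "h \<in> Hom C (cd g) (cd h)"
    using assms arr_hom hom_Obj(3) by metis+
qed (use assms in auto)

lemma id_hom: "x \<in> Obj C \<Longrightarrow> Ident C x : x ~> x"
  by (simp add: hom_iff Ident_closed)

lemma arr_id [simp]:
  assumes "x \<in> Obj C"
  shows "arr (Ident C x)" "dm (Ident C x) = x" "cd (Ident C x) = x"
  using id_hom[OF assms] by (auto simp: hom_def)

lemma comp_id [simp]: "arr f \<Longrightarrow> x = dm f \<Longrightarrow> f \<odot> Ident C x = f"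
  using Comp_Ident arr_hom hom_iff by metis

lemma id_comp [simp]: "arr f \<Longrightarrow> y = cd f \<Longrightarrow> Ident C y \<odot> f = f"
  using Ident_Comp arr_hom hom_iff by metis

text \<open>Uses an equation \<open>q \<odot> s = t\<close> inside a composite in right-associated normal form.\<close>

lemma comp_reduce:
  assumes "q \<odot> s = t" "arr q" "arr s" "arr u" "dm q = cd s" "dm s = cd u"
  shows "q \<odot> (s \<odot> u) = t \<odot> u"
  using comp_assoc[of q s u] assms by simp

section \<open>Coproducts in a category\<close>

lemma coprodD:
  assumes "is_coproduct C I X P \<iota>"
  shows coprod_Obj: "P \<in> Obj C" and coprod_inj: "\<And>i. i \<in> I \<Longrightarrow> \<iota> i : X i ~> P"
  using assms by (auto simp: is_coproduct_def hom_iff)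

lemma coprod_obtain:
  assumes "is_coproduct C I X P \<iota>" "Z \<in> Obj C" "\<And>i. i \<in> I \<Longrightarrow> f i : X i ~> Z"
  obtains h where "h : P ~> Z" "\<And>i. i \<in> I \<Longrightarrow> h \<odot> \<iota> i = f i"
proof -
  have "\<exists>!h. h \<in> Hom C P Z \<and> (\<forall>i\<in>I. h \<odot> \<iota> i = f i)"
    using assms by (simp add: is_coproduct_def hom_iff)
  then show thesis using that coprod_Obj[OF assms(1)] assms(2) by (auto simp: hom_iff)
qed

lemma coprod_ex:
  assumes "is_coproduct C I X P \<iota>" "Z \<in> Obj C" "\<And>i. i \<in> I \<Longrightarrow> f i : X i ~> Z"
  shows "\<exists>h. h : P ~> Z \<and> (\<forall>i\<in>I. h \<odot> \<iota> i = f i)"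
  by (rule coprod_obtain[OF assms]) auto

lemma coprod_eqI:
  assumes "is_coproduct C I X P \<iota>" "h : P ~> Z" "h' : P ~> Z"
    "\<And>i. i \<in> I \<Longrightarrow> h \<odot> \<iota> i = h' \<odot> \<iota> i"
  shows "h = h'"
proof -
  have "h' \<odot> \<iota> i : X i ~> Z" if "i \<in> I" for i
    using comp_hom coprod_inj[OF assms(1) that] assms(3) by blast
  then have "\<exists>!k. k \<in> Hom C P Z \<and> (\<forall>i\<in>I. k \<odot> \<iota> i = h' \<odot> \<iota> i)"
    using assms hom_Obj by (simp add: is_coproduct_def)
  then show ?thesis using assms hom_Obj(3) by blast
qed

lemma coprodI:
  assumes "P \<in> Obj C" "\<And>i. i \<in> I \<Longrightarrow> \<iota> i : X i ~> P"
    and ex: "\<And>Z f. Z \<in> Obj C \<Longrightarrow> (\<And>i. i \<in> I \<Longrightarrow> f i : X i ~> Z) \<Longrightarrow>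
        \<exists>h. h : P ~> Z \<and> (\<forall>i\<in>I. h \<odot> \<iota> i = f i)"
    and uniq: "\<And>Z h h'. h : P ~> Z \<Longrightarrow> h' : P ~> Z \<Longrightarrow>
        (\<And>i. i \<in> I \<Longrightarrow> h \<odot> \<iota> i = h' \<odot> \<iota> i) \<Longrightarrow> h = h'"
  shows "is_coproduct C I X P \<iota>"
  unfolding is_coproduct_def
proof (intro conjI allI ballI impI)
  fix Z f assume Z: "Z \<in> Obj C" and f: "\<forall>i\<in>I. f i \<in> Hom C (X i) Z"
  have f: "f i : X i ~> Z" if "i \<in> I" for i using f that Z assms(2)[OF that] hom_iff by blast
  obtain h where h: "h : P ~> Z" "\<forall>i\<in>I. h \<odot> \<iota> i = f i" using ex[OF Z f] by blast
  show "\<exists>!h. h \<in> Hom C P Z \<and> (\<forall>i\<in>I. h \<odot> \<iota> i = f i)"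
  proof (rule ex1I)
    show "h \<in> Hom C P Z \<and> (\<forall>i\<in>I. h \<odot> \<iota> i = f i)" using h hom_Obj by blast
    fix k assume k: "k \<in> Hom C P Z \<and> (\<forall>i\<in>I. k \<odot> \<iota> i = f i)"
    show "k = h" by (rule uniq[of _ Z]) (use k h Z assms(1) in \<open>auto simp: homI\<close>)
  qed
qed (use assms(1,2) hom_iff in auto)

lemma coprod_reindex:
  assumes "is_coproduct C I X P \<iota>" "bij_betw b J I"
  shows "is_coproduct C J (\<lambda>j. X (b j)) P (\<lambda>j. \<iota> (b j))"
proof (rule coprodI)
  have b: "b j \<in> I" if "j \<in> J" for j using assms(2) that by (auto simp: bij_betw_def)
  show "P \<in> Obj C" by (rule coprod_Obj[OF assms(1)])
  show "\<iota> (b j) : X (b j) ~> P" if "j \<in> J" for j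
    using coprod_inj[OF assms(1) b[OF that]] .
  define c where "c = inv_into J b"
  have c: "c i \<in> J" "b (c i) = i" if "i \<in> I" for i
    using assms(2) that bij_betw_inv_into_right[OF assms(2)] bij_betwE[OF bij_betw_inv_into[OF assms(2)]]
    by (auto simp: c_def)
  have cb: "c (b j) = j" if "j \<in> J" for j
    using assms(2) that by (simp add: c_def bij_betw_inv_into_left)
  fix Z
  {
    fix f assume Z: "Z \<in> Obj C" and f: "\<And>j. j \<in> J \<Longrightarrow> f j : X (b j) ~> Z"
    have "f (c i) : X i ~> Z" if "i \<in> I" for i using f[OF c(1)[OF that]] c(2)[OF that] by simp
    from coprod_obtain[OF assms(1) Z this] obtain h where
      h: "h : P ~> Z" "\<And>i. i \<in> I \<Longrightarrow> h \<odot> \<iota> i = f (c i)" by blast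
    then show "\<exists>h. h : P ~> Z \<and> (\<forall>j\<in>J. h \<odot> \<iota> (b j) = f j)"
      using b cb by auto
  }
  {
    fix h h' assume h: "h : P ~> Z" "h' : P ~> Z"
      "\<And>j. j \<in> J \<Longrightarrow> h \<odot> \<iota> (b j) = h' \<odot> \<iota> (b j)"
    show "h = h'" by (rule coprod_eqI[OF assms(1) h(1,2)]) (use h(3) c in metis)
  }
qed

lemma coprod_unreindex:
  assumes "is_coproduct C J Y P \<iota>" "bij_betw b J I" "\<And>j. j \<in> J \<Longrightarrow> X (b j) = Y j"
  shows "is_coproduct C I X P (\<lambda>i. \<iota> (inv_into J b i))"
proof -
  have "is_coproduct C I (\<lambda>i. Y (inv_into J b i)) P (\<lambda>i. \<iota> (inv_into J b i))"
    by (rule coprod_reindex[OF assms(1) bij_betw_inv_into[OF assms(2)]])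
  moreover have "Y (inv_into J b i) = X i" if "i \<in> I" for i
    using assms(3)[of "inv_into J b i"] bij_betw_inv_into_right[OF assms(2) that]
      bij_betwE[OF bij_betw_inv_into[OF assms(2)]] that by metis
  ultimately show ?thesis unfolding is_coproduct_def by simp
qed

lemma coprod_Sigma:
  assumes "is_coproduct C I Q P \<iota>" "\<And>i. i \<in> I \<Longrightarrow> is_coproduct C (J i) (X i) (Q i) (\<lambda>j. \<iota>' i j)"
  shows "is_coproduct C (Sigma I J) (\<lambda>(i, j). X i j) P (\<lambda>(i, j). \<iota> i \<odot> \<iota>' i j)"
proof (rule coprodI)
  show "P \<in> Obj C" by (rule coprod_Obj[OF assms(1)])
  note i1 = coprod_inj[OF assms(1)] and i2 = coprod_inj[OF assms(2)]
  show "(case p of (i, j) \<Rightarrow> \<iota> i \<odot> \<iota>' i j) : (case p of (i, j) \<Rightarrow> X i j) ~> P" if "p \<in> Sigma I J" for p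
    using that by (auto intro: comp_hom i1 i2)
  fix Z
  {
    fix f assume Z: "Z \<in> Obj C"
      and f: "\<And>p. p \<in> Sigma I J \<Longrightarrow> f p : (case p of (i, j) \<Rightarrow> X i j) ~> Z"
    have "\<exists>k. k : Q i ~> Z \<and> (\<forall>j\<in>J i. k \<odot> \<iota>' i j = f (i, j))" if i: "i \<in> I" for i
    proof -
      have "f (i, j) : X i j ~> Z" if "j \<in> J i" for j using f[of "(i, j)"] i that by simp
      from coprod_obtain[OF assms(2)[OF i] Z this] show ?thesis by metis
    qed
    then obtain k where k: "\<And>i. i \<in> I \<Longrightarrow> k i : Q i ~> Z"
      "\<And>i j. i \<in> I \<Longrightarrow> j \<in> J i \<Longrightarrow> k i \<odot> \<iota>' i j = f (i, j)" by metis
    from coprod_obtain[OF assms(1) Z k(1)] obtain h where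
      h: "h : P ~> Z" "\<And>i. i \<in> I \<Longrightarrow> h \<odot> \<iota> i = k i" by blast
    have "h \<odot> (\<iota> i \<odot> \<iota>' i j) = f (i, j)" if "i \<in> I" "j \<in> J i" for i j
      using comp_reduce[OF h(2)[OF that(1)]] k(2) that h(1) i1[OF that(1)] i2[OF that]
      by (simp add: hom_def)
    then show "\<exists>h. h : P ~> Z \<and> (\<forall>p\<in>Sigma I J. h \<odot> (case p of (i, j) \<Rightarrow> \<iota> i \<odot> \<iota>' i j) = f p)"
      using h(1) by auto
  }
  {
    fix h h' assume h: "h : P ~> Z" "h' : P ~> Z"
      "\<And>p. p \<in> Sigma I J \<Longrightarrow> h \<odot> (case p of (i, j) \<Rightarrow> \<iota> i \<odot> \<iota>' i j) = h' \<odot> (case p of (i, j) \<Rightarrow> \<iota> i \<odot> \<iota>' i j)"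
    show "h = h'"
    proof (rule coprod_eqI[OF assms(1) h(1,2)])
      fix i assume i: "i \<in> I"
      show "h \<odot> \<iota> i = h' \<odot> \<iota> i"
      proof (rule coprod_eqI[OF assms(2)[OF i]])
        show "h \<odot> \<iota> i : Q i ~> Z" "h' \<odot> \<iota> i : Q i ~> Z" using comp_hom i1[OF i] h by blast+
        fix j assume j: "j \<in> J i"
        show "(h \<odot> \<iota> i) \<odot> \<iota>' i j = (h' \<odot> \<iota> i) \<odot> \<iota>' i j"
          using h(3)[of "(i, j)"] i j h(1,2) i1[OF i] i2[OF i j] by (simp add: hom_def)
      qed
    qed
  }
qed

lemma isomorphic_iff:
  assumes "x \<in> Obj C" "y \<in> Obj C"
  shows "isomorphic C x y \<longleftrightarrow>
    (\<exists>f g. f : x ~> y \<and> g : y ~> x \<and> g \<odot> f = Ident C x \<and> f \<odot> g = Ident C y)"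
  using assms by (auto simp: isomorphic_def is_iso_def hom_iff)

lemma isomorphicI:
  assumes "f : x ~> y" "g : y ~> x" "g \<odot> f = Ident C x" "f \<odot> g = Ident C y"
  shows "isomorphic C x y"
  using assms isomorphic_iff[of x y] hom_Obj[of f x y] by blast

lemma isomorphic_obtain:
  assumes "isomorphic C x y" "x \<in> Obj C" "y \<in> Obj C"
  obtains f g where "f : x ~> y" "g : y ~> x" "g \<odot> f = Ident C x" "f \<odot> g = Ident C y"
  using assms isomorphic_iff by blast

lemma isomorphic_refl:
  assumes "x \<in> Obj C" shows "isomorphic C x x"
proof -
  have "Ident C x \<odot> Ident C x = Ident C x" using assms by simp
  then show ?thesis using isomorphic_iff[OF assms assms] id_hom[OF assms] by blast
qed

lemma isomorphic_sym: "x \<in> Obj C \<Longrightarrow> y \<in> Obj C \<Longrightarrow> isomorphic C x y \<Longrightarrow> isomorphic C y x"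
  using isomorphic_iff[of x y] isomorphic_iff[of y x] by blast

lemma isomorphic_trans:
  assumes "x \<in> Obj C" "y \<in> Obj C" "z \<in> Obj C" "isomorphic C x y" "isomorphic C y z"
  shows "isomorphic C x z"
proof -
  obtain f g where fg: "f : x ~> y" "g : y ~> x" "g \<odot> f = Ident C x" "f \<odot> g = Ident C y"
    using isomorphic_obtain[OF assms(4) assms(1,2)] by blast
  obtain f' g' where fg': "f' : y ~> z" "g' : z ~> y" "g' \<odot> f' = Ident C y" "f' \<odot> g' = Ident C z"
    using isomorphic_obtain[OF assms(5) assms(2,3)] by blast
  have "(g \<odot> g') \<odot> (f' \<odot> f) = Ident C x"
    using fg fg' comp_reduce[OF fg'(3), of f] by (simp add: hom_def)
  moreover have "(f' \<odot> f) \<odot> (g \<odot> g') = Ident C z"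
    using fg fg' comp_reduce[OF fg(4), of g'] by (simp add: hom_def)
  ultimately show ?thesis using isomorphicI[OF comp_hom[OF fg(1) fg'(1)] comp_hom[OF fg'(2) fg(2)]] by blast
qed

end

section \<open>Addition of arrows\<close>

context additive_category
begin

lemma group_laws:
  assumes "x \<in> Obj C" "y \<in> Obj C"
  shows "f \<in> Hom C x y \<Longrightarrow> g \<in> Hom C x y \<Longrightarrow> Add C f g \<in> Hom C x y"
    "Zero C x y \<in> Hom C x y"
    "f \<in> Hom C x y \<Longrightarrow> g \<in> Hom C x y \<Longrightarrow> h \<in> Hom C x y \<Longrightarrow> Add C (Add C f g) h = Add C f (Add C g h)"
    "f \<in> Hom C x y \<Longrightarrow> g \<in> Hom C x y \<Longrightarrow> Add C f g = Add C g f"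
    "f \<in> Hom C x y \<Longrightarrow> Add C f (Zero C x y) = f"
    "f \<in> Hom C x y \<Longrightarrow> \<exists>g \<in> Hom C x y. Add C f g = Zero C x y"
proof -
  interpret G: comm_group "hom_group C x y" by (rule hom_comm_group[OF assms])
  have [simp]: "carrier (hom_group C x y) = Hom C x y" "mult (hom_group C x y) = Add C"
    "one (hom_group C x y) = Zero C x y" by (simp_all add: hom_group_def)
  show "f \<in> Hom C x y \<Longrightarrow> g \<in> Hom C x y \<Longrightarrow> Add C f g \<in> Hom C x y"
    "Zero C x y \<in> Hom C x y"
    "f \<in> Hom C x y \<Longrightarrow> g \<in> Hom C x y \<Longrightarrow> h \<in> Hom C x y \<Longrightarrow> Add C (Add C f g) h = Add C f (Add C g h)"
    "f \<in> Hom C x y \<Longrightarrow> g \<in> Hom C x y \<Longrightarrow> Add C f g = Add C g f"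
    "f \<in> Hom C x y \<Longrightarrow> Add C f (Zero C x y) = f"
    using G.m_closed[of f g] G.one_closed G.m_assoc[of f g h] G.m_comm[of f g] G.r_one[of f] by auto
  show "f \<in> Hom C x y \<Longrightarrow> \<exists>g \<in> Hom C x y. Add C f g = Zero C x y"
    using G.r_inv_ex by simp
qed

abbreviation add :: "'m \<Rightarrow> 'm \<Rightarrow> 'm" (infixl \<open>\<oplus>\<close> 65) where "f \<oplus> g \<equiv> Add C f g"

lemma add_hom: "f : x ~> y \<Longrightarrow> g : x ~> y \<Longrightarrow> f \<oplus> g : x ~> y"
  by (simp add: hom_iff group_laws)

lemma zero_hom: "x \<in> Obj C \<Longrightarrow> y \<in> Obj C \<Longrightarrow> Zero C x y : x ~> y"
  by (simp add: hom_iff group_laws)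

lemma arr_zero [simp]:
  assumes "x \<in> Obj C" "y \<in> Obj C"
  shows "arr (Zero C x y)" "dm (Zero C x y) = x" "cd (Zero C x y) = y"
  using zero_hom[OF assms] by (auto simp: hom_def)

lemma arr_add [simp]:
  assumes "arr f" "arr g" "dm g = dm f" "cd g = cd f"
  shows "arr (f \<oplus> g)" "dm (f \<oplus> g) = dm f" "cd (f \<oplus> g) = cd f"
  using add_hom[of f "dm f" "cd f" g] assms by (auto simp: hom_def)

lemma add_assoc [simp]:
  assumes "arr f" "arr g" "arr h" "dm g = dm f" "cd g = cd f" "dm h = dm g" "cd h = cd g"
  shows "(f \<oplus> g) \<oplus> h = f \<oplus> (g \<oplus> h)"
  by (rule group_laws(3)[of "dm f" "cd f"]) (use assms arr_hom[of f] arr_hom[of g] arr_hom[of h] hom_Obj in auto)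

lemma add_commute:
  assumes "arr f" "arr g" "dm g = dm f" "cd g = cd f"
  shows "f \<oplus> g = g \<oplus> f"
  by (rule group_laws(4)[of "dm f" "cd f"]) (use assms arr_hom[of f] arr_hom[of g] hom_Obj in auto)

lemma add_zero [simp]: "arr f \<Longrightarrow> x = dm f \<Longrightarrow> y = cd f \<Longrightarrow> f \<oplus> Zero C x y = f"
  using group_laws(5) arr_hom hom_Obj by metis

lemma zero_add [simp]: "arr f \<Longrightarrow> x = dm f \<Longrightarrow> y = cd f \<Longrightarrow> Zero C x y \<oplus> f = f"
  using add_zero add_commute[of f "Zero C x y"] by simp

lemma add_inverse:
  assumes "f : x ~> y" obtains g where "g : x ~> y" "f \<oplus> g = Zero C x y" "g \<oplus> f = Zero C x y"
proof -
  obtain g where "g \<in> Hom C x y" "f \<oplus> g = Zero C x y" using group_laws(6)[of x y f] assms hom_iff by blast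
  then show thesis using that add_commute[of f g] assms homI[of x y g] hom_Obj by (auto simp: hom_def)
qed

lemma add_left_cancel:
  assumes "h \<oplus> f = h \<oplus> g" "h : x ~> y" "f : x ~> y" "g : x ~> y"
  shows "f = g"
proof -
  obtain k where k: "k : x ~> y" "k \<oplus> h = Zero C x y" using add_inverse assms by metis
  have "f = (k \<oplus> h) \<oplus> f" unfolding k(2) using assms(3) by (simp add: hom_def)
  also have "\<dots> = k \<oplus> (h \<oplus> f)" by (rule add_assoc) (use assms(2-4) k(1) in \<open>simp_all add: hom_def\<close>)
  also have "\<dots> = (k \<oplus> h) \<oplus> g" unfolding assms(1)
    by (rule add_assoc[symmetric]) (use assms(2-4) k(1) in \<open>simp_all add: hom_def\<close>)
  also have "\<dots> = g" unfolding k(2) using assms(4) by (simp add: hom_def)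
  finally show ?thesis .
qed

lemma difference:
  assumes "f : x ~> y" "g : x ~> y" obtains d where "d : x ~> y" "f = g \<oplus> d"
proof -
  obtain k where k: "k : x ~> y" "g \<oplus> k = Zero C x y" using add_inverse assms by metis
  have "(g \<oplus> k) \<oplus> f = f" unfolding k(2) using assms by (simp add: hom_def)
  then have "f = g \<oplus> (k \<oplus> f)" using assms k(1) by (simp add: hom_def)
  then show thesis using that add_hom[OF k(1) assms(1)] by blast
qed

lemma comp_add [simp]:
  assumes "arr g" "arr f" "arr f'" "dm g = cd f" "dm f' = dm f" "cd f' = cd f"
  shows "g \<odot> (f \<oplus> f') = (g \<odot> f) \<oplus> (g \<odot> f')"
  by (rule Comp_Add[of "dm f" "cd f" "cd g"])
     (use assms arr_hom[of f] arr_hom[of f'] arr_hom[of g] hom_Obj in auto)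

lemma add_comp [simp]:
  assumes "arr g" "arr g'" "arr f" "dm g = cd f" "dm g' = dm g" "cd g' = cd g"
  shows "(g \<oplus> g') \<odot> f = (g \<odot> f) \<oplus> (g' \<odot> f)"
  by (rule Add_Comp[of "dm f" "cd f" "cd g"])
     (use assms arr_hom[of f] arr_hom[of g'] arr_hom[of g] hom_Obj in auto)

lemma comp_zero [simp]:
  assumes "arr g" "x \<in> Obj C" "y = dm g"
  shows "g \<odot> Zero C x y = Zero C x (cd g)"
proof (rule add_left_cancel[of "g \<odot> Zero C x y" _ _ x "cd g"])
  have y: "y \<in> Obj C" using assms by simp
  have z: "Zero C x y \<oplus> Zero C x y = Zero C x y" using assms(2) y by simp
  have "(g \<odot> Zero C x y) \<oplus> (g \<odot> Zero C x y) = g \<odot> (Zero C x y \<oplus> Zero C x y)"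
    by (rule comp_add[symmetric]) (use assms y in simp_all)
  also have "\<dots> = (g \<odot> Zero C x y) \<oplus> Zero C x (cd g)" unfolding z using assms y by simp
  finally show "(g \<odot> Zero C x y) \<oplus> (g \<odot> Zero C x y) = (g \<odot> Zero C x y) \<oplus> Zero C x (cd g)" .
qed (use assms in \<open>auto simp: hom_def\<close>)

lemma zero_comp [simp]:
  assumes "arr g" "y \<in> Obj C" "x = cd g"
  shows "Zero C x y \<odot> g = Zero C (dm g) y"
proof (rule add_left_cancel[of "Zero C x y \<odot> g" _ _ "dm g" y])
  have x: "x \<in> Obj C" using assms by simp
  have z: "Zero C x y \<oplus> Zero C x y = Zero C x y" using assms(2) x by simp
  have "(Zero C x y \<odot> g) \<oplus> (Zero C x y \<odot> g) = (Zero C x y \<oplus> Zero C x y) \<odot> g"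
    by (rule add_comp[symmetric]) (use assms x in simp_all)
  also have "\<dots> = (Zero C x y \<odot> g) \<oplus> Zero C (dm g) y" unfolding z using assms x by simp
  finally show "(Zero C x y \<odot> g) \<oplus> (Zero C x y \<odot> g) = (Zero C x y \<odot> g) \<oplus> Zero C (dm g) y" .
qed (use assms in \<open>auto simp: hom_def\<close>)

lemma zero_object_hom:
  assumes "is_zero_object C z"
  shows "z \<in> Obj C" "f : x ~> z \<Longrightarrow> f = Zero C x z" "f : z ~> x \<Longrightarrow> f = Zero C z x"
  using assms by (auto simp: is_zero_object_def hom_iff)

lemma is_zero_objectI:
  assumes "z \<in> Obj C" "Ident C z = Zero C z z"
  shows "is_zero_object C z"
  unfolding is_zero_object_def
proof (intro conjI ballI assms(1))
  fix x assume x: "x \<in> Obj C"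
  have "f = Zero C x z" if "f : x ~> z" for f
  proof -
    have "f = Ident C z \<odot> f" using that by (simp add: hom_def)
    also have "\<dots> = Zero C x z" unfolding assms(2) using that assms(1) by (simp add: hom_def)
    finally show ?thesis .
  qed
  then show "Hom C x z = {Zero C x z}" using x assms(1) group_laws(2) hom_iff by blast
  have "f = Zero C z x" if "f : z ~> x" for f
  proof -
    have "f = f \<odot> Ident C z" using that by (simp add: hom_def)
    also have "\<dots> = Zero C z x" unfolding assms(2) using that assms(1) by (simp add: hom_def)
    finally show ?thesis .
  qed
  then show "Hom C z x = {Zero C z x}" using x assms(1) group_laws(2) hom_iff by blast
qed

end

section \<open>Exactness in triangulated categories\<close>

context triangulated_category
begin

notation hom (\<open>_ : _ ~> _\<close> [51, 51, 51] 50) and add (infixl \<open>\<oplus>\<close> 65)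

abbreviation \<Sigma> :: "'o \<Rightarrow> 'o" where "\<Sigma> \<equiv> ShiftO T"
abbreviation \<sigma> :: "'m \<Rightarrow> 'm" where "\<sigma> \<equiv> ShiftM T"

lemma shift_Obj [simp]: "x \<in> Obj T \<Longrightarrow> \<Sigma> x \<in> Obj T" by (rule ShiftO_closed)

lemma shift_hom: "f : x ~> y \<Longrightarrow> \<sigma> f : \<Sigma> x ~> \<Sigma> y"
  using ShiftM_bij[of x y] by (auto simp: hom_iff bij_betw_def)

lemma arr_shift [simp]:
  assumes "arr f" shows "arr (\<sigma> f)" "dm (\<sigma> f) = \<Sigma> (dm f)" "cd (\<sigma> f) = \<Sigma> (cd f)"
  using shift_hom[OF arr_hom[OF assms]] by (auto simp: hom_def)

lemma shift_id [simp]: "x \<in> Obj T \<Longrightarrow> \<sigma> (Ident T x) = Ident T (\<Sigma> x)"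
  by (rule ShiftM_Ident)

lemma shift_comp [simp]:
  assumes "arr g" "arr f" "dm g = cd f"
  shows "\<sigma> (g \<odot> f) = \<sigma> g \<odot> \<sigma> f"
  by (rule ShiftM_Comp[of "dm f" "cd f" "cd g"])
     (use assms arr_hom[of f] arr_hom[of g] hom_Obj in auto)

lemma shift_add [simp]:
  assumes "arr f" "arr g" "dm g = dm f" "cd g = cd f"
  shows "\<sigma> (f \<oplus> g) = \<sigma> f \<oplus> \<sigma> g"
  by (rule ShiftM_Add[of "dm f" "cd f"])
     (use assms arr_hom[of f] arr_hom[of g] hom_Obj in auto)

lemma shift_zero [simp]:
  assumes "x \<in> Obj T" "y \<in> Obj T"
  shows "\<sigma> (Zero T x y) = Zero T (\<Sigma> x) (\<Sigma> y)"
proof (rule add_left_cancel[of "\<sigma> (Zero T x y)" _ _ "\<Sigma> x" "\<Sigma> y"])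
  have "\<sigma> (Zero T x y) \<oplus> \<sigma> (Zero T x y) = \<sigma> (Zero T x y \<oplus> Zero T x y)"
    using assms by (intro shift_add[symmetric]) auto
  also have "\<dots> = \<sigma> (Zero T x y)" using assms by (subst add_zero) auto
  finally show "\<sigma> (Zero T x y) \<oplus> \<sigma> (Zero T x y) = \<sigma> (Zero T x y) \<oplus> Zero T (\<Sigma> x) (\<Sigma> y)"
    using assms by simp
qed (use assms in \<open>auto simp: hom_def\<close>)

lemma shift_full:
  assumes "g : \<Sigma> x ~> \<Sigma> y" "x \<in> Obj T" "y \<in> Obj T"
  obtains f where "f : x ~> y" "g = \<sigma> f"
proof -
  have "g \<in> \<sigma> ` Hom T x y" using ShiftM_bij[OF assms(2,3)] assms(1) by (auto simp: hom_iff bij_betw_def)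
  then show thesis using that assms(2,3) homI by blast
qed

lemma shift_faithful:
  assumes "\<sigma> f = \<sigma> g" "f : x ~> y" "g : x ~> y"
  shows "f = g"
  using ShiftM_bij[of x y] assms by (auto simp: hom_iff bij_betw_def inj_on_def)

lemma unshift:
  assumes "y \<in> Obj T"
  obtains x u v where "x \<in> Obj T" "u : \<Sigma> x ~> y" "v : y ~> \<Sigma> x"
    "v \<odot> u = Ident T (\<Sigma> x)" "u \<odot> v = Ident T y"
proof -
  obtain x where x: "x \<in> Obj T" "isomorphic T (\<Sigma> x) y" using ShiftO_ess_surj[OF assms] by blast
  then show thesis using isomorphic_obtain[OF x(2) shift_Obj[OF x(1)] assms] that by blast
qed

lemma zero_object_obtain:
  obtains z where "is_zero_object T z" "z \<in> Obj T"
  using zero_object_exists zero_object_hom(1) by blast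

lemma shift_zero_object:
  assumes "is_zero_object T z" shows "is_zero_object T (\<Sigma> z)"
proof -
  have z: "z \<in> Obj T" using assms zero_object_hom by blast
  then have "Ident T z = Zero T z z" using assms zero_object_hom(2) id_hom by blast
  then have "Ident T (\<Sigma> z) = Zero T (\<Sigma> z) (\<Sigma> z)" using shift_id[OF z] shift_zero[OF z z] by simp
  then show ?thesis using is_zero_objectI z by simp
qed

lemma triangle_hom:
  assumes "exact_triangle T x y z f g h"
  shows "f : x ~> y" "g : y ~> z" "h : z ~> \<Sigma> x"
  using assms by (auto simp: exact_triangle_def candidate_triangle_def hom_iff)

lemma triangle_iff:
  "exact_triangle T x y z f g h \<longleftrightarrow>
    f : x ~> y \<and> g : y ~> z \<and> h : z ~> \<Sigma> x \<and> (f, g, h) \<in> Triangles T"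
  by (auto simp: exact_triangle_def candidate_triangle_def hom_iff)

lemma inv_hom_group:
  assumes "f : x ~> y" "f' : x ~> y" "f \<oplus> f' = Zero T x y"
  shows "inv\<^bsub>hom_group T x y\<^esub> f = f'"
proof -
  have z0: "x \<in> Obj T" "y \<in> Obj T" using assms hom_Obj by blast+
  interpret G: comm_group "hom_group T x y" by (rule hom_comm_group[OF z0])
  have "f' \<oplus> f = Zero T x y" using assms add_commute[of f f'] by (simp add: hom_def)
  then show ?thesis
    by (intro G.inv_equality) (use assms hom_Obj(3) in \<open>auto simp: hom_group_def\<close>)
qed

lemma rotate:
  assumes "exact_triangle T x y z f g h"
  obtains f' where "exact_triangle T y z (\<Sigma> x) g h f'" "f' : \<Sigma> x ~> \<Sigma> y"
    "\<sigma> f \<oplus> f' = Zero T (\<Sigma> x) (\<Sigma> y)"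
proof -
  note t = triangle_hom[OF assms]
  obtain f' where f': "f' : \<Sigma> x ~> \<Sigma> y" "\<sigma> f \<oplus> f' = Zero T (\<Sigma> x) (\<Sigma> y)"
    using add_inverse[OF shift_hom[OF t(1)]] by blast
  have "(g, h, f') \<in> Triangles T"
    using TR2_rotate[of x y z f g h] assms inv_hom_group[OF shift_hom[OF t(1)] f']
    by (auto simp: exact_triangle_def)
  then show thesis using that f' t by (simp add: triangle_iff)
qed

lemma unrotate:
  assumes "exact_triangle T y z (\<Sigma> x) g h f'" "f : x ~> y" "\<sigma> f \<oplus> f' = Zero T (\<Sigma> x) (\<Sigma> y)"
  shows "exact_triangle T x y z f g h"
proof -
  note t = triangle_hom[OF assms(1)]
  have "candidate_triangle T x y z f g h" using t assms(2) by (auto simp: candidate_triangle_def hom_iff)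
  then show ?thesis
    using TR2_rotate[of x y z f g h] assms(1) inv_hom_group[OF shift_hom[OF assms(2)] t(3) assms(3)]
    by (auto simp: exact_triangle_def)
qed

text \<open>
  Rotation replaces \<open>f\<close> by \<open>-\<Sigma>f\<close>. The sign does not matter for the vanishing of composites, and all
  exactness statements below are free of signs.
\<close>

lemma neg_comp_zero:
  assumes "f \<oplus> f' = Zero T x y" "f : x ~> y" "f' : x ~> y" "k : w ~> x"
  shows "f' \<odot> k = Zero T w y \<longleftrightarrow> f \<odot> k = Zero T w y"
proof -
  have "(f \<odot> k) \<oplus> (f' \<odot> k) = (f \<oplus> f') \<odot> k" using assms(2-4) by (simp add: hom_def)
  also have "\<dots> = Zero T w y" unfolding assms(1) using assms(2-4) by (auto simp: hom_def)
  finally have *: "(f \<odot> k) \<oplus> (f' \<odot> k) = Zero T w y" .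
  show ?thesis using * assms(2-4) by (auto simp: hom_def)
qed

lemma triangle_id:
  assumes "w \<in> Obj T" "is_zero_object T z"
  shows "exact_triangle T w w z (Ident T w) (Zero T w z) (Zero T z (\<Sigma> w))"
  using TR1_Ident[OF assms] assms id_hom zero_hom zero_object_hom(1) by (simp add: triangle_iff)

text \<open>Compare the triangle on \<open>x = x\<close> with the given one.\<close>

lemma triangle_comp_zero:
  assumes "exact_triangle T x y z f g h"
  shows "g \<odot> f = Zero T x z"
proof -
  note t = triangle_hom[OF assms]
  obtain z0 where z0: "is_zero_object T z0" "z0 \<in> Obj T" by (rule zero_object_obtain)
  have x: "x \<in> Obj T" using t hom_Obj by blast
  have e: "f \<odot> Ident T x = f \<odot> Ident T x" ..
  obtain w where w: "w \<in> Hom T z0 z" "w \<odot> Zero T x z0 = g \<odot> f"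
    using TR3_fill[OF triangle_id[OF x z0(1)] assms hom_Obj(3)[OF id_hom[OF x]] hom_Obj(3)[OF t(1)] e] by blast
  have "w : z0 ~> z" using w z0 t hom_iff by blast
  then show ?thesis using w(2) x z0(2) by (simp add: hom_def)
qed

lemma triangle_comp_zero2:
  assumes "exact_triangle T x y z f g h"
  shows "h \<odot> g = Zero T y (\<Sigma> x)"
  using rotate[OF assms] triangle_comp_zero by metis

lemma triangle_comp_zero3:
  assumes "exact_triangle T x y z f g h"
  shows "\<sigma> f \<odot> h = Zero T z (\<Sigma> y)"
proof -
  note t = triangle_hom[OF assms]
  obtain f' where f': "exact_triangle T y z (\<Sigma> x) g h f'" "f' : \<Sigma> x ~> \<Sigma> y"
    "\<sigma> f \<oplus> f' = Zero T (\<Sigma> x) (\<Sigma> y)" using rotate[OF assms] .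
  then show ?thesis using neg_comp_zero[OF f'(3) shift_hom[OF t(1)] f'(2) t(3)] triangle_comp_zero2[OF f'(1)]
    by simp
qed

text \<open>
  Exactness of \<open>Hom(s, -)\<close>: compare the rotated triangle \<open>s \<rightarrow> 0 \<rightarrow> \<Sigma> s \<rightarrow> \<Sigma> s\<close> with the rotation of
  the given one, and desuspend the filler.
\<close>

lemma triangle_lift:
  assumes "exact_triangle T x y z f g h" "k : s ~> y" "g \<odot> k = Zero T s z"
  obtains l where "l : s ~> x" "k = f \<odot> l"
proof -
  note t = triangle_hom[OF assms(1)]
  have s: "s \<in> Obj T" and obj: "x \<in> Obj T" "y \<in> Obj T" "z \<in> Obj T" using assms(2) t hom_Obj by blast+
  obtain z0 where z0: "is_zero_object T z0" "z0 \<in> Obj T" by (rule zero_object_obtain)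
  obtain i' where i': "exact_triangle T s z0 (\<Sigma> s) (Zero T s z0) (Zero T z0 (\<Sigma> s)) i'"
    "i' : \<Sigma> s ~> \<Sigma> s" "\<sigma> (Ident T s) \<oplus> i' = Zero T (\<Sigma> s) (\<Sigma> s)"
    using rotate[OF triangle_id[OF s z0(1)]] .
  obtain f' where f': "exact_triangle T y z (\<Sigma> x) g h f'" "f' : \<Sigma> x ~> \<Sigma> y"
    "\<sigma> f \<oplus> f' = Zero T (\<Sigma> x) (\<Sigma> y)" using rotate[OF assms(1)] .
  have sq: "Zero T z0 z \<odot> Zero T s z0 = g \<odot> k" using assms(3) s z0(2) obj by simp
  obtain w where w: "w \<in> Hom T (\<Sigma> s) (\<Sigma> x)" "\<sigma> k \<odot> i' = f' \<odot> w"
    using TR3_fill[OF i'(1) f'(1) hom_Obj(3)[OF assms(2)] hom_Obj(3)[OF zero_hom[OF z0(2) obj(3)]] sq] by blast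
  then have wh: "w : \<Sigma> s ~> \<Sigma> x" using s obj hom_iff by simp
  obtain l where l: "l : s ~> x" "w = \<sigma> l" using shift_full[OF wh s obj(1)] .
  \<comment> \<open>Both signs of the rotated triangles cancel.\<close>
  have "\<sigma> k \<oplus> (\<sigma> k \<odot> i') = \<sigma> k \<odot> (\<sigma> (Ident T s) \<oplus> i')"
    using i'(2) assms(2) s by (simp add: hom_def)
  also have "\<dots> = Zero T (\<Sigma> s) (\<Sigma> y)" unfolding i'(3) using assms(2) s by (simp add: hom_def)
  also have "\<dots> = (\<sigma> f \<oplus> f') \<odot> w" unfolding f'(3) using wh obj by (simp add: hom_def)
  also have "\<dots> = (\<sigma> f \<odot> w) \<oplus> (f' \<odot> w)" using f'(2) wh t by (simp add: hom_def)
  finally have "(\<sigma> k \<odot> i') \<oplus> \<sigma> k = (\<sigma> k \<odot> i') \<oplus> (\<sigma> f \<odot> w)"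
    unfolding w(2) using add_commute[of "f' \<odot> w" "\<sigma> k"] add_commute[of "f' \<odot> w" "\<sigma> f \<odot> w"]
      f'(2) wh t(1) assms(2) by (simp add: hom_def)
  then have "\<sigma> k = \<sigma> f \<odot> w"
    by (rule add_left_cancel[of _ _ _ "\<Sigma> s" "\<Sigma> y"])
       (use i'(2) assms(2) shift_hom wh t comp_hom in blast)+
  then have "\<sigma> k = \<sigma> (f \<odot> l)" using l t by (simp add: hom_def)
  then have "k = f \<odot> l" using shift_faithful assms(2) comp_hom[OF l(1) t(1)] by blast
  then show thesis using that l by blast
qed

text \<open>Exactness of \<open>Hom(-, w)\<close>: compare the given triangle with \<open>0 \<rightarrow> w = w \<rightarrow> 0\<close>.\<close>

lemma triangle_extend:
  assumes "exact_triangle T x y z f g h" "k : y ~> w" "k \<odot> f = Zero T x w"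
  obtains l where "l : z ~> w" "k = l \<odot> g"
proof -
  note t = triangle_hom[OF assms(1)]
  have w: "w \<in> Obj T" and obj: "x \<in> Obj T" "y \<in> Obj T" "z \<in> Obj T" using assms(2) t hom_Obj by blast+
  obtain z0 where z0: "is_zero_object T z0" "z0 \<in> Obj T" by (rule zero_object_obtain)
  have tr: "exact_triangle T z0 w w (Zero T z0 w) (Ident T w) (Zero T w (\<Sigma> z0))"
  proof (rule unrotate)
    show "exact_triangle T w w (\<Sigma> z0) (Ident T w) (Zero T w (\<Sigma> z0)) (Zero T (\<Sigma> z0) (\<Sigma> w))"
      by (rule triangle_id[OF w shift_zero_object[OF z0(1)]])
    show "\<sigma> (Zero T z0 w) \<oplus> Zero T (\<Sigma> z0) (\<Sigma> w) = Zero T (\<Sigma> z0) (\<Sigma> w)" using z0(2) w by simp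
  qed (use zero_hom[OF z0(2) w] in simp)
  have sq: "k \<odot> f = Zero T z0 w \<odot> Zero T x z0" using assms(3) z0(2) w obj by simp
  obtain l where l: "l \<in> Hom T z w" "l \<odot> g = Ident T w \<odot> k"
    using TR3_fill[OF assms(1) tr hom_Obj(3)[OF zero_hom[OF obj(1) z0(2)]] hom_Obj(3)[OF assms(2)] sq] by blast
  have "l : z ~> w" using l obj w hom_iff by blast
  moreover have "k = l \<odot> g" using l(2) assms(2) by (simp add: hom_def)
  ultimately show thesis using that by blast
qed

text \<open>Rotation gives exactness at the other two places of the triangle.\<close>

lemma triangle_lift2:
  assumes "exact_triangle T x y z f g h" "k : s ~> z" "h \<odot> k = Zero T s (\<Sigma> x)"
  obtains l where "l : s ~> y" "k = g \<odot> l"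
  using rotate[OF assms(1)] triangle_lift[OF _ assms(2,3)] by metis

lemma triangle_extend2:
  assumes "exact_triangle T x y z f g h" "k : z ~> w" "k \<odot> g = Zero T y w"
  obtains l where "l : \<Sigma> x ~> w" "k = l \<odot> h"
  using rotate[OF assms(1)] triangle_extend[OF _ assms(2,3)] by metis

lemma triangle_lift3:
  assumes "exact_triangle T x y z f g h" "k : s ~> \<Sigma> x" "\<sigma> f \<odot> k = Zero T s (\<Sigma> y)"
  obtains l where "l : s ~> z" "k = h \<odot> l"
proof -
  note t = triangle_hom[OF assms(1)]
  obtain f' where f': "exact_triangle T y z (\<Sigma> x) g h f'" "f' : \<Sigma> x ~> \<Sigma> y"
    "\<sigma> f \<oplus> f' = Zero T (\<Sigma> x) (\<Sigma> y)" using rotate[OF assms(1)] .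
  have "f' \<odot> k = Zero T s (\<Sigma> y)"
    using neg_comp_zero[OF f'(3) shift_hom[OF t(1)] f'(2) assms(2)] assms(3) by simp
  then show thesis using triangle_lift2[OF f'(1) assms(2)] that by blast
qed

lemma triangle_extend3:
  assumes "exact_triangle T x y z f g h" "k : \<Sigma> x ~> w" "k \<odot> h = Zero T z w"
  obtains l where "l : \<Sigma> y ~> w" "k = l \<odot> \<sigma> f"
proof -
  note t = triangle_hom[OF assms(1)]
  obtain f' where f': "exact_triangle T y z (\<Sigma> x) g h f'" "f' : \<Sigma> x ~> \<Sigma> y"
    "\<sigma> f \<oplus> f' = Zero T (\<Sigma> x) (\<Sigma> y)" using rotate[OF assms(1)] .
  obtain l where l: "l : \<Sigma> y ~> w" "k = l \<odot> f'" using triangle_extend2[OF f'(1) assms(2,3)] .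
  obtain l' where l': "l' : \<Sigma> y ~> w" "l \<oplus> l' = Zero T (\<Sigma> y) w" using add_inverse[OF l(1)] by metis
  have h1: "l' \<odot> \<sigma> f : \<Sigma> x ~> w" and h2: "l \<odot> f' : \<Sigma> x ~> w"
    and h3: "l \<odot> \<sigma> f : \<Sigma> x ~> w"
    using comp_hom shift_hom t(1) l l' f' by blast+
  have "(l \<odot> \<sigma> f) \<oplus> (l' \<odot> \<sigma> f) = (l \<oplus> l') \<odot> \<sigma> f"
    using l(1) l'(1) t(1) by (simp add: hom_def)
  also have "\<dots> = Zero T (\<Sigma> x) w" unfolding l'(2) using l(1) t(1) by (auto simp: hom_def)
  also have "\<dots> = l \<odot> (\<sigma> f \<oplus> f')" unfolding f'(3) using l(1) t(1) f'(2) by (auto simp: hom_def)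
  also have "\<dots> = (l \<odot> \<sigma> f) \<oplus> (l \<odot> f')" using l(1) t(1) f'(2) by (simp add: hom_def)
  finally have "l' \<odot> \<sigma> f = l \<odot> f'" using add_left_cancel h1 h2 h3 by blast
  then show thesis using that l' l by metis
qed

text \<open>
  In this and the next lemma, exactness is stated for two arrows with the same image; this avoids
  subtraction of arrows.
\<close>

lemma triangle_lift_diff:
  assumes "exact_triangle T x y z f g h" "k : s ~> y" "k' : s ~> y" "g \<odot> k = g \<odot> k'"
  obtains l where "l : s ~> x" "k = k' \<oplus> (f \<odot> l)"
proof -
  note t = triangle_hom[OF assms(1)]
  obtain d where d: "d : s ~> y" "k = k' \<oplus> d" using difference[OF assms(2,3)] .
  have "(g \<odot> k') \<oplus> (g \<odot> d) = (g \<odot> k') \<oplus> Zero T s z"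
    using assms(4) assms(3) d t(2) hom_Obj[OF t(2)] hom_Obj[OF d(1)] unfolding d(2) by (simp add: hom_def)
  then have "g \<odot> d = Zero T s z"
    by (rule add_left_cancel) (use assms(3) d t(2) comp_hom zero_hom hom_Obj in blast)+
  then show thesis using triangle_lift[OF assms(1) d(1)] d(2) that by metis
qed

lemma triangle_extend2_diff:
  assumes "exact_triangle T x y z f g h" "k : z ~> w" "k' : z ~> w" "k \<odot> g = k' \<odot> g"
  obtains l where "l : \<Sigma> x ~> w" "k = k' \<oplus> (l \<odot> h)"
proof -
  note t = triangle_hom[OF assms(1)]
  obtain d where d: "d : z ~> w" "k = k' \<oplus> d" using difference[OF assms(2,3)] .
  have "(k' \<odot> g) \<oplus> (d \<odot> g) = (k' \<odot> g) \<oplus> Zero T y w"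
    using assms(4) assms(3) d t(2) hom_Obj[OF t(2)] hom_Obj[OF d(1)] unfolding d(2) by (simp add: hom_def)
  then have "d \<odot> g = Zero T y w"
    by (rule add_left_cancel) (use assms(3) d t(2) comp_hom zero_hom hom_Obj in blast)+
  then show thesis using triangle_extend2[OF assms(1) d(1)] d(2) that by metis
qed

lemma cone_exists:
  assumes "f : x ~> y" obtains z g h where "exact_triangle T x y z f g h"
  using TR1_cone assms hom_Obj by metis

lemma triangle_fill:
  assumes "exact_triangle T x y z f g h" "exact_triangle T x' y' z' f' g' h'"
    "u : x ~> x'" "v : y ~> y'" "v \<odot> f = f' \<odot> u"
  obtains w where "w : z ~> z'" "w \<odot> g = g' \<odot> v" "\<sigma> u \<odot> h = h' \<odot> w"
proof -
  obtain w where "w \<in> Hom T z z'" "w \<odot> g = g' \<odot> v" "\<sigma> u \<odot> h = h' \<odot> w"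
    using TR3_fill[OF assms(1,2) hom_Obj(3)[OF assms(3)] hom_Obj(3)[OF assms(4)] assms(5)] by blast
  moreover have "z \<in> Obj T" "z' \<in> Obj T" using triangle_hom(2)[OF assms(1)] triangle_hom(2)[OF assms(2)] hom_Obj by blast+
  ultimately show thesis using that homI by blast
qed

text \<open>
  Rotate the triangle on \<open>g\<close> backwards. As \<open>\<Sigma>\<close> is only essentially surjective, the cone has to be
  replaced by an isomorphic object of the form \<open>\<Sigma> x\<close> first.
\<close>

lemma fibre_exists:
  assumes "g : y ~> z" obtains x f h where "exact_triangle T x y z f g h"
proof -
  obtain c b d where t: "exact_triangle T y z c g b d" using cone_exists[OF assms] .
  note t' = triangle_hom[OF t]
  have obj: "y \<in> Obj T" "z \<in> Obj T" "c \<in> Obj T" using t' hom_Obj by blast+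
  obtain x u v where u: "x \<in> Obj T" "u : \<Sigma> x ~> c" "v : c ~> \<Sigma> x"
    "v \<odot> u = Ident T (\<Sigma> x)" "u \<odot> v = Ident T c" using unshift[OF obj(3)] .
  have vb: "v \<odot> b : z ~> \<Sigma> x" and du: "d \<odot> u : \<Sigma> x ~> \<Sigma> y" using comp_hom t' u by blast+
  have iso: "is_iso T y y (Ident T y)" "is_iso T z z (Ident T z)" "is_iso T c (\<Sigma> x) v"
    unfolding is_iso_def using id_hom hom_Obj obj u by (metis comp_id homD)+
  have "(g, v \<odot> b, d \<odot> u) \<in> Triangles T"
  proof (rule Triangles_iso_closed[OF t _ iso])
    show "candidate_triangle T y z (\<Sigma> x) g (v \<odot> b) (d \<odot> u)"
      using vb du assms obj u(1) hom_Obj by (auto simp: candidate_triangle_def)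
    show "Ident T z \<odot> g = g \<odot> Ident T y" using assms by (simp add: hom_def)
    show "v \<odot> b = (v \<odot> b) \<odot> Ident T z" using vb by (simp add: hom_def)
    have "(d \<odot> u) \<odot> v = d \<odot> (u \<odot> v)" using t' u(2,3) by (simp add: hom_def)
    then show "\<sigma> (Ident T y) \<odot> d = (d \<odot> u) \<odot> v" using u(5) t' obj by (simp add: hom_def)
  qed
  then have tr: "exact_triangle T y z (\<Sigma> x) g (v \<odot> b) (d \<odot> u)" using assms vb du by (simp add: triangle_iff)
  obtain e where e: "e : \<Sigma> x ~> \<Sigma> y" "e \<oplus> (d \<odot> u) = Zero T (\<Sigma> x) (\<Sigma> y)"
    using add_inverse[OF du] by metis
  obtain f where f: "f : x ~> y" "e = \<sigma> f" using shift_full[OF e(1) u(1) obj(1)] .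
  show thesis using that unrotate[OF tr f(1)] e f by blast
qed

lemma shift_coprod:
  assumes "is_coproduct T I X P \<iota>"
  shows "is_coproduct T I (\<lambda>i. \<Sigma> (X i)) (\<Sigma> P) (\<lambda>i. \<sigma> (\<iota> i))"
proof (rule coprodI)
  have P: "P \<in> Obj T" by (rule coprod_Obj[OF assms])
  then show "\<Sigma> P \<in> Obj T" by simp
  note \<iota> = coprod_inj[OF assms]
  show "\<sigma> (\<iota> i) : \<Sigma> (X i) ~> \<Sigma> P" if "i \<in> I" for i using shift_hom \<iota>[OF that] .
  fix Z
  {
    fix f assume Z: "Z \<in> Obj T" and f: "\<And>i. i \<in> I \<Longrightarrow> f i : \<Sigma> (X i) ~> Z"
    obtain x u v where u: "x \<in> Obj T" "u : \<Sigma> x ~> Z" "v : Z ~> \<Sigma> x"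
      "v \<odot> u = Ident T (\<Sigma> x)" "u \<odot> v = Ident T Z" using unshift[OF Z] .
    have "\<exists>f'. f' : X i ~> x \<and> v \<odot> f i = \<sigma> f'" if "i \<in> I" for i
      using shift_full[OF comp_hom[OF f[OF that] u(3)] _ u(1)] \<iota>[OF that] hom_Obj by metis
    then obtain f' where f': "\<And>i. i \<in> I \<Longrightarrow> f' i : X i ~> x" "\<And>i. i \<in> I \<Longrightarrow> v \<odot> f i = \<sigma> (f' i)"
      by metis
    obtain h where h: "h : P ~> x" "\<And>i. i \<in> I \<Longrightarrow> h \<odot> \<iota> i = f' i"
      using coprod_obtain[OF assms u(1) f'(1)] by blast
    have "(u \<odot> \<sigma> h) \<odot> \<sigma> (\<iota> i) = f i" if i: "i \<in> I" for i
    proof -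
      have "(u \<odot> \<sigma> h) \<odot> \<sigma> (\<iota> i) = u \<odot> \<sigma> (h \<odot> \<iota> i)" using u h(1) \<iota>[OF i] by (simp add: hom_def)
      also have "\<dots> = u \<odot> (v \<odot> f i)" using h(2)[OF i] f'(2)[OF i] by simp
      also have "\<dots> = (u \<odot> v) \<odot> f i" using u(2,3) f[OF i] by (simp add: hom_def)
      also have "\<dots> = f i" unfolding u(5) using f[OF i] by (simp add: hom_def)
      finally show ?thesis .
    qed
    then show "\<exists>h. h : \<Sigma> P ~> Z \<and> (\<forall>i\<in>I. h \<odot> \<sigma> (\<iota> i) = f i)"
      using comp_hom[OF shift_hom[OF h(1)] u(2)] by blast
  }
  {
    fix h h' assume h: "h : \<Sigma> P ~> Z" "h' : \<Sigma> P ~> Z"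
      and eq: "\<And>i. i \<in> I \<Longrightarrow> h \<odot> \<sigma> (\<iota> i) = h' \<odot> \<sigma> (\<iota> i)"
    have Z: "Z \<in> Obj T" using h hom_Obj by blast
    obtain x u v where u: "x \<in> Obj T" "u : \<Sigma> x ~> Z" "v : Z ~> \<Sigma> x"
      "v \<odot> u = Ident T (\<Sigma> x)" "u \<odot> v = Ident T Z" using unshift[OF Z] .
    obtain a where a: "a : P ~> x" "v \<odot> h = \<sigma> a" using shift_full[OF comp_hom[OF h(1) u(3)] P u(1)] .
    obtain b where b: "b : P ~> x" "v \<odot> h' = \<sigma> b" using shift_full[OF comp_hom[OF h(2) u(3)] P u(1)] .
    have "a = b"
    proof (rule coprod_eqI[OF assms a(1) b(1)])
      fix i assume i: "i \<in> I"
      have "\<sigma> (a \<odot> \<iota> i) = (v \<odot> h) \<odot> \<sigma> (\<iota> i)" unfolding a(2) using a(1) \<iota>[OF i] by (simp add: hom_def)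
      also have "\<dots> = (v \<odot> h') \<odot> \<sigma> (\<iota> i)" using eq[OF i] h u(3) \<iota>[OF i] by (simp add: hom_def)
      also have "\<dots> = \<sigma> (b \<odot> \<iota> i)" unfolding b(2) using b(1) \<iota>[OF i] by (simp add: hom_def)
      finally show "a \<odot> \<iota> i = b \<odot> \<iota> i" using shift_faithful comp_hom \<iota>[OF i] a(1) b(1) by blast
    qed
    then have vh: "v \<odot> h = v \<odot> h'" using a b by simp
    have "h = (u \<odot> v) \<odot> h" unfolding u(5) using h(1) by (simp add: hom_def)
    also have "\<dots> = u \<odot> (v \<odot> h)" using u(2,3) h(1) by (simp add: hom_def)
    also have "\<dots> = (u \<odot> v) \<odot> h'" unfolding vh using u(2,3) h(2) by (simp add: hom_def)
    also have "\<dots> = h'" unfolding u(5) using h(2) by (simp add: hom_def)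
    finally show "h = h'" .
  }
qed

end

section \<open>Sets below a regular cardinal\<close>

lemma card_subset_less: "A \<subseteq> B \<Longrightarrow> |B| <o r \<Longrightarrow> |A| <o r"
  using card_of_mono1 ordLeq_ordLess_trans by blast

lemma card_image_less: "|A| <o r \<Longrightarrow> |f ` A| <o r"
  using card_of_image ordLeq_ordLess_trans by blast

lemma card_UN_less:
  assumes "regular_cardinal r" "|I| <o r" "\<And>i. i \<in> I \<Longrightarrow> |A i| <o r"
  shows "|\<Union>i\<in>I. A i| <o r"
  using card_of_UNION_ordLess_infinite_Field_regularCard[of r I A] assms
  by (simp add: regular_cardinal_def)

lemma card_Sigma_less:
  assumes "regular_cardinal r" "|I| <o r" "\<And>i. i \<in> I \<Longrightarrow> |A i| <o r"
  shows "|Sigma I A| <o r"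
proof -
  have "Sigma I A = (\<Union>i\<in>I. Pair i ` A i)" by auto
  then show ?thesis using card_UN_less[OF assms(1,2), of "\<lambda>i. Pair i ` A i"] assms(3) card_image_less
    by metis
qed

lemma card_finite_less: "regular_cardinal r \<Longrightarrow> finite A \<Longrightarrow> |A| <o r"
  using Cfinite_ordLess_Cinfinite[of "|A|" r]
  by (simp add: regular_cardinal_def cfinite_def Field_card_of card_of_card_order_on)

lemma card_small_subsets_mono:
  assumes "|N| \<le>o |N'|"
  shows "|{G. G \<subseteq> N \<and> |G| <o r}| \<le>o |{G. G \<subseteq> N' \<and> |G| <o r}|"
proof -
  obtain b where b: "inj_on b N" "b ` N \<subseteq> N'" using assms card_of_ordLeq by metis
  show ?thesis
  proof (rule card_of_ordLeqI[of "(`) b"])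
    show "inj_on ((`) b) {G. G \<subseteq> N \<and> |G| <o r}" using b(1) by (auto simp: inj_on_def inj_on_image_eq_iff)
    show "b ` G \<in> {G. G \<subseteq> N' \<and> |G| <o r}" if "G \<in> {G. G \<subseteq> N \<and> |G| <o r}" for G
      using that card_image_less b(2) by blast
  qed
qed

context triangulated_category
begin

section \<open>Coproducts of exact triangles\<close>

text \<open>
  The comparison morphisms \<open>z i \<rightarrow> Z\<close> make \<open>Z\<close> a coproduct, by a five lemma argument for \<open>Hom(-, W)\<close>,
  which turns coproducts of triangles into products of exact sequences. The argument is carried out on
  elements: a family on the \<open>z i\<close> is extended over \<open>Y\<close>, and then corrected by a morphism from \<open>\<Sigma> X\<close>.
\<close>

lemma coprod_triangle:
  assumes t: "\<And>i. i \<in> I \<Longrightarrow> exact_triangle T (x i) (y i) (z i) (f i) (g i) (h i)"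
    and X: "is_coproduct T I x X \<iota>" and Y: "is_coproduct T I y Y \<iota>'"
    and F: "\<And>i. i \<in> I \<Longrightarrow> F \<odot> \<iota> i = \<iota>' i \<odot> f i"
    and T: "exact_triangle T X Y Z F G H"
  shows "\<exists>c. is_coproduct T I z Z c \<and> (\<forall>i\<in>I. c i \<odot> g i = G \<odot> \<iota>' i)"
proof -
  note TT = triangle_hom[OF T]
  note \<iota> = coprod_inj[OF X] and \<iota>' = coprod_inj[OF Y]
  note tt = triangle_hom[OF t]
  note \<Sigma>X = shift_coprod[OF X] and \<Sigma>Y = shift_coprod[OF Y]
  have "\<exists>w. w : z i ~> Z \<and> w \<odot> g i = G \<odot> \<iota>' i \<and> \<sigma> (\<iota> i) \<odot> h i = H \<odot> w" if i: "i \<in> I" for i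
    using triangle_fill[OF t[OF i] T \<iota>[OF i] \<iota>'[OF i]] F[OF i] by metis
  then obtain c where c: "\<And>i. i \<in> I \<Longrightarrow> c i : z i ~> Z" "\<And>i. i \<in> I \<Longrightarrow> c i \<odot> g i = G \<odot> \<iota>' i"
    "\<And>i. i \<in> I \<Longrightarrow> \<sigma> (\<iota> i) \<odot> h i = H \<odot> c i" by metis
  have "is_coproduct T I z Z c"
  proof (rule coprodI)
    show "Z \<in> Obj T" using TT hom_Obj by blast
    show "c i : z i ~> Z" if "i \<in> I" for i by (rule c(1)[OF that])
    fix W
    {
      fix k assume W: "W \<in> Obj T" and k: "\<And>i. i \<in> I \<Longrightarrow> k i : z i ~> W"
      have kg: "k i \<odot> g i : y i ~> W" if "i \<in> I" for i using comp_hom tt(2)[OF that] k[OF that] by blast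
      obtain a where a: "a : Y ~> W" "\<And>i. i \<in> I \<Longrightarrow> a \<odot> \<iota>' i = k i \<odot> g i"
        using coprod_obtain[OF Y W kg] by blast
      have "a \<odot> F = Zero T X W"
      proof (rule coprod_eqI[OF X comp_hom[OF TT(1) a(1)]])
        show "Zero T X W : X ~> W" using zero_hom W TT hom_Obj by blast
        fix i assume i: "i \<in> I"
        have "(a \<odot> F) \<odot> \<iota> i = a \<odot> (\<iota>' i \<odot> f i)" using a(1) TT(1) \<iota>[OF i] F[OF i] by (simp add: hom_def)
        also have "\<dots> = (k i \<odot> g i) \<odot> f i"
          using comp_reduce[OF a(2)[OF i], of "f i"] a(1) \<iota>'[OF i] tt[OF i] by (simp add: hom_def)
        also have "\<dots> = k i \<odot> (g i \<odot> f i)" using k[OF i] tt[OF i] by (simp add: hom_def)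
        also have "\<dots> = Zero T (x i) W" unfolding triangle_comp_zero[OF t[OF i]]
          using k[OF i] tt[OF i] hom_Obj(1)[OF tt(1)[OF i]] by (simp add: hom_def)
        also have "\<dots> = Zero T X W \<odot> \<iota> i" using W \<iota>[OF i] by (simp add: hom_def)
        finally show "(a \<odot> F) \<odot> \<iota> i = Zero T X W \<odot> \<iota> i" .
      qed
      then obtain b where b: "b : Z ~> W" "a = b \<odot> G" using triangle_extend[OF T a(1)] by metis
      have "\<exists>l. l : \<Sigma> (x i) ~> W \<and> k i = b \<odot> c i \<oplus> (l \<odot> h i)" if i: "i \<in> I" for i
      proof -
        have "(b \<odot> c i) \<odot> g i = b \<odot> (G \<odot> \<iota>' i)" using b(1) c(1,2)[OF i] tt[OF i] by (simp add: hom_def)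
        also have "\<dots> = k i \<odot> g i" using a(2)[OF i] b TT \<iota>'[OF i] by (simp add: hom_def)
        finally have e: "k i \<odot> g i = (b \<odot> c i) \<odot> g i" ..
        show ?thesis using triangle_extend2_diff[OF t[OF i] k[OF i] comp_hom[OF c(1)[OF i] b(1)] e] by metis
      qed
      then obtain l where l: "\<And>i. i \<in> I \<Longrightarrow> l i : \<Sigma> (x i) ~> W"
        "\<And>i. i \<in> I \<Longrightarrow> k i = b \<odot> c i \<oplus> (l i \<odot> h i)" by metis
      obtain L where L: "L : \<Sigma> X ~> W" "\<And>i. i \<in> I \<Longrightarrow> L \<odot> \<sigma> (\<iota> i) = l i"
        using coprod_obtain[OF \<Sigma>X W l(1)] by blast
      have "(b \<oplus> (L \<odot> H)) \<odot> c i = k i" if i: "i \<in> I" for i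
      proof -
        have "(b \<oplus> (L \<odot> H)) \<odot> c i = (b \<odot> c i) \<oplus> (L \<odot> (H \<odot> c i))"
          using b(1) L(1) TT c(1)[OF i] by (simp add: hom_def)
        also have "H \<odot> c i = \<sigma> (\<iota> i) \<odot> h i" using c(3)[OF i] by simp
        also have "L \<odot> (\<sigma> (\<iota> i) \<odot> h i) = l i \<odot> h i"
          using comp_reduce[OF L(2)[OF i], of "h i"] L(1) shift_hom[OF \<iota>[OF i]] tt[OF i] by (simp add: hom_def)
        finally show ?thesis using l(2)[OF i] by simp
      qed
      then show "\<exists>h. h : Z ~> W \<and> (\<forall>i\<in>I. h \<odot> c i = k i)"
        using add_hom[OF b(1) comp_hom[OF TT(3) L(1)]] by blast
    }
    {
      fix b0 b1 assume b01: "b0 : Z ~> W" "b1 : Z ~> W" "\<And>i. i \<in> I \<Longrightarrow> b0 \<odot> c i = b1 \<odot> c i"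
      have "b0 \<odot> G = b1 \<odot> G"
      proof (rule coprod_eqI[OF Y comp_hom[OF TT(2) b01(1)] comp_hom[OF TT(2) b01(2)]])
        fix i assume i: "i \<in> I"
        have "(b \<odot> G) \<odot> \<iota>' i = (b \<odot> c i) \<odot> g i" if "b : Z ~> W" for b
          using that TT \<iota>'[OF i] c(1,2)[OF i] tt[OF i] by (simp add: hom_def)
        then show "(b0 \<odot> G) \<odot> \<iota>' i = (b1 \<odot> G) \<odot> \<iota>' i" using b01(1,2) b01(3)[OF i] by simp
      qed
      then obtain k where k: "k : \<Sigma> X ~> W" "b0 = b1 \<oplus> (k \<odot> H)"
        using triangle_extend2_diff[OF T b01(1,2)] by metis
      have W: "W \<in> Obj T" using k hom_Obj by blast
      have "\<exists>l. l : \<Sigma> (y i) ~> W \<and> k \<odot> \<sigma> (\<iota> i) = l \<odot> \<sigma> (f i)" if i: "i \<in> I" for i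
      proof -
        have zi: "z i \<in> Obj T" using tt(2)[OF i] hom_Obj by blast
        have "(b1 \<odot> c i) \<oplus> (k \<odot> (H \<odot> c i)) = b0 \<odot> c i"
          unfolding k(2) using b01(2) k(1) TT c(1)[OF i] by (simp add: hom_def)
        also have "\<dots> = (b1 \<odot> c i) \<oplus> Zero T (z i) W"
          using b01(2) b01(3)[OF i] c(1)[OF i] by (simp add: hom_def)
        finally have "k \<odot> (H \<odot> c i) = Zero T (z i) W"
          by (rule add_left_cancel) (use b01(2) k(1) TT c(1)[OF i] comp_hom zero_hom zi W in blast)+
        then have "(k \<odot> \<sigma> (\<iota> i)) \<odot> h i = Zero T (z i) W"
          using k(1) shift_hom[OF \<iota>[OF i]] tt[OF i] c(3)[OF i] by (simp add: hom_def)
        then show ?thesis using triangle_extend3[OF t[OF i] comp_hom[OF shift_hom[OF \<iota>[OF i]] k(1)]] by metis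
      qed
      then obtain l where l: "\<And>i. i \<in> I \<Longrightarrow> l i : \<Sigma> (y i) ~> W"
        "\<And>i. i \<in> I \<Longrightarrow> k \<odot> \<sigma> (\<iota> i) = l i \<odot> \<sigma> (f i)" by metis
      obtain L where L: "L : \<Sigma> Y ~> W" "\<And>i. i \<in> I \<Longrightarrow> L \<odot> \<sigma> (\<iota>' i) = l i"
        using coprod_obtain[OF \<Sigma>Y W l(1)] by blast
      have kL: "k = L \<odot> \<sigma> F"
      proof (rule coprod_eqI[OF \<Sigma>X k(1) comp_hom[OF shift_hom[OF TT(1)] L(1)]])
        fix i assume i: "i \<in> I"
        have "(L \<odot> \<sigma> F) \<odot> \<sigma> (\<iota> i) = L \<odot> \<sigma> (F \<odot> \<iota> i)" using L(1) TT \<iota>[OF i] by (simp add: hom_def)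
        also have "\<dots> = (L \<odot> \<sigma> (\<iota>' i)) \<odot> \<sigma> (f i)"
          unfolding F[OF i] using L(1) \<iota>'[OF i] tt[OF i] by (simp add: hom_def)
        finally show "k \<odot> \<sigma> (\<iota> i) = (L \<odot> \<sigma> F) \<odot> \<sigma> (\<iota> i)" using l(2)[OF i] L(2)[OF i] by simp
      qed
      have "k \<odot> H = L \<odot> (\<sigma> F \<odot> H)" unfolding kL using L(1) TT by (simp add: hom_def)
      also have "\<dots> = Zero T Z W" unfolding triangle_comp_zero3[OF T] using L(1) TT hom_Obj[OF TT(3)] by (simp add: hom_def)
      finally show "b0 = b1" using k(2) b01(2) by (simp add: hom_def)
    }
  qed
  then show ?thesis using c by blast
qed

text \<open>
  What dies in \<open>Z\<close> also dies in the cone \<open>C\<close> of \<open>A\<close>, because \<open>C\<close> receives a morphism from \<open>Z\<close> by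
  the previous lemma.
\<close>

lemma coprod_fibre_lift:
  assumes t: "\<And>i. i \<in> I \<Longrightarrow> exact_triangle T (w i) (x i) (z i) (a i) (q i) (h i)"
    and W: "is_coproduct T I w W \<omega>" and X: "is_coproduct T I x X \<iota>" and Z: "is_coproduct T I z Z \<zeta>"
    and A: "A : W ~> X" "\<And>i. i \<in> I \<Longrightarrow> A \<odot> \<omega> i = \<iota> i \<odot> a i"
    and Q: "Q : X ~> Z" "\<And>i. i \<in> I \<Longrightarrow> Q \<odot> \<iota> i = \<zeta> i \<odot> q i"
    and u: "u : s ~> X" "Q \<odot> u = Zero T s Z"
  obtains l where "l : s ~> W" "u = A \<odot> l"
proof -
  note \<iota> = coprod_inj[OF X] and \<zeta> = coprod_inj[OF Z]
  note tt = triangle_hom[OF t]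
  obtain C G H where T: "exact_triangle T W X C A G H" using cone_exists[OF A(1)] .
  note TT = triangle_hom[OF T]
  have C: "C \<in> Obj T" using TT hom_Obj by blast
  obtain c where "is_coproduct T I z C c \<and> (\<forall>i\<in>I. c i \<odot> q i = G \<odot> \<iota> i)"
    using coprod_triangle[OF t W X A(2) T] by blast
  then have c: "is_coproduct T I z C c" "\<And>i. i \<in> I \<Longrightarrow> c i \<odot> q i = G \<odot> \<iota> i" by blast+
  obtain b where b: "b : Z ~> C" "\<And>i. i \<in> I \<Longrightarrow> b \<odot> \<zeta> i = c i"
    using coprod_obtain[OF Z C coprod_inj[OF c(1)]] by blast
  have "b \<odot> Q = G"
  proof (rule coprod_eqI[OF X comp_hom[OF Q(1) b(1)] TT(2)])
    fix i assume i: "i \<in> I"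
    have "(b \<odot> Q) \<odot> \<iota> i = b \<odot> (\<zeta> i \<odot> q i)" using b(1) Q(1) Q(2)[OF i] \<iota>[OF i] by (simp add: hom_def)
    also have "\<dots> = c i \<odot> q i"
      using comp_reduce[OF b(2)[OF i], of "q i"] b(1) \<zeta>[OF i] tt[OF i] by (simp add: hom_def)
    finally show "(b \<odot> Q) \<odot> \<iota> i = G \<odot> \<iota> i" using c(2)[OF i] by simp
  qed
  then have "G \<odot> u = b \<odot> (Q \<odot> u)" using b(1) Q(1) u(1) by (auto simp: hom_def)
  also have "\<dots> = Zero T s C" unfolding u(2) using b(1) hom_Obj[OF u(1)] by (simp add: hom_def)
  finally show thesis using triangle_lift[OF T u(1)] that by blast
qed

end

section \<open>Factorisations through small coproducts\<close>

locale cocomplete_triangulated = triangulated_category T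
  for T :: "('o, 'm, 'z) triangulated_data_scheme" (structure) +
  fixes \<kappa> :: "'u rel"
  assumes inacc: "inaccessible \<kappa>" and lsmall: "locally_small \<kappa> T" and cocomplete: "has_small_coproducts \<kappa> T"
begin

notation hom (\<open>_ : _ ~> _\<close> [51, 51, 51] 50) and add (infixl \<open>\<oplus>\<close> 65)

lemma regular_\<kappa>: "regular_cardinal \<kappa>" using inacc by (simp add: inaccessible_def)

lemma small_index:
  fixes I :: "'i set" assumes "|I| <o \<kappa>"
  obtains b :: "'i \<Rightarrow> 'u" where "bij_betw b I (b ` I)"
proof -
  have "|I| \<le>o |Field \<kappa>|"
    using assms regular_\<kappa> card_of_Field_ordIso ordLess_imp_ordLeq ordLeq_ordIso_trans ordIso_symmetric
    by (metis regular_cardinal_def)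
  then show thesis using that card_of_ordLeq inj_on_imp_bij_betw by metis
qed

lemma coprod_exists:
  fixes I :: "'i set"
  assumes "|I| <o \<kappa>" "\<And>i. i \<in> I \<Longrightarrow> X i \<in> Obj T"
  obtains P \<iota> where "is_coproduct T I X P \<iota>"
proof -
  obtain b :: "'i \<Rightarrow> 'u" where b: "bij_betw b I (b ` I)" using small_index[OF assms(1)] .
  let ?c = "inv_into I b"
  have c: "bij_betw ?c (b ` I) I" using bij_betw_inv_into[OF b] .
  have "|b ` I| <o \<kappa>" by (rule card_image_less[OF assms(1)])
  moreover have "\<forall>j\<in>b ` I. X (?c j) \<in> Obj T" using c assms(2) bij_betwE by blast
  ultimately obtain P \<iota> where "is_coproduct T (b ` I) (\<lambda>j. X (?c j)) P \<iota>"
    using cocomplete[unfolded has_small_coproducts_def, rule_format, of "b ` I" "\<lambda>j. X (?c j)"] by blast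
  then show thesis using that coprod_unreindex[OF _ c] by blast
qed

text \<open>
  Factorisation through few summands and through objects of \<open>B\<close> at the same time; in this form the
  condition is monotone both in \<open>\<nu>\<close> and in \<open>B\<close>.
\<close>

definition factors :: "'u rel \<Rightarrow> 'o set \<Rightarrow> 'i set \<Rightarrow> ('i \<Rightarrow> 'o) \<Rightarrow> 'o \<Rightarrow> ('i \<Rightarrow> 'm) \<Rightarrow> 'm \<Rightarrow> bool" where
  "factors \<nu> B I X P \<iota> f \<longleftrightarrow> (\<exists>I' S p Q \<iota>' h g. I' \<subseteq> I \<and> |I'| <o \<nu> \<and>
     (\<forall>i\<in>I'. S i \<in> B \<and> p i : S i ~> X i) \<and> is_coproduct T I' S Q \<iota>' \<and>
     h : Q ~> P \<and> (\<forall>i\<in>I'. h \<odot> \<iota>' i = \<iota> i \<odot> p i) \<and> g : dm f ~> Q \<and> f = h \<odot> g)"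

lemma factorsI:
  assumes "I' \<subseteq> I" "|I'| <o \<nu>" "\<And>i. i \<in> I' \<Longrightarrow> S i \<in> B" "\<And>i. i \<in> I' \<Longrightarrow> p i : S i ~> X i"
    "is_coproduct T I' S Q \<iota>'" "h : Q ~> P" "\<And>i. i \<in> I' \<Longrightarrow> h \<odot> \<iota>' i = \<iota> i \<odot> p i"
    "g : s ~> Q" "f = h \<odot> g"
  shows "factors \<nu> B I X P \<iota> f"
proof -
  have "dm f = s" using assms(6,8,9) by (auto simp: hom_def)
  then show ?thesis unfolding factors_def using assms by blast
qed

lemma factorsE:
  assumes "factors \<nu> B I X P \<iota> f" "f : s ~> P"
  obtains I' S p Q \<iota>' h g where
    "I' \<subseteq> I" "|I'| <o \<nu>" "\<And>i. i \<in> I' \<Longrightarrow> S i \<in> B" "\<And>i. i \<in> I' \<Longrightarrow> p i : S i ~> X i"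
    "is_coproduct T I' S Q \<iota>'" "h : Q ~> P" "\<And>i. i \<in> I' \<Longrightarrow> h \<odot> \<iota>' i = \<iota> i \<odot> p i"
    "g : s ~> Q" "f = h \<odot> g"
  using assms homD(2)[OF assms(2)] unfolding factors_def by blast

lemma factors_mono: "factors \<nu> B I X P \<iota> f \<Longrightarrow> B \<subseteq> B' \<Longrightarrow> factors \<nu> B' I X P \<iota> f"
  unfolding factors_def by blast

lemma factors_precomp:
  assumes "factors \<nu> B I X P \<iota> f" "f : s ~> P" "e : w ~> s"
  shows "factors \<nu> B I X P \<iota> (f \<odot> e)"
proof -
  obtain I' S p Q \<iota>' h g where *: "I' \<subseteq> I" "|I'| <o \<nu>" "\<And>i. i \<in> I' \<Longrightarrow> S i \<in> B"
    "\<And>i. i \<in> I' \<Longrightarrow> p i : S i ~> X i" "is_coproduct T I' S Q \<iota>'" "h : Q ~> P"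
    "\<And>i. i \<in> I' \<Longrightarrow> h \<odot> \<iota>' i = \<iota> i \<odot> p i" "g : s ~> Q" "f = h \<odot> g"
    by (rule factorsE[OF assms(1,2)]) blast
  have "f \<odot> e = h \<odot> (g \<odot> e)" using *(6,8,9) assms(3) by (simp add: hom_def)
  then show ?thesis using factorsI[OF *(1-7) comp_hom[OF assms(3) *(8)]] by blast
qed

lemma factors_reindex:
  assumes "factors \<nu> B J (\<lambda>j. X (b j)) P (\<lambda>j. \<iota> (b j)) f" "bij_betw b J I" "f : s ~> P"
  shows "factors \<nu> B I X P \<iota> f"
proof -
  obtain J' S p Q \<iota>' h g where *: "J' \<subseteq> J" "|J'| <o \<nu>" "\<And>i. i \<in> J' \<Longrightarrow> S i \<in> B"
    "\<And>i. i \<in> J' \<Longrightarrow> p i : S i ~> X (b i)" "is_coproduct T J' S Q \<iota>'" "h : Q ~> P"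
    "\<And>i. i \<in> J' \<Longrightarrow> h \<odot> \<iota>' i = \<iota> (b i) \<odot> p i" "g : s ~> Q" "f = h \<odot> g"
    by (rule factorsE[OF assms(1,3)]) blast
  define c where "c = inv_into J b"
  have bJ: "bij_betw b J' (b ` J')" using assms(2) *(1) by (rule bij_betw_subset) simp
  have c: "bij_betw c (b ` J') J'" unfolding c_def using assms(2) *(1)
    by (metis bij_betw_inv_into_subset)
  have cJ: "c i \<in> J'" "b (c i) = i" if "i \<in> b ` J'" for i
    using that *(1) assms(2) by (auto simp: c_def bij_betw_inv_into_left)
  show ?thesis
  proof (rule factorsI[of "b ` J'" _ _ "\<lambda>i. S (c i)" _ "\<lambda>i. p (c i)" _ Q "\<lambda>i. \<iota>' (c i)" h])
    show "b ` J' \<subseteq> I" using *(1) assms(2) by (auto simp: bij_betw_def)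
    show "|b ` J'| <o \<nu>" by (rule card_image_less[OF *(2)])
    show "is_coproduct T (b ` J') (\<lambda>i. S (c i)) Q (\<lambda>i. \<iota>' (c i))" by (rule coprod_reindex[OF *(5) c])
    show "p (c i) : S (c i) ~> X i" if "i \<in> b ` J'" for i using *(4)[OF cJ(1)[OF that]] cJ(2)[OF that] by simp
    show "h \<odot> \<iota>' (c i) = \<iota> i \<odot> p (c i)" if "i \<in> b ` J'" for i
      using *(7)[OF cJ(1)[OF that]] cJ(2)[OF that] by simp
  qed (use * cJ in auto)
qed

definition factoring_to :: "'u rel \<Rightarrow> 'o set \<Rightarrow> 'o \<Rightarrow> bool" where
  "factoring_to \<nu> B S \<longleftrightarrow> S \<in> Obj T \<and> (\<forall>(I::'u set) X P \<iota> f.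
     |I| <o \<kappa> \<and> is_coproduct T I X P \<iota> \<and> f : S ~> P \<longrightarrow> factors \<nu> B I X P \<iota> f)"

lemma factoring_toD:
  fixes I :: "'i set"
  assumes "factoring_to \<nu> B S" "|I| <o \<kappa>" "is_coproduct T I X P \<iota>" "f : S ~> P"
  shows "factors \<nu> B I X P \<iota> f"
proof -
  obtain b :: "'i \<Rightarrow> 'u" where b: "bij_betw b I (b ` I)" using small_index[OF assms(2)] .
  let ?c = "inv_into I b"
  have c: "bij_betw ?c (b ` I) I" using bij_betw_inv_into[OF b] .
  have "factors \<nu> B (b ` I) (\<lambda>j. X (?c j)) P (\<lambda>j. \<iota> (?c j)) f"
    using assms(1,4) coprod_reindex[OF assms(3) c] card_image_less[OF assms(2)]
    unfolding factoring_to_def by blast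
  then show ?thesis using factors_reindex[OF _ c assms(4)] by blast
qed

lemma factoring_toI:
  assumes "S \<in> Obj T" "\<And>(I::'u set) X P \<iota> f. |I| <o \<kappa> \<Longrightarrow> is_coproduct T I X P \<iota> \<Longrightarrow> f : S ~> P \<Longrightarrow>
    factors \<nu> B I X P \<iota> f"
  shows "factoring_to \<nu> B S"
  using assms unfolding factoring_to_def by blast

lemma factoring_to_mono: "factoring_to \<nu> B S \<Longrightarrow> B \<subseteq> B' \<Longrightarrow> factoring_to \<nu> B' S"
  unfolding factoring_to_def using factors_mono by blast

text \<open>
  Enlarges the index set by summands \<open>s\<close> that are mapped to zero. The filler \<open>s\<close> can be taken from
  any non-empty class of objects under consideration.
\<close>

lemma extend_coprod:
  assumes Q: "is_coproduct T I' S Q \<iota>'" and P: "is_coproduct T I X P \<iota>" and I: "I' \<subseteq> I" "|I| <o \<kappa>"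
    and p: "\<And>i. i \<in> I' \<Longrightarrow> p i : S i ~> X i"
    and h: "h : Q ~> P" "\<And>i. i \<in> I' \<Longrightarrow> h \<odot> \<iota>' i = \<iota> i \<odot> p i" and s: "s \<in> Obj T"
  shows "\<exists>S2 p2 R \<rho> k t. is_coproduct T I S2 R \<rho> \<and> k : R ~> P \<and>
    (\<forall>i\<in>I. k \<odot> \<rho> i = \<iota> i \<odot> p2 i) \<and> t : Q ~> R \<and> k \<odot> t = h \<and>
    (\<forall>i\<in>I. p2 i : S2 i ~> X i \<and>
       (i \<in> I' \<and> S2 i = S i \<and> p2 i = p i \<or> S2 i = s \<and> p2 i = Zero T s (X i)))"
proof -
  note \<iota> = coprod_inj[OF P] and \<iota>' = coprod_inj[OF Q]
  define S2 where "S2 i = (if i \<in> I' then S i else s)" for i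
  define p2 where "p2 i = (if i \<in> I' then p i else Zero T s (X i))" for i
  have p2: "p2 i : S2 i ~> X i" if "i \<in> I" for i
    using p zero_hom[OF s] hom_Obj(1)[OF \<iota>[OF that]] by (simp add: p2_def S2_def)
  obtain R \<rho> where R: "is_coproduct T I S2 R \<rho>" by (rule coprod_exists[OF I(2) hom_Obj(1)[OF p2]])
  note \<rho> = coprod_inj[OF R]
  have "\<exists>k. k : R ~> P \<and> (\<forall>i\<in>I. k \<odot> \<rho> i = \<iota> i \<odot> p2 i)"
    by (rule coprod_ex[OF R coprod_Obj[OF P]]) (use comp_hom p2 \<iota> in blast)
  then obtain k where k: "k : R ~> P" "\<And>i. i \<in> I \<Longrightarrow> k \<odot> \<rho> i = \<iota> i \<odot> p2 i" by blast
  have "\<exists>t. t : Q ~> R \<and> (\<forall>i\<in>I'. t \<odot> \<iota>' i = \<rho> i)"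
  proof (rule coprod_ex[OF Q coprod_Obj[OF R]])
    show "\<rho> i : S i ~> R" if "i \<in> I'" for i using \<rho>[of i] that I(1) by (auto simp: S2_def)
  qed
  then obtain t where t: "t : Q ~> R" "\<And>i. i \<in> I' \<Longrightarrow> t \<odot> \<iota>' i = \<rho> i" by blast
  have kt: "k \<odot> t = h"
  proof (rule coprod_eqI[OF Q comp_hom[OF t(1) k(1)] h(1)])
    fix i assume i: "i \<in> I'"
    then have i': "i \<in> I" using I(1) by blast
    have "(k \<odot> t) \<odot> \<iota>' i = k \<odot> \<rho> i" using k(1) t(1) t(2)[OF i] \<iota>'[OF i] by (simp add: hom_def)
    then show "(k \<odot> t) \<odot> \<iota>' i = h \<odot> \<iota>' i" using h(2)[OF i] k(2)[OF i'] i by (simp add: p2_def)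
  qed
  show ?thesis
    by (rule exI[of _ S2], rule exI[of _ p2], intro exI conjI ballI)
       (use R k t(1) kt p2 in \<open>auto simp: S2_def p2_def\<close>)
qed

text \<open>
  From left to right, factor first through few summands by smallness and then through objects of
  \<open>A\<close>. From right to left, forgetting the objects of \<open>A\<close> gives smallness, and adding summands
  gives a factorisation indexed by all of \<open>I\<close>.
\<close>

lemma coproduct_factoring_iff:
  "coproduct_factoring \<kappa> \<nu> T A \<longleftrightarrow> (\<forall>S\<in>A. factoring_to \<nu> A S)"
proof (intro iffI ballI)
  fix S assume A: "coproduct_factoring \<kappa> \<nu> T A" and S: "S \<in> A"
  have small: "small_object \<kappa> \<nu> T S" using A S by (simp add: coproduct_factoring_def)
  then have SO: "S \<in> Obj T" by (simp add: small_object_def)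
  show "factoring_to \<nu> A S"
  proof (rule factoring_toI[OF SO])
    fix I :: "'u set" and X P \<iota> f
    assume I: "|I| <o \<kappa>" "is_coproduct T I X P \<iota>" "f : S ~> P"
    obtain I' Q \<iota>' h g where 1: "I' \<subseteq> I" "|I'| <o \<nu>" "is_coproduct T I' X Q \<iota>'" "h \<in> Hom T Q P"
      "\<forall>i\<in>I'. h \<odot> \<iota>' i = \<iota> i" "g \<in> Hom T S Q" "f = h \<odot> g"
      using small I hom_Obj(3)[OF I(3)] unfolding small_object_def by blast
    have QO: "Q \<in> Obj T" by (rule coprod_Obj[OF 1(3)])
    have h: "h : Q ~> P" using 1(4) QO I(3) hom_Obj homI by blast
    have "|I'| <o \<kappa>" using card_subset_less[OF 1(1) I(1)] .
    then obtain S' Q' \<iota>'' p h' g' where 2: "\<forall>i\<in>I'. S' i \<in> A \<and> p i \<in> Hom T (S' i) (X i)"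
      "is_coproduct T I' S' Q' \<iota>''" "is_coproduct_map T I' p Q' \<iota>'' Q \<iota>' h'" "g' \<in> Hom T S Q'" "g = h' \<odot> g'"
      using A S 1(3,6) unfolding coproduct_factoring_def by metis
    have Q'O: "Q' \<in> Obj T" by (rule coprod_Obj[OF 2(2)])
    have h': "h' : Q' ~> Q" "\<And>i. i \<in> I' \<Longrightarrow> h' \<odot> \<iota>'' i = \<iota>' i \<odot> p i"
      using 2(3) QO Q'O by (auto simp: is_coproduct_map_def hom_iff)
    have g': "g' : S ~> Q'" using 2(4) SO Q'O homI by blast
    have p: "p i : S' i ~> X i" if "i \<in> I'" for i
      using 2(1) that coprod_inj[OF 2(2) that] coprod_inj[OF 1(3) that] hom_iff by blast
    show "factors \<nu> A I X P \<iota> f"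
    proof (rule factorsI[OF 1(1,2) _ p 2(2) comp_hom[OF h'(1) h] _ g'])
      show "f = (h \<odot> h') \<odot> g'" using 1(7) 2(5) h h' g' by (simp add: hom_def)
      fix i assume i: "i \<in> I'"
      show "S' i \<in> A" using 2(1) i by blast
      have "(h \<odot> h') \<odot> \<iota>'' i = h \<odot> (\<iota>' i \<odot> p i)" using h h'(1) h'(2)[OF i] coprod_inj[OF 2(2) i] by (simp add: hom_def)
      also have "\<dots> = \<iota> i \<odot> p i"
        using comp_reduce[of h "\<iota>' i" "\<iota> i" "p i"] 1(5) i h coprod_inj[OF 1(3) i] p[OF i] by (simp add: hom_def)
      finally show "(h \<odot> h') \<odot> \<iota>'' i = \<iota> i \<odot> p i" .
    qed
  qed
next
  assume A: "\<forall>S\<in>A. factoring_to \<nu> A S"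
  show "coproduct_factoring \<kappa> \<nu> T A"
    unfolding coproduct_factoring_def small_object_def
  proof (intro conjI ballI allI impI)
    fix S assume S: "S \<in> A"
    then show SO: "S \<in> Obj T" using A by (simp add: factoring_to_def)
    fix I :: "'u set" and X P \<iota> f
    assume I: "|I| <o \<kappa> \<and> is_coproduct T I X P \<iota> \<and> f \<in> Hom T S P"
    then have P: "is_coproduct T I X P \<iota>" and Ik: "|I| <o \<kappa>" by blast+
    have PO: "P \<in> Obj T" by (rule coprod_Obj[OF P])
    have f: "f : S ~> P" using I SO PO homI by blast
    obtain I' S' p Q \<iota>' h g where *: "I' \<subseteq> I" "|I'| <o \<nu>" "\<And>i. i \<in> I' \<Longrightarrow> S' i \<in> A"
      "\<And>i. i \<in> I' \<Longrightarrow> p i : S' i ~> X i" "is_coproduct T I' S' Q \<iota>'" "h : Q ~> P"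
      "\<And>i. i \<in> I' \<Longrightarrow> h \<odot> \<iota>' i = \<iota> i \<odot> p i" "g : S ~> Q" "f = h \<odot> g"
      by (rule factorsE[OF factoring_toD[OF A[rule_format, OF S] Ik P f] f]) blast
    note \<iota> = coprod_inj[OF P] and \<iota>' = coprod_inj[OF *(5)]
    {
      have "|I'| <o \<kappa>" using card_subset_less[OF *(1) Ik] .
      moreover have "X i \<in> Obj T" if "i \<in> I'" for i using hom_Obj *(4)[OF that] by blast
      ultimately obtain R \<rho> where R: "is_coproduct T I' X R \<rho>" using coprod_exists by blast
      note \<rho> = coprod_inj[OF R]
      have RO: "R \<in> Obj T" by (rule coprod_Obj[OF R])
      have "\<iota> i : X i ~> P" if "i \<in> I'" for i using \<iota> *(1) that by blast
      then obtain k where k: "k : R ~> P" "\<And>i. i \<in> I' \<Longrightarrow> k \<odot> \<rho> i = \<iota> i" using coprod_obtain[OF R PO] by blast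
      have "\<rho> i \<odot> p i : S' i ~> R" if "i \<in> I'" for i using comp_hom \<rho> *(4) that by blast
      then obtain t where t: "t : Q ~> R" "\<And>i. i \<in> I' \<Longrightarrow> t \<odot> \<iota>' i = \<rho> i \<odot> p i"
        using coprod_obtain[OF *(5) RO, of "\<lambda>i. \<rho> i \<odot> p i"] by blast
      have kt: "k \<odot> t = h"
      proof (rule coprod_eqI[OF *(5) comp_hom[OF t(1) k(1)] *(6)])
        fix i assume i: "i \<in> I'"
        have "(k \<odot> t) \<odot> \<iota>' i = k \<odot> (\<rho> i \<odot> p i)" using k(1) t(1) t(2)[OF i] \<iota>'[OF i] by (simp add: hom_def)
        also have "\<dots> = \<iota> i \<odot> p i" using comp_reduce[OF k(2)[OF i], of "p i"] k(1) \<rho>[OF i] *(4)[OF i] by (simp add: hom_def)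
        finally show "(k \<odot> t) \<odot> \<iota>' i = h \<odot> \<iota>' i" using *(7)[OF i] by simp
      qed
      have "f = k \<odot> (t \<odot> g)" using *(9) kt[symmetric] k(1) t(1) *(8) by (simp add: hom_def)
      then show "\<exists>I' Q \<iota>' h g. I' \<subseteq> I \<and> |I'| <o \<nu> \<and> is_coproduct T I' X Q \<iota>' \<and>
           h \<in> Hom T Q P \<and> (\<forall>i\<in>I'. h \<odot> \<iota>' i = \<iota> i) \<and> g \<in> Hom T S Q \<and> f = h \<odot> g"
        using *(1,2) R hom_Obj(3)[OF k(1)] k(2) hom_Obj(3)[OF comp_hom[OF *(8) t(1)]] by blast
    }
    {
      obtain S2 p2 R \<rho> k t where R: "is_coproduct T I S2 R \<rho>" and k: "k : R ~> P"
        "\<forall>i\<in>I. k \<odot> \<rho> i = \<iota> i \<odot> p2 i" and t: "t : Q ~> R" and kt: "k \<odot> t = h"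
        and S2: "\<forall>i\<in>I. p2 i : S2 i ~> X i \<and>
          (i \<in> I' \<and> S2 i = S' i \<and> p2 i = p i \<or> S2 i = S \<and> p2 i = Zero T S (X i))"
        using extend_coprod[OF *(5) P *(1) Ik *(4,6,7) SO] by blast
      have p2: "p2 i : S2 i ~> X i" if "i \<in> I" for i using S2 that by blast
      have S2A: "S2 i \<in> A" if "i \<in> I" for i using S2[rule_format, OF that] *(3) S by auto
      have "f = k \<odot> (t \<odot> g)" using *(9) kt[symmetric] k(1) t *(8) by (simp add: hom_def)
      moreover have "is_coproduct_map T I p2 R \<rho> P \<iota> k"
        using k hom_Obj(3) by (auto simp: is_coproduct_map_def)
      moreover have "t \<odot> g \<in> Hom T S R" using comp_hom[OF *(8) t] hom_Obj by blast
      moreover have "\<forall>i\<in>I. S2 i \<in> A \<and> p2 i \<in> Hom T (S2 i) (X i)" using S2A p2 hom_Obj(3) by blast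
      ultimately show "\<exists>S' Q \<iota>' p h g. (\<forall>i\<in>I. S' i \<in> A \<and> p i \<in> Hom T (S' i) (X i)) \<and>
           is_coproduct T I S' Q \<iota>' \<and> is_coproduct_map T I p Q \<iota>' P \<iota> h \<and>
           g \<in> Hom T S Q \<and> f = h \<odot> g" using R by blast
    }
  qed
qed

end

context cocomplete_triangulated
begin

section \<open>Closure properties of the \<open>\<nu>\<close>-compact objects\<close>

abbreviation Cpt :: "'u rel \<Rightarrow> 'o set" where "Cpt \<nu> \<equiv> compact_objects \<kappa> \<nu> T"

lemma Cpt_factoring:
  assumes "S \<in> Cpt \<nu>" shows "factoring_to \<nu> (Cpt \<nu>) S"
proof -
  have "coproduct_factoring \<kappa> \<nu> T (Cpt \<nu>)" unfolding compact_objects_eq_Union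
    by (rule coproduct_factoring_Union) simp
  then show ?thesis using assms coproduct_factoring_iff by blast
qed

lemma Cpt_Obj: "S \<in> Cpt \<nu> \<Longrightarrow> S \<in> Obj T"
  using Cpt_factoring by (auto simp: factoring_to_def)

lemma Cpt_coinduct:
  assumes "\<And>S. S \<in> A \<Longrightarrow> factoring_to \<nu> (A \<union> Cpt \<nu>) S"
  shows "A \<subseteq> Cpt \<nu>"
proof -
  have "\<forall>S\<in>A \<union> Cpt \<nu>. factoring_to \<nu> (A \<union> Cpt \<nu>) S"
    using assms Cpt_factoring factoring_to_mono[of \<nu> "Cpt \<nu>" _ "A \<union> Cpt \<nu>"] by blast
  then have "coproduct_factoring \<kappa> \<nu> T (A \<union> Cpt \<nu>)" by (simp add: coproduct_factoring_iff)
  then show ?thesis unfolding compact_objects_eq_Union by blast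
qed

lemma Cpt_mono:
  assumes "\<nu> \<le>o \<nu>'" shows "Cpt \<nu> \<subseteq> Cpt \<nu>'"
proof (rule Cpt_coinduct)
  fix S assume S: "S \<in> Cpt \<nu>"
  show "factoring_to \<nu>' (Cpt \<nu> \<union> Cpt \<nu>') S"
  proof (rule factoring_toI[OF Cpt_Obj[OF S]])
    fix I :: "'u set" and X P \<iota> f
    assume I: "|I| <o \<kappa>" "is_coproduct T I X P \<iota>" "f : S ~> P"
    have "factors \<nu> (Cpt \<nu>) I X P \<iota> f" using factoring_toD[OF Cpt_factoring[OF S] I] .
    then have "factors \<nu>' (Cpt \<nu>) I X P \<iota> f"
      unfolding factors_def using assms ordLess_ordLeq_trans by blast
    then show "factors \<nu>' (Cpt \<nu> \<union> Cpt \<nu>') I X P \<iota> f" using factors_mono by blast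
  qed
qed

text \<open>
  Given \<open>f\<close> on the retract \<open>z\<close>, factor \<open>f \<odot> r\<close> and restrict along \<open>i\<close>.
\<close>

lemma Cpt_retract:
  assumes "s \<in> Cpt \<nu>" "i : z ~> s" "r : s ~> z" "r \<odot> i = Ident T z"
  shows "z \<in> Cpt \<nu>"
proof -
  have "{z} \<subseteq> Cpt \<nu>"
  proof (rule Cpt_coinduct)
    fix z' assume "z' \<in> {z}"
    then have [simp]: "z' = z" by simp
    show "factoring_to \<nu> ({z} \<union> Cpt \<nu>) z'"
    proof (rule factoring_toI)
      show "z' \<in> Obj T" using assms hom_Obj by simp
      fix I :: "'u set" and X P \<iota> f
      assume I: "|I| <o \<kappa>" "is_coproduct T I X P \<iota>" "f : z' ~> P"
      have fr: "f \<odot> r : s ~> P" using comp_hom[OF assms(3)] I(3) by simp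
      have "factors \<nu> (Cpt \<nu>) I X P \<iota> ((f \<odot> r) \<odot> i)"
        using factors_precomp[OF factoring_toD[OF Cpt_factoring[OF assms(1)] I(1,2) fr] fr assms(2)] .
      moreover have "(f \<odot> r) \<odot> i = f" using assms(2-4) I(3) by (simp add: hom_def)
      ultimately have "factors \<nu> (Cpt \<nu>) I X P \<iota> f" by simp
      then show "factors \<nu> ({z} \<union> Cpt \<nu>) I X P \<iota> f" by (rule factors_mono) blast
    qed
  qed
  then show ?thesis by simp
qed

lemma Cpt_iso:
  assumes "s \<in> Cpt \<nu>" "isomorphic T z s" "z \<in> Obj T"
  shows "z \<in> Cpt \<nu>"
  using isomorphic_obtain[OF assms(2,3) Cpt_Obj[OF assms(1)]] Cpt_retract[OF assms(1)] by blast

text \<open>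
  A morphism \<open>\<Sigma> x \<rightarrow> \<Coprod>X\<^sub>i\<close> is the shift of a morphism from \<open>x\<close> once the \<open>X\<^sub>i\<close> are replaced by isomorphic
  objects \<open>\<Sigma> y\<^sub>i\<close>: the shift preserves coproducts.
\<close>

lemma Cpt_shift:
  assumes x: "x \<in> Cpt \<nu>" shows "\<Sigma> x \<in> Cpt \<nu>"
proof -
  have "\<Sigma> ` Cpt \<nu> \<subseteq> Cpt \<nu>"
  proof (rule Cpt_coinduct)
    fix S assume "S \<in> \<Sigma> ` Cpt \<nu>"
    then obtain x where x: "x \<in> Cpt \<nu>" "S = \<Sigma> x" by blast
    note xO = Cpt_Obj[OF x(1)]
    show "factoring_to \<nu> (\<Sigma> ` Cpt \<nu> \<union> Cpt \<nu>) S"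
    proof (rule factoring_toI)
      show "S \<in> Obj T" using x(2) xO by simp
      fix I :: "'u set" and X P \<iota> f
      assume I: "|I| <o \<kappa>" "is_coproduct T I X P \<iota>" and f: "f : S ~> P"
      note \<iota> = coprod_inj[OF I(2)]
      have PO: "P \<in> Obj T" by (rule coprod_Obj[OF I(2)])
      have "\<forall>i\<in>I. \<exists>y u v. y \<in> Obj T \<and> u : \<Sigma> y ~> X i \<and> v : X i ~> \<Sigma> y \<and> u \<odot> v = Ident T (X i)"
        using unshift hom_Obj(1)[OF \<iota>] by metis
      then obtain y u v where u: "\<And>i. i \<in> I \<Longrightarrow> y i \<in> Obj T" "\<And>i. i \<in> I \<Longrightarrow> u i : \<Sigma> (y i) ~> X i"
        "\<And>i. i \<in> I \<Longrightarrow> v i : X i ~> \<Sigma> (y i)" "\<And>i. i \<in> I \<Longrightarrow> u i \<odot> v i = Ident T (X i)" by metis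
      obtain P' \<iota>' where P': "is_coproduct T I y P' \<iota>'" by (rule coprod_exists[OF I(1) u(1)])
      note \<iota>' = coprod_inj[OF P'] and \<Sigma>P' = shift_coprod[OF P']
      have P'O: "P' \<in> Obj T" by (rule coprod_Obj[OF P'])
      have "\<iota> i \<odot> u i : \<Sigma> (y i) ~> P" if "i \<in> I" for i using comp_hom u(2) \<iota> that by blast
      then obtain \<theta> where \<theta>: "\<theta> : \<Sigma> P' ~> P" "\<And>i. i \<in> I \<Longrightarrow> \<theta> \<odot> \<sigma> (\<iota>' i) = \<iota> i \<odot> u i"
        using coprod_obtain[OF \<Sigma>P' PO, of "\<lambda>i. \<iota> i \<odot> u i"] by blast
      have "\<sigma> (\<iota>' i) \<odot> v i : X i ~> \<Sigma> P'" if "i \<in> I" for i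
        using comp_hom[OF u(3)[OF that] shift_hom[OF \<iota>'[OF that]]] .
      then obtain \<eta> where \<eta>: "\<eta> : P ~> \<Sigma> P'" "\<And>i. i \<in> I \<Longrightarrow> \<eta> \<odot> \<iota> i = \<sigma> (\<iota>' i) \<odot> v i"
        using coprod_obtain[OF I(2) shift_Obj[OF P'O], of "\<lambda>i. \<sigma> (\<iota>' i) \<odot> v i"] by blast
      have \<theta>\<eta>: "\<theta> \<odot> \<eta> = Ident T P"
      proof (rule coprod_eqI[OF I(2) comp_hom[OF \<eta>(1) \<theta>(1)] id_hom[OF PO]])
        fix i assume i: "i \<in> I"
        have "(\<theta> \<odot> \<eta>) \<odot> \<iota> i = \<theta> \<odot> (\<sigma> (\<iota>' i) \<odot> v i)" using \<theta>(1) \<eta>(1) \<eta>(2)[OF i] \<iota>[OF i] by (simp add: hom_def)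
        also have "\<dots> = (\<iota> i \<odot> u i) \<odot> v i"
          using comp_reduce[OF \<theta>(2)[OF i], of "v i"] \<theta>(1) shift_hom[OF \<iota>'[OF i]] u(3)[OF i] by (simp add: hom_def)
        also have "\<dots> = \<iota> i \<odot> (u i \<odot> v i)" using \<iota>[OF i] u(2,3)[OF i] by (simp add: hom_def)
        also have "\<dots> = Ident T P \<odot> \<iota> i" unfolding u(4)[OF i] using \<iota>[OF i] by (simp add: hom_def)
        finally show "(\<theta> \<odot> \<eta>) \<odot> \<iota> i = Ident T P \<odot> \<iota> i" .
      qed
      obtain f' where f': "f' : x ~> P'" "\<eta> \<odot> f = \<sigma> f'"
        using shift_full[OF _ xO P'O] comp_hom[OF f \<eta>(1)] x(2) by metis
      have f_eq: "f = \<theta> \<odot> \<sigma> f'"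
        using comp_reduce[OF \<theta>\<eta>, of f] f \<theta>(1) \<eta>(1) f'(2) by (simp add: hom_def)
      obtain I' S' p Q \<iota>'' h g where *: "I' \<subseteq> I" "|I'| <o \<nu>" "\<And>i. i \<in> I' \<Longrightarrow> S' i \<in> Cpt \<nu>"
        "\<And>i. i \<in> I' \<Longrightarrow> p i : S' i ~> y i" "is_coproduct T I' S' Q \<iota>''" "h : Q ~> P'"
        "\<And>i. i \<in> I' \<Longrightarrow> h \<odot> \<iota>'' i = \<iota>' i \<odot> p i" "g : x ~> Q" "f' = h \<odot> g"
        by (rule factorsE[OF factoring_toD[OF Cpt_factoring[OF x(1)] I(1) P' f'(1)] f'(1)]) blast
      note \<iota>'' = coprod_inj[OF *(5)]
      show "factors \<nu> (\<Sigma> ` Cpt \<nu> \<union> Cpt \<nu>) I X P \<iota> f"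
      proof (rule factorsI[OF *(1,2) _ _ shift_coprod[OF *(5)] comp_hom[OF shift_hom[OF *(6)] \<theta>(1)] _ shift_hom[OF *(8)],
            of _ "\<lambda>i. u i \<odot> \<sigma> (p i)"])
        show "f = (\<theta> \<odot> \<sigma> h) \<odot> \<sigma> g" using f_eq *(6,8,9) \<theta>(1) by (simp add: hom_def)
        fix i assume i: "i \<in> I'"
        then have iI: "i \<in> I" using *(1) by blast
        show "\<Sigma> (S' i) \<in> \<Sigma> ` Cpt \<nu> \<union> Cpt \<nu>" using *(3)[OF i] by blast
        show "u i \<odot> \<sigma> (p i) : \<Sigma> (S' i) ~> X i" using comp_hom[OF shift_hom[OF *(4)[OF i]] u(2)[OF iI]] .
        have "(\<theta> \<odot> \<sigma> h) \<odot> \<sigma> (\<iota>'' i) = \<theta> \<odot> \<sigma> (h \<odot> \<iota>'' i)" using \<theta>(1) *(6) \<iota>''[OF i] by (simp add: hom_def)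
        also have "\<dots> = (\<theta> \<odot> \<sigma> (\<iota>' i)) \<odot> \<sigma> (p i)" unfolding *(7)[OF i]
          using \<theta>(1) \<iota>'[OF iI] *(4)[OF i] by (simp add: hom_def)
        also have "\<dots> = \<iota> i \<odot> (u i \<odot> \<sigma> (p i))" unfolding \<theta>(2)[OF iI]
          using \<iota>[OF iI] u(2)[OF iI] *(4)[OF i] by (simp add: hom_def)
        finally show "(\<theta> \<odot> \<sigma> h) \<odot> \<sigma> (\<iota>'' i) = \<iota> i \<odot> (u i \<odot> \<sigma> (p i))" .
      qed
    qed
  qed
  then show ?thesis using x by blast
qed

text \<open>
  Shift the given morphism, factor it, and desuspend the factorisation; the objects in the middle are
  only isomorphic to shifts.
\<close>

lemma Cpt_unshift:
  assumes z: "z \<in> Obj T" "\<Sigma> z \<in> Cpt \<nu>" shows "z \<in> Cpt \<nu>"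
proof -
  define A where "A = {z \<in> Obj T. \<Sigma> z \<in> Cpt \<nu>}"
  have "A \<subseteq> Cpt \<nu>"
  proof (rule Cpt_coinduct)
    fix z assume "z \<in> A"
    then have z: "z \<in> Obj T" "\<Sigma> z \<in> Cpt \<nu>" by (auto simp: A_def)
    show "factoring_to \<nu> (A \<union> Cpt \<nu>) z"
    proof (rule factoring_toI[OF z(1)])
      fix I :: "'u set" and X P \<iota> f
      assume I: "|I| <o \<kappa>" "is_coproduct T I X P \<iota>" and f: "f : z ~> P"
      note \<iota> = coprod_inj[OF I(2)]
      have PO: "P \<in> Obj T" by (rule coprod_Obj[OF I(2)])
      obtain I' S p Q \<iota>' h g where *: "I' \<subseteq> I" "|I'| <o \<nu>" "\<And>i. i \<in> I' \<Longrightarrow> S i \<in> Cpt \<nu>"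
        "\<And>i. i \<in> I' \<Longrightarrow> p i : S i ~> \<Sigma> (X i)" "is_coproduct T I' S Q \<iota>'" "h : Q ~> \<Sigma> P"
        "\<And>i. i \<in> I' \<Longrightarrow> h \<odot> \<iota>' i = \<sigma> (\<iota> i) \<odot> p i" "g : \<Sigma> z ~> Q" "\<sigma> f = h \<odot> g"
        by (rule factorsE[OF factoring_toD[OF Cpt_factoring[OF z(2)] I(1) shift_coprod[OF I(2)] shift_hom[OF f]] shift_hom[OF f]]) blast
      note \<iota>' = coprod_inj[OF *(5)]
      have "\<forall>i\<in>I'. \<exists>y u v. y \<in> Obj T \<and> u : \<Sigma> y ~> S i \<and> v : S i ~> \<Sigma> y \<and>
          v \<odot> u = Ident T (\<Sigma> y) \<and> u \<odot> v = Ident T (S i)"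
        using unshift hom_Obj(1)[OF \<iota>'] by metis
      then obtain y u v where u: "\<And>i. i \<in> I' \<Longrightarrow> y i \<in> Obj T" "\<And>i. i \<in> I' \<Longrightarrow> u i : \<Sigma> (y i) ~> S i"
        "\<And>i. i \<in> I' \<Longrightarrow> v i : S i ~> \<Sigma> (y i)" "\<And>i. i \<in> I' \<Longrightarrow> v i \<odot> u i = Ident T (\<Sigma> (y i))"
        "\<And>i. i \<in> I' \<Longrightarrow> u i \<odot> v i = Ident T (S i)" by metis
      have yA: "y i \<in> A" if "i \<in> I'" for i
        using isomorphicI[OF u(2,3,4,5)] Cpt_iso[OF *(3)] u(1) that unfolding A_def by simp
      have "\<exists>p'. p' : y i ~> X i \<and> p i \<odot> u i = \<sigma> p'" if i: "i \<in> I'" for i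
        using shift_full[OF comp_hom[OF u(2)[OF i] *(4)[OF i]] u(1)[OF i]] \<iota>[of i] *(1) hom_Obj i by (metis subsetD)
      then obtain p' where p': "\<And>i. i \<in> I' \<Longrightarrow> p' i : y i ~> X i"
        "\<And>i. i \<in> I' \<Longrightarrow> p i \<odot> u i = \<sigma> (p' i)" by metis
      have "|I'| <o \<kappa>" using card_subset_less[OF *(1) I(1)] .
      then obtain R \<rho> where R: "is_coproduct T I' y R \<rho>" using coprod_exists u(1) by blast
      note \<rho> = coprod_inj[OF R]
      have RO: "R \<in> Obj T" by (rule coprod_Obj[OF R])
      have "\<iota> i \<odot> p' i : y i ~> P" if "i \<in> I'" for i using comp_hom p'(1)[OF that] \<iota> *(1) that by blast
      then obtain k where k: "k : R ~> P" "\<And>i. i \<in> I' \<Longrightarrow> k \<odot> \<rho> i = \<iota> i \<odot> p' i"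
        using coprod_obtain[OF R PO, of "\<lambda>i. \<iota> i \<odot> p' i"] by blast
      have "\<sigma> (\<rho> i) \<odot> v i : S i ~> \<Sigma> R" if "i \<in> I'" for i using comp_hom[OF u(3)[OF that] shift_hom[OF \<rho>[OF that]]] .
      then obtain \<theta> where \<theta>: "\<theta> : Q ~> \<Sigma> R" "\<And>i. i \<in> I' \<Longrightarrow> \<theta> \<odot> \<iota>' i = \<sigma> (\<rho> i) \<odot> v i"
        using coprod_obtain[OF *(5) shift_Obj[OF RO], of "\<lambda>i. \<sigma> (\<rho> i) \<odot> v i"] by blast
      have k\<theta>: "\<sigma> k \<odot> \<theta> = h"
      proof (rule coprod_eqI[OF *(5) comp_hom[OF \<theta>(1) shift_hom[OF k(1)]] *(6)])
        fix i assume i: "i \<in> I'"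
        then have iI: "i \<in> I" using *(1) by blast
        have "(\<sigma> k \<odot> \<theta>) \<odot> \<iota>' i = \<sigma> (k \<odot> \<rho> i) \<odot> v i"
          using k(1) \<theta>(1) \<theta>(2)[OF i] \<iota>'[OF i] \<rho>[OF i] u(3)[OF i] by (simp add: hom_def)
        also have "\<dots> = \<sigma> (\<iota> i) \<odot> (\<sigma> (p' i) \<odot> v i)" unfolding k(2)[OF i]
          using \<iota>[OF iI] p'(1)[OF i] u(3)[OF i] by (simp add: hom_def)
        also have "\<sigma> (p' i) \<odot> v i = p i \<odot> (u i \<odot> v i)" unfolding p'(2)[OF i, symmetric]
          using *(4)[OF i] u(2,3)[OF i] by (simp add: hom_def)
        also have "\<dots> = p i" unfolding u(5)[OF i] using *(4)[OF i] by (simp add: hom_def)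
        finally show "(\<sigma> k \<odot> \<theta>) \<odot> \<iota>' i = h \<odot> \<iota>' i" using *(7)[OF i] by simp
      qed
      obtain g' where g': "g' : z ~> R" "\<theta> \<odot> g = \<sigma> g'"
        using shift_full[OF comp_hom[OF *(8) \<theta>(1)] z(1) RO] .
      have "\<sigma> f = \<sigma> (k \<odot> g')"
        using *(9) comp_reduce[OF k\<theta>, of g] k(1) \<theta>(1) *(8) g' by (simp add: hom_def)
      then have f_eq: "f = k \<odot> g'" using shift_faithful f comp_hom[OF g'(1) k(1)] by blast
      show "factors \<nu> (A \<union> Cpt \<nu>) I X P \<iota> f"
        by (rule factorsI[OF *(1,2) _ p'(1) R k g'(1) f_eq]) (use yA in auto)
    qed
  qed
  then show ?thesis using z by (auto simp: A_def)
qed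

definition coprod_closed :: "'u rel \<Rightarrow> 'o set \<Rightarrow> bool" where
  "coprod_closed \<nu> B \<longleftrightarrow> (\<forall>(K::'u set) X P \<iota>. |K| <o \<nu> \<and> (\<forall>k\<in>K. X k \<in> B) \<and> is_coproduct T K X P \<iota> \<longrightarrow> P \<in> B)"

lemma coprod_closedD:
  fixes K :: "'k set"
  assumes "coprod_closed \<nu> B" "\<nu> \<le>o \<kappa>" "|K| <o \<nu>" "\<And>k. k \<in> K \<Longrightarrow> X k \<in> B" "is_coproduct T K X P \<iota>"
  shows "P \<in> B"
proof -
  obtain b :: "'k \<Rightarrow> 'u" where b: "bij_betw b K (b ` K)"
    using small_index ordLess_ordLeq_trans[OF assms(3,2)] by blast
  let ?c = "inv_into K b"
  have c: "bij_betw ?c (b ` K) K" using bij_betw_inv_into[OF b] .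
  have "X (?c j) \<in> B" if "j \<in> b ` K" for j using assms(4) bij_betwE[OF c] that by blast
  then show ?thesis
    using assms(1)[unfolded coprod_closed_def, rule_format, of "b ` K" "\<lambda>j. X (?c j)" P "\<lambda>j. \<iota> (?c j)"]
      coprod_reindex[OF assms(5) c] card_image_less[OF assms(3)] by blast
qed

text \<open>
  Factor each component through \<open>\<Coprod>\<^sub>i S' k i\<close>, and exchange the two coproducts: for fixed \<open>i\<close> the objects
  \<open>S' k i\<close> add up to an object of \<open>B\<close>. Regularity of \<open>\<nu>\<close> bounds the union of the index sets.
\<close>

lemma factors_coprod:
  fixes K :: "'k set" and I :: "'i set"
  assumes \<nu>: "regular_cardinal \<nu>" "\<nu> \<le>o \<kappa>" and B: "coprod_closed \<nu> B"
    and S: "is_coproduct T K Y S \<zeta>" "|K| <o \<nu>" and P: "is_coproduct T I X P \<iota>"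
    and f: "f : S ~> P" "\<And>k. k \<in> K \<Longrightarrow> factors \<nu> B I X P \<iota> (f \<odot> \<zeta> k)"
  shows "factors \<nu> B I X P \<iota> f"
proof -
  have \<nu>\<kappa>: "|A| <o \<nu> \<Longrightarrow> |A| <o \<kappa>" for A :: "'x set" using ordLess_ordLeq_trans \<nu>(2) by blast
  note \<zeta> = coprod_inj[OF S(1)] and \<iota> = coprod_inj[OF P]
  have PO: "P \<in> Obj T" by (rule coprod_Obj[OF P])
  define \<Phi> where "\<Phi> k I' S p Q \<iota>' h g \<longleftrightarrow> I' \<subseteq> I \<and> |I'| <o \<nu> \<and>
     (\<forall>i\<in>I'. S i \<in> B \<and> p i : S i ~> X i) \<and> is_coproduct T I' S Q \<iota>' \<and>
     h : Q ~> P \<and> (\<forall>i\<in>I'. h \<odot> \<iota>' i = \<iota> i \<odot> p i) \<and> g : dm (f \<odot> \<zeta> k) ~> Q \<and> f \<odot> \<zeta> k = h \<odot> g"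
    for k I' S p Q \<iota>' h g
  have "\<forall>k\<in>K. \<exists>I' S p Q \<iota>' h g. \<Phi> k I' S p Q \<iota>' h g"
    using f(2) unfolding factors_def \<Phi>_def by blast
  then obtain I' S' p Q \<iota>' h g where \<Phi>: "\<And>k. k \<in> K \<Longrightarrow> \<Phi> k (I' k) (S' k) (p k) (Q k) (\<iota>' k) (h k) (g k)"
    by metis
  have dm: "dm (f \<odot> \<zeta> k) = Y k" if "k \<in> K" for k using homD(2)[OF comp_hom[OF \<zeta>[OF that] f(1)]] .
  have *: "\<And>k. k \<in> K \<Longrightarrow> I' k \<subseteq> I" "\<And>k. k \<in> K \<Longrightarrow> |I' k| <o \<nu>" "\<And>k i. k \<in> K \<Longrightarrow> i \<in> I' k \<Longrightarrow> S' k i \<in> B"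
    "\<And>k i. k \<in> K \<Longrightarrow> i \<in> I' k \<Longrightarrow> p k i : S' k i ~> X i"
    "\<And>k. k \<in> K \<Longrightarrow> is_coproduct T (I' k) (S' k) (Q k) (\<iota>' k)"
    "\<And>k. k \<in> K \<Longrightarrow> h k : Q k ~> P"
    "\<And>k i. k \<in> K \<Longrightarrow> i \<in> I' k \<Longrightarrow> h k \<odot> \<iota>' k i = \<iota> i \<odot> p k i"
    "\<And>k. k \<in> K \<Longrightarrow> g k : Y k ~> Q k" "\<And>k. k \<in> K \<Longrightarrow> f \<odot> \<zeta> k = h k \<odot> g k"
    using \<Phi> dm unfolding \<Phi>_def by simp_all
  define J where "J = (\<Union>k\<in>K. I' k)"
  define L where "L i = {k\<in>K. i \<in> I' k}" for i
  have J: "J \<subseteq> I" "|J| <o \<nu>" using *(1) card_UN_less[OF \<nu>(1) S(2) *(2)] by (auto simp: J_def)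
  have L: "|L i| <o \<nu>" for i using card_subset_less[OF _ S(2)] by (auto simp: L_def)
  have "\<exists>R \<rho>. is_coproduct T (L i) (\<lambda>k. S' k i) R \<rho>" for i
  proof (rule coprod_exists[OF \<nu>\<kappa>[OF L]])
    show "S' k i \<in> Obj T" if "k \<in> L i" for k using hom_Obj(1)[OF *(4)[of k i]] that by (simp add: L_def)
  qed blast
  then obtain R \<rho> where R: "\<And>i. is_coproduct T (L i) (\<lambda>k. S' k i) (R i) (\<rho> i)" by metis
  note \<rho> = coprod_inj[OF R]
  have RB: "R i \<in> B" for i using coprod_closedD[OF B \<nu>(2) L _ R] *(3) by (simp add: L_def)
  have RO: "R i \<in> Obj T" for i by (rule coprod_Obj[OF R])
  have "\<exists>q. q : R i ~> X i \<and> (\<forall>k\<in>L i. q \<odot> \<rho> i k = p k i)" if i: "i \<in> J" for i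
  proof -
    have "X i \<in> Obj T" using \<iota> J(1) i hom_Obj by blast
    moreover have "p k i : S' k i ~> X i" if "k \<in> L i" for k using *(4) that by (simp add: L_def)
    ultimately show ?thesis by (intro coprod_ex[OF R])
  qed
  then have "\<forall>i\<in>J. \<exists>q. q : R i ~> X i \<and> (\<forall>k\<in>L i. q \<odot> \<rho> i k = p k i)" by blast
  from bchoice[OF this] obtain q where q: "\<And>i. i \<in> J \<Longrightarrow> q i : R i ~> X i"
    "\<And>i k. i \<in> J \<Longrightarrow> k \<in> L i \<Longrightarrow> q i \<odot> \<rho> i k = p k i" by blast
  obtain Q' \<tau> where Q': "is_coproduct T J R Q' \<tau>" by (rule coprod_exists[OF \<nu>\<kappa>[OF J(2)] RO])
  note \<tau> = coprod_inj[OF Q']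
  have Q'O: "Q' \<in> Obj T" by (rule coprod_Obj[OF Q'])
  have "\<iota> i \<odot> q i : R i ~> P" if "i \<in> J" for i using comp_hom[OF q(1)[OF that]] \<iota> J(1) that by blast
  then obtain H where H: "H : Q' ~> P" "\<And>i. i \<in> J \<Longrightarrow> H \<odot> \<tau> i = \<iota> i \<odot> q i"
    using coprod_obtain[OF Q' PO, of "\<lambda>i. \<iota> i \<odot> q i"] by blast
  have IJ: "i \<in> J" "k \<in> L i" "i \<in> I" if "k \<in> K" "i \<in> I' k" for i k using that J(1) by (auto simp: J_def L_def)
  have "\<exists>t. t : Q k ~> Q' \<and> H \<odot> t = h k" if k: "k \<in> K" for k
  proof -
    have "\<tau> i \<odot> \<rho> i k : S' k i ~> Q'" if "i \<in> I' k" for i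
      using comp_hom[OF \<rho> \<tau>, of k i] IJ[OF k that] by blast
    then obtain t where t: "t : Q k ~> Q'" "\<And>i. i \<in> I' k \<Longrightarrow> t \<odot> \<iota>' k i = \<tau> i \<odot> \<rho> i k"
      using coprod_obtain[OF *(5)[OF k] Q'O, of "\<lambda>i. \<tau> i \<odot> \<rho> i k"] by blast
    have "H \<odot> t = h k"
    proof (rule coprod_eqI[OF *(5)[OF k] comp_hom[OF t(1) H(1)] *(6)[OF k]])
      fix i assume i: "i \<in> I' k"
      note ij = IJ[OF k i]
      have "(H \<odot> t) \<odot> \<iota>' k i = H \<odot> (\<tau> i \<odot> \<rho> i k)"
        using H(1) t(1) t(2)[OF i] coprod_inj[OF *(5)[OF k] i] by (simp add: hom_def)
      also have "\<dots> = (\<iota> i \<odot> q i) \<odot> \<rho> i k"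
        using comp_reduce[OF H(2)[OF ij(1)], of "\<rho> i k"] H(1) \<tau>[OF ij(1)] \<rho>[OF ij(2)] by (simp add: hom_def)
      also have "\<dots> = \<iota> i \<odot> p k i" using q(2)[OF ij(1,2)] \<iota>[OF ij(3)] q(1)[OF ij(1)] \<rho>[OF ij(2)] by (simp add: hom_def)
      finally show "(H \<odot> t) \<odot> \<iota>' k i = h k \<odot> \<iota>' k i" using *(7)[OF k i] by simp
    qed
    then show ?thesis using t(1) by blast
  qed
  then obtain t where t: "\<And>k. k \<in> K \<Longrightarrow> t k : Q k ~> Q'" "\<And>k. k \<in> K \<Longrightarrow> H \<odot> t k = h k" by metis
  have "t k \<odot> g k : Y k ~> Q'" if "k \<in> K" for k using comp_hom[OF *(8)[OF that] t(1)[OF that]] .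
  then obtain G where G: "G : S ~> Q'" "\<And>k. k \<in> K \<Longrightarrow> G \<odot> \<zeta> k = t k \<odot> g k"
    using coprod_obtain[OF S(1) Q'O, of "\<lambda>k. t k \<odot> g k"] by blast
  have "f = H \<odot> G"
  proof (rule coprod_eqI[OF S(1) f(1) comp_hom[OF G(1) H(1)]])
    fix k assume k: "k \<in> K"
    have "(H \<odot> G) \<odot> \<zeta> k = H \<odot> (t k \<odot> g k)" using H(1) G(1) G(2)[OF k] \<zeta>[OF k] by (simp add: hom_def)
    also have "\<dots> = h k \<odot> g k" using comp_reduce[OF t(2)[OF k], of "g k"] H(1) t(1)[OF k] *(8)[OF k] by (simp add: hom_def)
    finally show "f \<odot> \<zeta> k = (H \<odot> G) \<odot> \<zeta> k" using *(9)[OF k] by simp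
  qed
  then show ?thesis using factorsI[OF J _ q(1) Q' H(1) H(2) G(1)] RB by blast
qed

text \<open>The sum of two morphisms on \<open>s\<close> is a morphism on \<open>s \<oplus> s\<close> composed with the diagonal.\<close>

lemma factors_add:
  assumes \<nu>: "regular_cardinal \<nu>" "\<nu> \<le>o \<kappa>" and B: "coprod_closed \<nu> B"
    and P: "is_coproduct T I X P \<iota>" and f: "f : s ~> P" "f' : s ~> P"
    "factors \<nu> B I X P \<iota> f" "factors \<nu> B I X P \<iota> f'"
  shows "factors \<nu> B I X P \<iota> (f \<oplus> f')"
proof -
  have s: "s \<in> Obj T" "P \<in> Obj T" using f hom_Obj by blast+
  obtain S \<zeta> where S: "is_coproduct T (UNIV::bool set) (\<lambda>b. s) S \<zeta>"
    using binary_coproduct_exists[OF s(1) s(1)] by auto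
  note \<zeta> = coprod_inj[OF S UNIV_I]
  have "\<exists>h. h : S ~> P \<and> (\<forall>b\<in>UNIV. h \<odot> \<zeta> b = (if b then f else f'))"
    by (rule coprod_ex[OF S s(2)]) (use f in simp)
  then obtain h where h: "h : S ~> P" "\<And>b. h \<odot> \<zeta> b = (if b then f else f')" by blast
  have "factors \<nu> B I X P \<iota> h"
    by (rule factors_coprod[OF \<nu> B S card_finite_less[OF \<nu>(1)] P h(1)]) (use h(2) f in auto)
  then have "factors \<nu> B I X P \<iota> (h \<odot> (\<zeta> True \<oplus> \<zeta> False))"
    using factors_precomp h(1) add_hom[OF \<zeta> \<zeta>] by blast
  moreover have "h \<odot> (\<zeta> True \<oplus> \<zeta> False) = f \<oplus> f'" using h \<zeta>[of True] \<zeta>[of False] by (simp add: hom_def)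
  ultimately show ?thesis by simp
qed

inductive_set coprod_closure :: "'u rel \<Rightarrow> 'o set \<Rightarrow> 'o set" for \<nu> A where
  base: "x \<in> A \<Longrightarrow> x \<in> coprod_closure \<nu> A"
| step: "|K::'u set| <o \<nu> \<Longrightarrow> (\<And>k. k \<in> K \<Longrightarrow> X k \<in> coprod_closure \<nu> A) \<Longrightarrow> is_coproduct T K X P \<iota>
    \<Longrightarrow> P \<in> coprod_closure \<nu> A"

lemma coprod_closed_closure: "coprod_closed \<nu> (coprod_closure \<nu> A)"
  unfolding coprod_closed_def using coprod_closure.step by blast

text \<open>
  Coinduction up to coproducts: the factorisations may use everything built from \<open>A\<close> and compact
  objects by coproducts of fewer than \<open>\<nu>\<close> objects.
\<close>

lemma Cpt_coinduct_coprod: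
  assumes \<nu>: "regular_cardinal \<nu>" "\<nu> \<le>o \<kappa>"
    and A: "\<And>S. S \<in> A \<Longrightarrow> factoring_to \<nu> (coprod_closure \<nu> (A \<union> Cpt \<nu>)) S"
  shows "coprod_closure \<nu> (A \<union> Cpt \<nu>) \<subseteq> Cpt \<nu>"
proof (rule Cpt_coinduct)
  let ?B = "coprod_closure \<nu> (A \<union> Cpt \<nu>)"
  fix S assume "S \<in> ?B"
  then have "factoring_to \<nu> ?B S"
  proof induction
    case (base x)
    then show ?case
      using A Cpt_factoring factoring_to_mono[of \<nu> "Cpt \<nu>" x ?B] coprod_closure.base by blast
  next
    case (step K Y S \<zeta>)
    note \<zeta> = coprod_inj[OF step(3)]
    show ?case
    proof (rule factoring_toI[OF coprod_Obj[OF step(3)]])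
      fix I :: "'u set" and X P \<iota> f
      assume I: "|I| <o \<kappa>" "is_coproduct T I X P \<iota>" "f : S ~> P"
      show "factors \<nu> ?B I X P \<iota> f"
      proof (rule factors_coprod[OF \<nu> coprod_closed_closure step(3,1) I(2,3)])
        fix k assume k: "k \<in> K"
        show "factors \<nu> ?B I X P \<iota> (f \<odot> \<zeta> k)"
          using factoring_toD[OF step(4)[OF k] I(1,2) comp_hom[OF \<zeta>[OF k] I(3)]] .
      qed
    qed
  qed
  then show "factoring_to \<nu> (?B \<union> Cpt \<nu>) S" using factoring_to_mono by blast
qed

lemma Cpt_coprod_closed:
  assumes "regular_cardinal \<nu>" "\<nu> \<le>o \<kappa>" shows "coprod_closed \<nu> (Cpt \<nu>)"
proof -
  have "coprod_closure \<nu> (Cpt \<nu>) = Cpt \<nu>"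
    using Cpt_coinduct_coprod[OF assms, of "{}"] coprod_closure.base by auto
  then show ?thesis using coprod_closed_closure by metis
qed

text \<open>
  A morphism that is killed by a coproduct \<open>Q\<close> of morphisms \<open>q i\<close> lifts to the coproduct of the fibres
  of the \<open>q i\<close>; factor the lift.
\<close>

lemma coprod_kernel_factor:
  fixes I :: "'i set"
  assumes s: "s \<in> Cpt \<nu>" and I: "|I| <o \<kappa>"
    and X: "is_coproduct T I x X \<iota>" and Z: "is_coproduct T I z Z \<zeta>"
    and q: "\<And>i. i \<in> I \<Longrightarrow> q i : x i ~> z i"
    and Q: "Q : X ~> Z" "\<And>i. i \<in> I \<Longrightarrow> Q \<odot> \<iota> i = \<zeta> i \<odot> q i"
    and u: "u : s ~> X" "Q \<odot> u = Zero T s Z"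
  shows "\<exists>I' S a P \<iota>' h g. I' \<subseteq> I \<and> |I'| <o \<nu> \<and>
    (\<forall>i\<in>I'. S i \<in> Cpt \<nu> \<and> a i : S i ~> x i \<and> q i \<odot> a i = Zero T (S i) (z i)) \<and>
    is_coproduct T I' S P \<iota>' \<and> h : P ~> X \<and> (\<forall>i\<in>I'. h \<odot> \<iota>' i = \<iota> i \<odot> a i) \<and>
    g : s ~> P \<and> u = h \<odot> g"
proof -
  note \<iota> = coprod_inj[OF X]
  have XO: "X \<in> Obj T" by (rule coprod_Obj[OF X])
  have "\<forall>i\<in>I. \<exists>w a h. exact_triangle T w (x i) (z i) a (q i) h" using fibre_exists[OF q] by metis
  then obtain w a h where t: "\<And>i. i \<in> I \<Longrightarrow> exact_triangle T (w i) (x i) (z i) (a i) (q i) (h i)" by metis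
  note tt = triangle_hom[OF t]
  obtain W \<omega> where W: "is_coproduct T I w W \<omega>" using coprod_exists[OF I, of w] tt(1) hom_Obj by blast
  note \<omega> = coprod_inj[OF W]
  have "\<iota> i \<odot> a i : w i ~> X" if "i \<in> I" for i using comp_hom[OF tt(1)[OF that] \<iota>[OF that]] .
  then obtain A where A: "A : W ~> X" "\<And>i. i \<in> I \<Longrightarrow> A \<odot> \<omega> i = \<iota> i \<odot> a i"
    using coprod_obtain[OF W XO, of "\<lambda>i. \<iota> i \<odot> a i"] by blast
  obtain l where l: "l : s ~> W" "u = A \<odot> l" using coprod_fibre_lift[OF t W X Z A Q u] by blast
  obtain I' S p P \<iota>' k g where *: "I' \<subseteq> I" "|I'| <o \<nu>" "\<And>i. i \<in> I' \<Longrightarrow> S i \<in> Cpt \<nu>"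
    "\<And>i. i \<in> I' \<Longrightarrow> p i : S i ~> w i" "is_coproduct T I' S P \<iota>'" "k : P ~> W"
    "\<And>i. i \<in> I' \<Longrightarrow> k \<odot> \<iota>' i = \<omega> i \<odot> p i" "g : s ~> P" "l = k \<odot> g"
    by (rule factorsE[OF factoring_toD[OF Cpt_factoring[OF s] I W l(1)] l(1)]) blast
  note \<iota>' = coprod_inj[OF *(5)]
  have u_eq: "u = (A \<odot> k) \<odot> g" using l *(6,8,9) A(1) by (simp add: hom_def)
  have "a i \<odot> p i : S i ~> x i \<and> q i \<odot> (a i \<odot> p i) = Zero T (S i) (z i) \<and>
    (A \<odot> k) \<odot> \<iota>' i = \<iota> i \<odot> (a i \<odot> p i)" if i: "i \<in> I'" for i
  proof (intro conjI)
    have iI: "i \<in> I" using *(1) i by blast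
    show "a i \<odot> p i : S i ~> x i" using comp_hom[OF *(4)[OF i] tt(1)[OF iI]] .
    have "q i \<odot> (a i \<odot> p i) = Zero T (w i) (z i) \<odot> p i"
      using comp_reduce[OF triangle_comp_zero[OF t[OF iI]], of "p i"] tt[OF iI] *(4)[OF i] by (simp add: hom_def)
    then show "q i \<odot> (a i \<odot> p i) = Zero T (S i) (z i)"
      using *(4)[OF i] hom_Obj(2)[OF tt(2)[OF iI]] by (simp add: hom_def)
    have "(A \<odot> k) \<odot> \<iota>' i = A \<odot> (\<omega> i \<odot> p i)" using A(1) *(6) *(7)[OF i] \<iota>'[OF i] by (simp add: hom_def)
    also have "\<dots> = (\<iota> i \<odot> a i) \<odot> p i"
      using comp_reduce[OF A(2)[OF iI], of "p i"] A(1) \<omega>[OF iI] *(4)[OF i] by (simp add: hom_def)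
    finally show "(A \<odot> k) \<odot> \<iota>' i = \<iota> i \<odot> (a i \<odot> p i)"
      using \<iota>[OF iI] tt(1)[OF iI] *(4)[OF i] by (simp add: hom_def)
  qed
  then show ?thesis
    by (intro exI[of _ I'] exI[of _ S] exI[of _ "\<lambda>i. a i \<odot> p i"] exI[of _ P] exI[of _ \<iota>'] exI[of _ "A \<odot> k"] exI[of _ g])
       (use *(1,2,3,5,8) comp_hom[OF *(6) A(1)] u_eq in blast)
qed

end

context cocomplete_triangulated
begin

text \<open>
  Let \<open>F\<close> be a morphism from the cone \<open>z\<close> of \<open>f : x \<rightarrow> y\<close> to a coproduct of the \<open>X\<^sub>i\<close>. Its restriction to \<open>y\<close>
  factors through \<open>\<Coprod>S\<^sub>i\<close> with \<open>S\<^sub>i\<close> compact, and since its restriction to \<open>x\<close> is zero, \<open>x \<rightarrow> \<Coprod>S\<^sub>i\<close> factors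
  through compact objects \<open>S3\<^sub>i \<rightarrow> S\<^sub>i\<close> whose composites to \<open>X\<^sub>i\<close> vanish. The cones of \<open>S3\<^sub>i \<rightarrow> S\<^sub>i\<close> map to
  \<open>X\<^sub>i\<close>, and \<open>F\<close> agrees on \<open>y\<close> with a morphism through their coproduct. The difference factors through
  \<open>\<Sigma> x\<close>, which is compact. Coinduction up to coproducts allows the sum of the two.
\<close>

lemma Cpt_cone:
  assumes \<nu>: "regular_cardinal \<nu>" "\<nu> \<le>o \<kappa>"
    and t: "exact_triangle T x y z f g h" and xy: "x \<in> Cpt \<nu>" "y \<in> Cpt \<nu>"
  shows "z \<in> Cpt \<nu>"
proof -
  define A where "A = {z. \<exists>x y f g h. exact_triangle T x y z f g h \<and> x \<in> Cpt \<nu> \<and> y \<in> Cpt \<nu>}"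
  let ?B = "coprod_closure \<nu> (A \<union> Cpt \<nu>)"
  have "?B \<subseteq> Cpt \<nu>"
  proof (rule Cpt_coinduct_coprod[OF \<nu>])
    fix z assume "z \<in> A"
    then obtain x y f g h where t: "exact_triangle T x y z f g h" and x: "x \<in> Cpt \<nu>" and y: "y \<in> Cpt \<nu>"
      unfolding A_def by blast
    note tt = triangle_hom[OF t]
    show "factoring_to \<nu> ?B z"
    proof (rule factoring_toI)
      show "z \<in> Obj T" using tt hom_Obj by blast
      fix I :: "'u set" and X P \<iota> F
      assume I: "|I| <o \<kappa>" and P: "is_coproduct T I X P \<iota>" and F: "F : z ~> P"
      note \<iota> = coprod_inj[OF P]
      have PO: "P \<in> Obj T" by (rule coprod_Obj[OF P])
      have Fg: "F \<odot> g : y ~> P" using comp_hom[OF tt(2) F] .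
      obtain I1 S p Q \<iota>1 k e where *: "I1 \<subseteq> I" "|I1| <o \<nu>" "\<And>i. i \<in> I1 \<Longrightarrow> S i \<in> Cpt \<nu>"
        "\<And>i. i \<in> I1 \<Longrightarrow> p i : S i ~> X i" "is_coproduct T I1 S Q \<iota>1" "k : Q ~> P"
        "\<And>i. i \<in> I1 \<Longrightarrow> k \<odot> \<iota>1 i = \<iota> i \<odot> p i" "e : y ~> Q" "F \<odot> g = k \<odot> e"
        by (rule factorsE[OF factoring_toD[OF Cpt_factoring[OF y] I P Fg] Fg]) blast
      note \<iota>1 = coprod_inj[OF *(5)]
      have I1: "|I1| <o \<kappa>" using card_subset_less[OF *(1) I] .
      have XO: "X i \<in> Obj T" if "i \<in> I" for i using hom_Obj(1)[OF \<iota>[OF that]] .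
      obtain R \<rho> where R: "is_coproduct T I1 X R \<rho>"
        by (rule coprod_exists[OF I1, of X]) (use *(1) XO in blast)+
      note \<rho> = coprod_inj[OF R]
      have RO: "R \<in> Obj T" by (rule coprod_Obj[OF R])
      \<comment> \<open>The projection of the whole coproduct onto the summands indexed by \<open>I1\<close>.\<close>
      have "\<exists>r. r : P ~> R \<and> (\<forall>i\<in>I. r \<odot> \<iota> i = (if i \<in> I1 then \<rho> i else Zero T (X i) R))"
        by (rule coprod_ex[OF P RO]) (use \<rho> zero_hom XO RO in auto)
      then obtain r where r: "r : P ~> R" "\<And>i. i \<in> I1 \<Longrightarrow> r \<odot> \<iota> i = \<rho> i" using *(1) by (metis subsetD)
      have rk: "(r \<odot> k) \<odot> \<iota>1 i = \<rho> i \<odot> p i" if i: "i \<in> I1" for i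
      proof -
        have "\<iota> i : X i ~> P" using \<iota> *(1) i by blast
        then have "r \<odot> (\<iota> i \<odot> p i) = \<rho> i \<odot> p i" using comp_reduce[OF r(2)[OF i], of "p i"] r(1) *(4)[OF i] by (simp add: hom_def)
        then show ?thesis using r(1) *(6) *(7)[OF i] \<iota>1[OF i] by (simp add: hom_def)
      qed
      have "k \<odot> (e \<odot> f) = F \<odot> (g \<odot> f)"
        using comp_reduce[OF *(9)[symmetric], of f] *(6,8) tt F by (simp add: hom_def)
      also have "\<dots> = Zero T x P" unfolding triangle_comp_zero[OF t] using F tt hom_Obj[OF tt(1)] by (simp add: hom_def)
      finally have "(r \<odot> k) \<odot> (e \<odot> f) = r \<odot> Zero T x P" using r(1) *(6,8) tt by (simp add: hom_def)
      then have kill: "(r \<odot> k) \<odot> (e \<odot> f) = Zero T x R" using r(1) hom_Obj[OF tt(1)] by (simp add: hom_def)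
      obtain I2 S2 a Q2 \<iota>2 k2 e2 where 2: "I2 \<subseteq> I1 \<and> |I2| <o \<nu> \<and>
        (\<forall>i\<in>I2. S2 i \<in> Cpt \<nu> \<and> a i : S2 i ~> S i \<and> p i \<odot> a i = Zero T (S2 i) (X i)) \<and>
        is_coproduct T I2 S2 Q2 \<iota>2 \<and> k2 : Q2 ~> Q \<and> (\<forall>i\<in>I2. k2 \<odot> \<iota>2 i = \<iota>1 i \<odot> a i) \<and>
        e2 : x ~> Q2 \<and> e \<odot> f = k2 \<odot> e2"
        using coprod_kernel_factor[OF x I1 *(5) R *(4) comp_hom[OF *(6) r(1)] rk comp_hom[OF tt(1) *(8)] kill]
        by blast
      then have 2: "I2 \<subseteq> I1" "|I2| <o \<nu>" "\<And>i. i \<in> I2 \<Longrightarrow> S2 i \<in> Cpt \<nu>" "\<And>i. i \<in> I2 \<Longrightarrow> a i : S2 i ~> S i"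
        "\<And>i. i \<in> I2 \<Longrightarrow> p i \<odot> a i = Zero T (S2 i) (X i)"
        "is_coproduct T I2 S2 Q2 \<iota>2" "k2 : Q2 ~> Q" "\<And>i. i \<in> I2 \<Longrightarrow> k2 \<odot> \<iota>2 i = \<iota>1 i \<odot> a i"
        "e2 : x ~> Q2" "e \<odot> f = k2 \<odot> e2"
        by blast+
      have xO: "x \<in> Obj T" using hom_Obj tt by blast
      \<comment> \<open>Make the two index sets agree, so that the cones can be formed summand by summand.\<close>
      obtain S3 a3 Q3 \<iota>3 m t' where Q3: "is_coproduct T I1 S3 Q3 \<iota>3" and m: "m : Q3 ~> Q"
        "\<forall>i\<in>I1. m \<odot> \<iota>3 i = \<iota>1 i \<odot> a3 i" and t': "t' : Q2 ~> Q3" "m \<odot> t' = k2"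
        and S3': "\<forall>i\<in>I1. a3 i : S3 i ~> S i \<and>
          (i \<in> I2 \<and> S3 i = S2 i \<and> a3 i = a i \<or> S3 i = x \<and> a3 i = Zero T x (S i))"
        using extend_coprod[OF 2(6) *(5) 2(1) I1 2(4,7,8) xO] by blast
      have S3: "S3 i \<in> Cpt \<nu>" if "i \<in> I1" for i using S3'[rule_format, OF that] 2(3) x by auto
      have a3: "a3 i : S3 i ~> S i" "p i \<odot> a3 i = Zero T (S3 i) (X i)" if "i \<in> I1" for i
        using S3'[rule_format, OF that] 2(5)[of i] *(4)[OF that] xO by (auto simp: hom_def)
      have e3: "t' \<odot> e2 : x ~> Q3" "e \<odot> f = m \<odot> (t' \<odot> e2)"
        using comp_hom[OF 2(9) t'(1)] comp_reduce[OF t'(2), of e2] 2(9,10) m(1) t'(1) by (simp_all add: hom_def)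
      have "\<forall>i\<in>I1. \<exists>z b c. exact_triangle T (S3 i) (S i) z (a3 i) b c" using cone_exists[OF a3(1)] by metis
      then obtain z' b c where tz: "\<And>i. i \<in> I1 \<Longrightarrow> exact_triangle T (S3 i) (S i) (z' i) (a3 i) (b i) (c i)" by metis
      note ttz = triangle_hom[OF tz]
      have z'A: "z' i \<in> ?B" if "i \<in> I1" for i
        using coprod_closure.base[of "z' i" "A \<union> Cpt \<nu>"] tz[OF that] S3[OF that] *(3)[OF that] unfolding A_def by blast
      have "\<forall>i\<in>I1. \<exists>p'. p' : z' i ~> X i \<and> p i = p' \<odot> b i"
        using triangle_extend[OF tz *(4) a3(2)] by metis
      then obtain p' where p': "\<And>i. i \<in> I1 \<Longrightarrow> p' i : z' i ~> X i" "\<And>i. i \<in> I1 \<Longrightarrow> p i = p' i \<odot> b i" by metis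
      obtain C G H where tC: "exact_triangle T Q3 Q C m G H" using cone_exists[OF m(1)] .
      note ttC = triangle_hom[OF tC]
      obtain c' where "is_coproduct T I1 z' C c' \<and> (\<forall>i\<in>I1. c' i \<odot> b i = G \<odot> \<iota>1 i)"
        using coprod_triangle[OF tz Q3 *(5) m(2)[rule_format] tC] by blast
      then have c': "is_coproduct T I1 z' C c'" "\<And>i. i \<in> I1 \<Longrightarrow> c' i \<odot> b i = G \<odot> \<iota>1 i" by blast+
      note c'i = coprod_inj[OF c'(1)]
      obtain w where w: "w : z ~> C" "w \<odot> g = G \<odot> e"
        using triangle_fill[OF t tC e3(1) *(8) e3(2)] by blast
      have "\<exists>k'. k' : C ~> P \<and> (\<forall>i\<in>I1. k' \<odot> c' i = \<iota> i \<odot> p' i)"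
        by (rule coprod_ex[OF c'(1) PO]) (use comp_hom[OF p'(1) \<iota>] *(1) in blast)
      then obtain k' where k': "k' : C ~> P" "\<And>i. i \<in> I1 \<Longrightarrow> k' \<odot> c' i = \<iota> i \<odot> p' i" by blast
      have k'G: "k' \<odot> G = k"
      proof (rule coprod_eqI[OF *(5) comp_hom[OF ttC(2) k'(1)] *(6)])
        fix i assume i: "i \<in> I1"
        have \<iota>i: "\<iota> i : X i ~> P" using \<iota> *(1) i by blast
        have "(k' \<odot> G) \<odot> \<iota>1 i = k' \<odot> (c' i \<odot> b i)" using k'(1) ttC \<iota>1[OF i] c'(2)[OF i] by (simp add: hom_def)
        also have "\<dots> = (\<iota> i \<odot> p' i) \<odot> b i" using comp_reduce[OF k'(2)[OF i], of "b i"] k'(1) c'i[OF i] ttz[OF i] by (simp add: hom_def)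
        also have "\<dots> = \<iota> i \<odot> p i" using p'[OF i] \<iota>i ttz[OF i] by (simp add: hom_def)
        finally show "(k' \<odot> G) \<odot> \<iota>1 i = k \<odot> \<iota>1 i" using *(7)[OF i] by simp
      qed
      have k'w: "k' \<odot> w : z ~> P" using comp_hom[OF w(1) k'(1)] .
      have "(k' \<odot> w) \<odot> g = (k' \<odot> G) \<odot> e" using k'(1) w ttC tt *(8) by (simp add: hom_def)
      then have "F \<odot> g = (k' \<odot> w) \<odot> g" using k'G *(9) by simp
      then obtain l where l: "l : \<Sigma> x ~> P" "F = (k' \<odot> w) \<oplus> (l \<odot> h)"
        using triangle_extend2_diff[OF t F k'w] by blast
      have B: "coprod_closed \<nu> ?B" by (rule coprod_closed_closure)
      have "factors \<nu> ?B I X P \<iota> (k' \<odot> w)"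
        by (rule factorsI[OF *(1,2) z'A p'(1) c'(1) k' w(1)]) auto
      moreover have "factors \<nu> ?B I X P \<iota> (l \<odot> h)"
        using factors_mono[OF factors_precomp[OF factoring_toD[OF Cpt_factoring[OF Cpt_shift[OF x]] I P l(1)] l(1) tt(3)]]
          coprod_closure.base[of _ "A \<union> Cpt \<nu>"] by blast
      ultimately show "factors \<nu> ?B I X P \<iota> F"
        using factors_add[OF \<nu> B P k'w comp_hom[OF tt(3) l(1)]] l(2) by simp
    qed
  qed
  moreover have "z \<in> ?B" using coprod_closure.base[of z "A \<union> Cpt \<nu>"] t xy unfolding A_def by blast
  ultimately show ?thesis by blast
qed

lemma small_objectD:
  fixes I :: "'i set"
  assumes "small_object \<kappa> \<nu> T S" "|I| <o \<kappa>" "is_coproduct T I X P \<iota>" "f : S ~> P"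
  obtains I' Q \<iota>' h g where "I' \<subseteq> I" "|I'| <o \<nu>" "is_coproduct T I' X Q \<iota>'" "h : Q ~> P"
    "\<And>i. i \<in> I' \<Longrightarrow> h \<odot> \<iota>' i = \<iota> i" "g : S ~> Q" "f = h \<odot> g"
proof -
  obtain b :: "'i \<Rightarrow> 'u" where b: "bij_betw b I (b ` I)" using small_index[OF assms(2)] .
  define c where "c = inv_into I b"
  have c: "bij_betw c (b ` I) I" using bij_betw_inv_into[OF b] by (simp add: c_def)
  obtain J Q \<iota>' h g where *: "J \<subseteq> b ` I" "|J| <o \<nu>" "is_coproduct T J (\<lambda>j. X (c j)) Q \<iota>'" "h \<in> Hom T Q P"
    "\<forall>j\<in>J. h \<odot> \<iota>' j = \<iota> (c j)" "g \<in> Hom T S Q" "f = h \<odot> g"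
    using assms(1)[unfolded small_object_def, THEN conjunct2, rule_format, of "b ` I" "\<lambda>j. X (c j)" P "\<lambda>j. \<iota> (c j)" f]
      coprod_reindex[OF assms(3) c] card_image_less[OF assms(2)] hom_Obj(3)[OF assms(4)] by blast
  have bi: "bij_betw c J (c ` J)" using c *(1) by (rule bij_betw_subset) simp
  have cJ: "inv_into J c i \<in> J" "c (inv_into J c i) = i" if "i \<in> c ` J" for i
    using that by (auto simp: inv_into_into f_inv_into_f)
  show thesis
  proof (rule that)
    show "c ` J \<subseteq> I" using *(1) c by (auto simp: bij_betw_def)
    show "|c ` J| <o \<nu>" by (rule card_image_less[OF *(2)])
    show "is_coproduct T (c ` J) X Q (\<lambda>i. \<iota>' (inv_into J c i))"
      by (rule coprod_unreindex[OF *(3) bi]) simp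
    show "h : Q ~> P" "g : S ~> Q"
      using *(4,6) coprod_Obj[OF *(3)] hom_Obj[OF assms(4)] homI by blast+
    show "h \<odot> \<iota>' (inv_into J c i) = \<iota> i" if "i \<in> c ` J" for i using *(5) cJ[OF that] by simp
  qed (rule *(7))
qed

text \<open>
  Cover each \<open>X i\<close> by a coproduct \<open>V i\<close> of generators, one for each morphism from a generator to
  \<open>X i\<close>. By the hypothesis \<open>perfect\<close>, a morphism from a generator to \<open>\<Coprod>X\<^sub>i\<close> lifts to \<open>\<Coprod>V\<^sub>i\<close>, and by
  smallness it uses fewer than \<open>\<alpha>\<close> of all the generators involved. Hence coproducts of
  fewer than \<open>\<alpha>\<close> generators form a class as required for coinduction.
\<close>

lemma generators_compact:
  assumes \<alpha>: "regular_cardinal \<alpha>" "\<alpha> \<le>o \<kappa>"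
    and \<S>: "|\<S>| <o \<kappa>" "\<And>S. S \<in> \<S> \<Longrightarrow> small_object \<kappa> \<alpha> T S"
    and perfect: "\<And>(I::'u set) X Y f P \<iota> Q \<iota>' h. |I| <o \<kappa> \<Longrightarrow> (\<forall>i\<in>I. f i \<in> Hom T (X i) (Y i)) \<Longrightarrow>
           is_coproduct T I X P \<iota> \<Longrightarrow> is_coproduct T I Y Q \<iota>' \<Longrightarrow> is_coproduct_map T I f P \<iota> Q \<iota>' h \<Longrightarrow>
           (\<forall>i\<in>I. \<forall>S\<in>\<S>. hom_surjective T S (X i) (Y i) (f i)) \<Longrightarrow> (\<forall>S\<in>\<S>. hom_surjective T S P Q h)"
  shows "\<S> \<subseteq> Cpt \<alpha>"
proof -
  let ?B = "coprod_closure \<alpha> (\<S> \<union> Cpt \<alpha>)"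
  have B: "coprod_closed \<alpha> ?B" by (rule coprod_closed_closure)
  have \<alpha>\<kappa>: "|A| <o \<alpha> \<Longrightarrow> |A| <o \<kappa>" for A :: "'x set" using ordLess_ordLeq_trans \<alpha>(2) by blast
  have \<alpha>\<kappa>': "|A| <o \<alpha> \<Longrightarrow> |A| <o \<kappa>" for A :: "'y set" using ordLess_ordLeq_trans \<alpha>(2) by blast
  have \<S>O: "S \<in> Obj T" if "S \<in> \<S>" for S using \<S>(2)[OF that] by (simp add: small_object_def)
  have "?B \<subseteq> Cpt \<alpha>"
  proof (rule Cpt_coinduct_coprod[OF \<alpha>])
    fix S assume S: "S \<in> \<S>"
    show "factoring_to \<alpha> ?B S"
    proof (rule factoring_toI[OF \<S>O[OF S]])
      fix I :: "'u set" and X P \<iota> f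
      assume I: "|I| <o \<kappa>" and P: "is_coproduct T I X P \<iota>" and f: "f : S ~> P"
      note \<iota> = coprod_inj[OF P]
      have PO: "P \<in> Obj T" by (rule coprod_Obj[OF P])
      have XO: "X i \<in> Obj T" if "i \<in> I" for i using hom_Obj(1)[OF \<iota>[OF that]] .
      define J where "J i = Sigma \<S> (\<lambda>s. Hom T s (X i))" for i
      have J: "|J i| <o \<kappa>" if "i \<in> I" for i unfolding J_def
        by (rule card_Sigma_less[OF regular_\<kappa> \<S>(1)]) (use lsmall \<S>O XO[OF that] in \<open>auto simp: locally_small_def\<close>)
      have Jh: "snd j : fst j ~> X i" "fst j \<in> \<S>" if "i \<in> I" "j \<in> J i" for i j
        using that \<S>O XO by (auto simp: J_def intro: homI)
      have "\<exists>V \<upsilon> v. is_coproduct T (J i) fst V \<upsilon> \<and> v : V ~> X i \<and> (\<forall>j\<in>J i. v \<odot> \<upsilon> j = snd j)"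
        if i: "i \<in> I" for i
      proof -
        obtain V \<upsilon> where V: "is_coproduct T (J i) fst V \<upsilon>"
          by (rule coprod_exists[OF J[OF i], of fst]) (use hom_Obj(1)[OF Jh(1)[OF i]] in blast)+
        then show ?thesis using coprod_ex[OF V XO[OF i] Jh(1)[OF i]] by blast
      qed
      then obtain V \<upsilon> v where V: "\<And>i. i \<in> I \<Longrightarrow> is_coproduct T (J i) fst (V i) (\<upsilon> i)"
        "\<And>i. i \<in> I \<Longrightarrow> v i : V i ~> X i" "\<And>i j. i \<in> I \<Longrightarrow> j \<in> J i \<Longrightarrow> v i \<odot> \<upsilon> i j = snd j" by metis
      note \<upsilon> = coprod_inj[OF V(1)]
      obtain W \<omega> where W: "is_coproduct T I V W \<omega>"
        by (rule coprod_exists[OF I, of V]) (use hom_Obj(1)[OF V(2)] in blast)+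
      note \<omega> = coprod_inj[OF W]
      have "\<exists>h. h : W ~> P \<and> (\<forall>i\<in>I. h \<odot> \<omega> i = \<iota> i \<odot> v i)"
        by (rule coprod_ex[OF W PO]) (rule comp_hom[OF V(2) \<iota>])
      then obtain h where h: "h : W ~> P" "\<And>i. i \<in> I \<Longrightarrow> h \<odot> \<omega> i = \<iota> i \<odot> v i" by blast
      have surj: "hom_surjective T s (V i) (X i) (v i)" if i: "i \<in> I" and s: "s \<in> \<S>" for i s
        unfolding hom_surjective_def
      proof (intro equalityI subsetI)
        fix a assume "a \<in> (\<lambda>g. v i \<odot> g) ` Hom T s (V i)"
        then obtain g where "g \<in> Hom T s (V i)" "a = v i \<odot> g" by blast
        then show "a \<in> Hom T s (X i)" using comp_hom[OF homI V(2)[OF i]] \<S>O[OF s] hom_Obj V(2)[OF i] by blast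
      next
        fix a assume "a \<in> Hom T s (X i)"
        then have j: "(s, a) \<in> J i" using s by (simp add: J_def)
        then show "a \<in> (\<lambda>g. v i \<odot> g) ` Hom T s (V i)"
          using V(3)[OF i j] hom_Obj(3)[OF \<upsilon>[OF i j]] by force
      qed
      have "\<forall>S\<in>\<S>. hom_surjective T S W P h"
      proof (rule perfect[OF I _ W P])
        show "\<forall>i\<in>I. v i \<in> Hom T (V i) (X i)" using V(2) hom_Obj(3) by blast
        show "is_coproduct_map T I v W \<omega> P \<iota> h" using h hom_Obj(3) by (auto simp: is_coproduct_map_def)
      qed (use surj in blast)
      then obtain f' where "f' \<in> Hom T S W" "f = h \<odot> f'"
        using S hom_Obj(3)[OF f] unfolding hom_surjective_def by blast
      then have f': "f' : S ~> W" "f = h \<odot> f'" using homI \<S>O[OF S] hom_Obj(1)[OF h(1)] by blast+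
      have cS: "is_coproduct T (Sigma I J) (\<lambda>(i, j). fst j) W (\<lambda>(i, j). \<omega> i \<odot> \<upsilon> i j)"
        using coprod_Sigma[OF W V(1)] .
      have cardS: "|Sigma I J| <o \<kappa>" by (rule card_Sigma_less[OF regular_\<kappa> I J])
      obtain N Q \<iota>' h' g where N: "N \<subseteq> Sigma I J" "|N| <o \<alpha>" "is_coproduct T N (\<lambda>(i, j). fst j) Q \<iota>'" "h' : Q ~> W"
        "\<And>n. n \<in> N \<Longrightarrow> h' \<odot> \<iota>' n = (case n of (i, j) \<Rightarrow> \<omega> i \<odot> \<upsilon> i j)" "g : S ~> Q" "f' = h' \<odot> g"
        by (rule small_objectD[OF \<S>(2)[OF S] cardS cS f'(1)]) blast
      note \<iota>' = coprod_inj[OF N(3)]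
      define I1 where "I1 = fst ` N"
      define M where "M i = {j. (i, j) \<in> N}" for i
      have I1: "I1 \<subseteq> I" "|I1| <o \<alpha>" using N(1) card_image_less[OF N(2)] by (auto simp: I1_def)
      have M: "|M i| <o \<alpha>" for i
      proof -
        have "M i \<subseteq> snd ` N" by (force simp: M_def)
        then show ?thesis using card_subset_less card_image_less[OF N(2)] by blast
      qed
      have MJ: "M i \<subseteq> J i" for i using N(1) by (auto simp: M_def)
      have "\<exists>U \<xi> p. is_coproduct T (M i) fst U \<xi> \<and> p : U ~> X i \<and> (\<forall>j\<in>M i. p \<odot> \<xi> j = snd j)"
        if i: "i \<in> I1" for i
      proof -
        have iI: "i \<in> I" using I1 i by blast
        have k: "|M i| <o \<kappa>" using card_subset_less[OF MJ J[OF iI]] .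
        have mh: "snd j : fst j ~> X i" if "j \<in> M i" for j using Jh(1)[OF iI] MJ that by blast
        obtain U \<xi> where U: "is_coproduct T (M i) fst U \<xi>"
          by (rule coprod_exists[OF k, of fst]) (use hom_Obj(1)[OF mh] in blast)+
        then show ?thesis using coprod_ex[OF U XO[OF iI] mh] by blast
      qed
      then obtain U \<xi> p where U: "\<And>i. i \<in> I1 \<Longrightarrow> is_coproduct T (M i) fst (U i) (\<xi> i)"
        "\<And>i. i \<in> I1 \<Longrightarrow> p i : U i ~> X i" "\<And>i j. i \<in> I1 \<Longrightarrow> j \<in> M i \<Longrightarrow> p i \<odot> \<xi> i j = snd j" by metis
      note \<xi> = coprod_inj[OF U(1)]
      have UB: "U i \<in> ?B" if i: "i \<in> I1" for i
      proof (rule coprod_closedD[OF B \<alpha>(2) M[of i] _ U(1)[OF i]])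
        fix j assume "j \<in> M i"
        then have "fst j \<in> \<S>" using Jh(2) MJ I1 i by blast
        then show "fst j \<in> ?B" using coprod_closure.base by blast
      qed
      have "|I1| <o \<kappa>" using card_subset_less[OF I1(1) I] .
      then obtain W' \<omega>' where W': "is_coproduct T I1 U W' \<omega>'"
        by (rule coprod_exists[of _ U]) (use hom_Obj(1)[OF U(2)] in blast)+
      note \<omega>' = coprod_inj[OF W']
      have "\<exists>H. H : W' ~> P \<and> (\<forall>i\<in>I1. H \<odot> \<omega>' i = \<iota> i \<odot> p i)"
        by (rule coprod_ex[OF W' PO]) (use comp_hom[OF U(2) \<iota>] I1(1) in blast)
      then obtain H where H: "H : W' ~> P" "\<And>i. i \<in> I1 \<Longrightarrow> H \<odot> \<omega>' i = \<iota> i \<odot> p i" by blast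
      have IM: "i \<in> I1" "j \<in> M i" "i \<in> I" "j \<in> J i" if "(i, j) \<in> N" for i j
        using that N(1) by (force simp: I1_def M_def)+
      have "\<exists>t. t : Q ~> W' \<and> (\<forall>n\<in>N. t \<odot> \<iota>' n = (case n of (i, j) \<Rightarrow> \<omega>' i \<odot> \<xi> i j))"
        by (rule coprod_ex[OF N(3) coprod_Obj[OF W']]) (use IM in \<open>auto intro!: comp_hom[OF \<xi> \<omega>']\<close>)
      then obtain t where t: "t : Q ~> W'" "\<And>i j. (i, j) \<in> N \<Longrightarrow> t \<odot> \<iota>' (i, j) = \<omega>' i \<odot> \<xi> i j" by force
      have Ht: "H \<odot> t = h \<odot> h'"
      proof (rule coprod_eqI[OF N(3) comp_hom[OF t(1) H(1)] comp_hom[OF N(4) h(1)]])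
        fix n assume n: "n \<in> N"
        obtain i j where ij: "n = (i, j)" by (rule prod.exhaust)
        with n have n': "(i, j) \<in> N" by simp
        note im = IM[OF n']
        have \<iota>i: "\<iota>' (i, j) : fst j ~> Q" using \<iota>'[OF n'] by simp
        have "(H \<odot> t) \<odot> \<iota>' (i, j) = H \<odot> (\<omega>' i \<odot> \<xi> i j)" using H(1) t(1) t(2)[OF n'] \<iota>i by (simp add: hom_def)
        also have "\<dots> = (\<iota> i \<odot> p i) \<odot> \<xi> i j"
          using comp_reduce[OF H(2)[OF im(1)], of "\<xi> i j"] H(1) \<omega>'[OF im(1)] \<xi>[OF im(1,2)] by (simp add: hom_def)
        also have "\<dots> = \<iota> i \<odot> snd j" using U(3)[OF im(1,2)] \<iota>[OF im(3)] U(2)[OF im(1)] \<xi>[OF im(1,2)] by (simp add: hom_def)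
        also have "\<dots> = (\<iota> i \<odot> v i) \<odot> \<upsilon> i j" using V(3)[OF im(3,4)] \<iota>[OF im(3)] V(2)[OF im(3)] \<upsilon>[OF im(3,4)] by (simp add: hom_def)
        also have "\<dots> = h \<odot> (\<omega> i \<odot> \<upsilon> i j)"
          using comp_reduce[OF h(2)[OF im(3)], of "\<upsilon> i j"] h(1) \<omega>[OF im(3)] \<upsilon>[OF im(3,4)] by (simp add: hom_def)
        also have "\<dots> = (h \<odot> h') \<odot> \<iota>' (i, j)" using N(5)[OF n'] h(1) N(4) \<iota>i by (simp add: hom_def)
        finally show "(H \<odot> t) \<odot> \<iota>' n = (h \<odot> h') \<odot> \<iota>' n" unfolding ij .
      qed
      have "f = H \<odot> (t \<odot> g)"
        using comp_reduce[OF Ht, of g] f'(2) N(4,6,7) H(1) t(1) h(1) by (simp add: hom_def)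
      then show "factors \<alpha> ?B I X P \<iota> f"
        using factorsI[OF I1 UB U(2) W' H comp_hom[OF N(6) t(1)]] by blast
    qed
  qed
  then show ?thesis using coprod_closure.base[of _ "\<S> \<union> Cpt \<alpha>"] by blast
qed

end

section \<open>Homotopy colimits\<close>

context cocomplete_triangulated
begin

text \<open>Surjectivity of \<open>Hom(S, q)\<close> for all \<open>\<nu>\<close>-compact \<open>S\<close> takes the role of epimorphisms.\<close>

definition onto :: "'u rel \<Rightarrow> 'o \<Rightarrow> 'o \<Rightarrow> 'm \<Rightarrow> bool" where
  "onto \<nu> X Z q \<longleftrightarrow> q : X ~> Z \<and> (\<forall>S\<in>Cpt \<nu>. \<forall>a. a : S ~> Z \<longrightarrow> (\<exists>b. b : S ~> X \<and> q \<odot> b = a))"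

lemma ontoE:
  assumes "onto \<nu> X Z q" "S \<in> Cpt \<nu>" "a : S ~> Z"
  obtains b where "b : S ~> X" "q \<odot> b = a"
  using assms unfolding onto_def by blast

lemma onto_hom: "onto \<nu> X Z q \<Longrightarrow> q : X ~> Z" by (simp add: onto_def)

text \<open>
  A morphism from a compact object to the coproduct of the \<open>Z i\<close> factors through compact objects over
  each \<open>Z i\<close>, and these lift.
\<close>

lemma onto_coprod:
  fixes I :: "'i set"
  assumes I: "|I| <o \<kappa>" and q: "\<And>i. i \<in> I \<Longrightarrow> onto \<nu> (X i) (Z i) (q i)"
    and P: "is_coproduct T I X P \<iota>" and R: "is_coproduct T I Z R \<zeta>"
    and Q: "Q : P ~> R" "\<And>i. i \<in> I \<Longrightarrow> Q \<odot> \<iota> i = \<zeta> i \<odot> q i"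
  shows "onto \<nu> P R Q"
  unfolding onto_def
proof (intro conjI ballI allI impI Q(1))
  fix S u assume S: "S \<in> Cpt \<nu>" and u: "u : S ~> R"
  note \<iota> = coprod_inj[OF P] and \<zeta> = coprod_inj[OF R]
  note qh = onto_hom[OF q]
  obtain I' S' p Q0 \<iota>' h g where *: "I' \<subseteq> I" "|I'| <o \<nu>" "\<And>i. i \<in> I' \<Longrightarrow> S' i \<in> Cpt \<nu>"
    "\<And>i. i \<in> I' \<Longrightarrow> p i : S' i ~> Z i" "is_coproduct T I' S' Q0 \<iota>'" "h : Q0 ~> R"
    "\<And>i. i \<in> I' \<Longrightarrow> h \<odot> \<iota>' i = \<zeta> i \<odot> p i" "g : S ~> Q0" "u = h \<odot> g"
    by (rule factorsE[OF factoring_toD[OF Cpt_factoring[OF S] I R u] u]) blast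
  note \<iota>' = coprod_inj[OF *(5)]
  have "\<forall>i\<in>I'. \<exists>b. b : S' i ~> X i \<and> q i \<odot> b = p i"
    using q *(1,3,4) unfolding onto_def by blast
  then obtain b where b: "\<And>i. i \<in> I' \<Longrightarrow> b i : S' i ~> X i" "\<And>i. i \<in> I' \<Longrightarrow> q i \<odot> b i = p i" by metis
  have "\<exists>t. t : Q0 ~> P \<and> (\<forall>i\<in>I'. t \<odot> \<iota>' i = \<iota> i \<odot> b i)"
    by (rule coprod_ex[OF *(5) coprod_Obj[OF P]]) (use comp_hom[OF b(1) \<iota>] *(1) in blast)
  then obtain t where t: "t : Q0 ~> P" "\<And>i. i \<in> I' \<Longrightarrow> t \<odot> \<iota>' i = \<iota> i \<odot> b i" by blast
  have Qt: "Q \<odot> t = h"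
  proof (rule coprod_eqI[OF *(5) comp_hom[OF t(1) Q(1)] *(6)])
    fix i assume i: "i \<in> I'"
    then have iI: "i \<in> I" using *(1) by blast
    have "(Q \<odot> t) \<odot> \<iota>' i = Q \<odot> (\<iota> i \<odot> b i)" using Q(1) t(1) t(2)[OF i] \<iota>'[OF i] by (simp add: hom_def)
    also have "\<dots> = (\<zeta> i \<odot> q i) \<odot> b i" using comp_reduce[OF Q(2)[OF iI], of "b i"] Q(1) \<iota>[OF iI] b(1)[OF i] by (simp add: hom_def)
    also have "\<dots> = \<zeta> i \<odot> p i" using b[OF i] \<zeta>[OF iI] qh[OF iI] by (simp add: hom_def)
    finally show "(Q \<odot> t) \<odot> \<iota>' i = h \<odot> \<iota>' i" using *(7)[OF i] by simp
  qed
  have "Q \<odot> (t \<odot> g) = u" using comp_reduce[OF Qt, of g] Q(1) t(1) *(8,9) by (simp add: hom_def)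
  then show "\<exists>b. b : S ~> P \<and> Q \<odot> b = u" using comp_hom[OF *(8) t(1)] by blast
qed

text \<open>
  Injectivity on \<open>Hom(S, -)\<close> for all compact \<open>S\<close> is stable under the shift, since every compact
  object is isomorphic to the shift of a compact object.
\<close>

lemma shift_mono_test:
  assumes f: "f : A ~> B" and inj: "\<And>S x. S \<in> Cpt \<nu> \<Longrightarrow> x : S ~> A \<Longrightarrow> f \<odot> x = Zero T S B \<Longrightarrow> x = Zero T S A"
    and S: "S \<in> Cpt \<nu>" and y: "y : S ~> \<Sigma> A" "\<sigma> f \<odot> y = Zero T S (\<Sigma> B)"
  shows "y = Zero T S (\<Sigma> A)"
proof -
  obtain S' u v where u: "S' \<in> Obj T" "u : \<Sigma> S' ~> S" "v : S ~> \<Sigma> S'"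
    "v \<odot> u = Ident T (\<Sigma> S')" "u \<odot> v = Ident T S" using unshift[OF Cpt_Obj[OF S]] .
  have S': "S' \<in> Cpt \<nu>" using Cpt_unshift[OF u(1) Cpt_iso[OF S isomorphicI[OF u(2,3,4,5)]]] u(1) by simp
  have AB: "A \<in> Obj T" "B \<in> Obj T" using f hom_Obj by blast+
  obtain x where x: "x : S' ~> A" "y \<odot> u = \<sigma> x" using shift_full[OF comp_hom[OF u(2) y(1)] u(1) AB(1)] .
  have "\<sigma> (f \<odot> x) = (\<sigma> f \<odot> y) \<odot> u" using x f y(1) u(2) by (simp add: hom_def)
  also have "\<dots> = \<sigma> (Zero T S' B)" unfolding y(2) using u(1,2) AB by (simp add: hom_def)
  finally have "f \<odot> x = Zero T S' B" using shift_faithful comp_hom[OF x(1) f] zero_hom[OF u(1) AB(2)] by blast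
  then have "x = Zero T S' A" using inj[OF S' x(1)] by blast
  then have yu: "y \<odot> u = Zero T (\<Sigma> S') (\<Sigma> A)" using x(2) u(1) AB by simp
  have "y = y \<odot> (u \<odot> v)" unfolding u(5) using y(1) by (simp add: hom_def)
  also have "\<dots> = (y \<odot> u) \<odot> v" using y(1) u(2,3) by (simp add: hom_def)
  also have "\<dots> = Zero T S (\<Sigma> A)" unfolding yu using u(1,3) AB by (simp add: hom_def)
  finally show ?thesis .
qed

lemma card_nat_less: "|UNIV::nat set| <o \<kappa>"
  using inacc card_of_nat ordIso_ordLess_trans by (auto simp: inaccessible_def)

text \<open>
  Let \<open>\<phi> = 1 - sh\<close>, where \<open>sh\<close> is the shift along the \<open>s n\<close>, and let \<open>Q\<close> map \<open>P = \<Coprod>X\<^sub>n\<close> to the coproduct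
  \<open>R\<close> of copies of \<open>Z\<close>. On compact objects \<open>Q\<close> is onto, and what \<open>Q\<close> kills is already killed by
  \<open>sh\<close>. As the sequence for the constant system \<open>Z\<close> splits, a diagram chase shows that \<open>\<phi>\<close> is
  injective on \<open>Hom(S, -)\<close> and that its image is the kernel of the map to \<open>Z\<close>. So the cone
  \<open>H\<close> of \<open>\<phi>\<close> maps bijectively to \<open>Z\<close> on \<open>Hom(S, -)\<close>, and the cone of \<open>H \<rightarrow> Z\<close> is zero.
\<close>

lemma hocolim_retract:
  fixes X :: "nat \<Rightarrow> 'o"
  assumes generate: "\<And>E. E \<in> Obj T \<Longrightarrow> (\<And>S a. S \<in> Cpt \<nu> \<Longrightarrow> a : S ~> E \<Longrightarrow> a = Zero T S E) \<Longrightarrow> is_zero_object T E"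
    and q: "\<And>n. onto \<nu> (X n) Z (q n)"
    and s: "\<And>n. s n : X n ~> X (Suc n)" "\<And>n. q (Suc n) \<odot> s n = q n"
    and kill: "\<And>n S a. S \<in> Cpt \<nu> \<Longrightarrow> a : S ~> X n \<Longrightarrow> q n \<odot> a = Zero T S Z \<Longrightarrow> s n \<odot> a = Zero T S (X (Suc n))"
    and P: "is_coproduct T (UNIV::nat set) X P \<iota>"
  shows "\<exists>\<phi> H g h t r. exact_triangle T P P H \<phi> g h \<and> r : Z ~> H \<and> t : H ~> Z \<and> t \<odot> r = Ident T Z"
proof -
  note \<iota> = coprod_inj[OF P UNIV_I]
  note qh = onto_hom[OF q]
  have PO: "P \<in> Obj T" by (rule coprod_Obj[OF P])
  have ZO: "Z \<in> Obj T" using qh hom_Obj by blast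
  have XO: "X n \<in> Obj T" for n using qh hom_Obj by blast
  obtain R \<zeta> where R: "is_coproduct T (UNIV::nat set) (\<lambda>n. Z) R \<zeta>" by (rule coprod_exists[OF card_nat_less ZO])
  note \<zeta> = coprod_inj[OF R UNIV_I]
  have RO: "R \<in> Obj T" by (rule coprod_Obj[OF R])
  have "\<exists>sh. sh : P ~> P \<and> (\<forall>n\<in>UNIV. sh \<odot> \<iota> n = \<iota> (Suc n) \<odot> s n)"
    by (rule coprod_ex[OF P PO]) (rule comp_hom[OF s(1) \<iota>])
  then obtain sh where sh: "sh : P ~> P" "\<And>n. sh \<odot> \<iota> n = \<iota> (Suc n) \<odot> s n" by blast
  have "\<exists>Q. Q : P ~> R \<and> (\<forall>n\<in>UNIV. Q \<odot> \<iota> n = \<zeta> n \<odot> q n)"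
    by (rule coprod_ex[OF P RO]) (rule comp_hom[OF qh \<zeta>])
  then obtain Q where Q: "Q : P ~> R" "\<And>n. Q \<odot> \<iota> n = \<zeta> n \<odot> q n" by blast
  have ontoQ: "onto \<nu> P R Q" by (rule onto_coprod[OF card_nat_less q P R Q])
  have "\<exists>sh'. sh' : R ~> R \<and> (\<forall>n\<in>UNIV. sh' \<odot> \<zeta> n = \<zeta> (Suc n))"
    by (rule coprod_ex[OF R RO]) (rule \<zeta>)
  then obtain sh' where sh': "sh' : R ~> R" "\<And>n. sh' \<odot> \<zeta> n = \<zeta> (Suc n)" by blast
  have "\<exists>d. d : R ~> Z \<and> (\<forall>n\<in>UNIV. d \<odot> \<zeta> n = Ident T Z)"
    by (rule coprod_ex[OF R ZO]) (rule id_hom[OF ZO])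
  then obtain d where d: "d : R ~> Z" "\<And>n. d \<odot> \<zeta> n = Ident T Z" by blast
  have Qsh: "Q \<odot> sh = sh' \<odot> Q"
  proof (rule coprod_eqI[OF P comp_hom[OF sh(1) Q(1)] comp_hom[OF Q(1) sh'(1)]])
    fix n
    have "(Q \<odot> sh) \<odot> \<iota> n = Q \<odot> (\<iota> (Suc n) \<odot> s n)" using Q(1) sh(1) sh(2)[of n] \<iota>[of n] by (simp add: hom_def)
    also have "\<dots> = (\<zeta> (Suc n) \<odot> q (Suc n)) \<odot> s n"
      using comp_reduce[OF Q(2)[of "Suc n"], of "s n"] Q(1) \<iota>[of "Suc n"] s(1)[of n] by (simp add: hom_def)
    also have "\<dots> = \<zeta> (Suc n) \<odot> q n" using \<zeta>[of "Suc n"] qh[of "Suc n"] s(1)[of n] s(2)[of n] by (simp add: hom_def)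
    also have "\<dots> = sh' \<odot> (\<zeta> n \<odot> q n)"
      using comp_reduce[OF sh'(2)[of n], of "q n"] sh'(1) \<zeta>[of n] qh[of n] by (simp add: hom_def)
    also have "\<dots> = (sh' \<odot> Q) \<odot> \<iota> n" using Q(1) Q(2)[of n] sh'(1) \<iota>[of n] by (simp add: hom_def)
    finally show "(Q \<odot> sh) \<odot> \<iota> n = (sh' \<odot> Q) \<odot> \<iota> n" .
  qed
  \<comment> \<open>Up to sign, \<open>\<psi>\<close> is the contraction that splits \<open>0 \<rightarrow> R \<rightarrow> R \<rightarrow> Z \<rightarrow> 0\<close>, where the first
    map is \<open>1 - sh'\<close> and the second is the fold map \<open>d\<close>.\<close>
  define c where "c = rec_nat (Zero T Z R) (\<lambda>n c. c \<oplus> \<zeta> n)"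
  have c0: "c 0 = Zero T Z R" and cS: "c (Suc n) = c n \<oplus> \<zeta> n" for n by (simp_all add: c_def)
  have c: "c n : Z ~> R" for n
    by (induction n) (use zero_hom[OF ZO RO] add_hom \<zeta> in \<open>auto simp: c0 cS\<close>)
  have "\<exists>\<psi>. \<psi> : R ~> R \<and> (\<forall>n\<in>UNIV. \<psi> \<odot> \<zeta> n = c n)"
    by (rule coprod_ex[OF R RO]) (rule c)
  then obtain \<psi> where \<psi>: "\<psi> : R ~> R" "\<And>n. \<psi> \<odot> \<zeta> n = c n" by blast
  have \<psi>1: "\<psi> \<odot> sh' = \<psi> \<oplus> Ident T R"
  proof (rule coprod_eqI[OF R comp_hom[OF sh'(1) \<psi>(1)] add_hom[OF \<psi>(1) id_hom[OF RO]]])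
    fix n show "(\<psi> \<odot> sh') \<odot> \<zeta> n = (\<psi> \<oplus> Ident T R) \<odot> \<zeta> n"
      using \<psi>(1) sh'(1) sh'(2)[of n] \<psi>(2)[of n] \<psi>(2)[of "Suc n"] cS[of n] \<zeta>[of n] RO by (simp add: hom_def)
  qed
  have shc: "(sh' \<odot> c n) \<oplus> \<zeta> 0 = c n \<oplus> \<zeta> n" for n
  proof (induction n)
    case 0
    then show ?case unfolding c0 using sh'(1) \<zeta>[of 0] ZO by (simp add: hom_def)
  next
    case (Suc n)
    have "(sh' \<odot> c (Suc n)) \<oplus> \<zeta> 0 = (sh' \<odot> c n) \<oplus> (\<zeta> (Suc n) \<oplus> \<zeta> 0)"
      unfolding cS using sh'(1) sh'(2)[of n] c[of n] \<zeta>[of n] \<zeta>[of "Suc n"] \<zeta>[of 0] by (simp add: hom_def)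
    also have "\<zeta> (Suc n) \<oplus> \<zeta> 0 = \<zeta> 0 \<oplus> \<zeta> (Suc n)" using add_commute \<zeta>[of "Suc n"] \<zeta>[of 0] by (simp add: hom_def)
    also have "(sh' \<odot> c n) \<oplus> (\<zeta> 0 \<oplus> \<zeta> (Suc n)) = ((sh' \<odot> c n) \<oplus> \<zeta> 0) \<oplus> \<zeta> (Suc n)"
      using sh'(1) c[of n] \<zeta>[of "Suc n"] \<zeta>[of 0] by (simp add: hom_def)
    finally show ?case unfolding Suc cS .
  qed
  have \<psi>2: "(sh' \<odot> \<psi>) \<oplus> (\<zeta> 0 \<odot> d) = \<psi> \<oplus> Ident T R"
  proof (rule coprod_eqI[OF R add_hom[OF comp_hom[OF \<psi>(1) sh'(1)] comp_hom[OF d(1) \<zeta>]] add_hom[OF \<psi>(1) id_hom[OF RO]]])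
    fix n show "((sh' \<odot> \<psi>) \<oplus> (\<zeta> 0 \<odot> d)) \<odot> \<zeta> n = (\<psi> \<oplus> Ident T R) \<odot> \<zeta> n"
      using \<psi>(1) sh'(1) \<psi>(2)[of n] d(1) d(2)[of n] shc[of n] \<zeta>[of n] \<zeta>[of 0] RO by (simp add: hom_def)
  qed
  have dsh': "d \<odot> sh' = d"
  proof (rule coprod_eqI[OF R comp_hom[OF sh'(1) d(1)] d(1)])
    fix n show "(d \<odot> sh') \<odot> \<zeta> n = d \<odot> \<zeta> n" using d(1) d(2) sh'(1) sh'(2)[of n] \<zeta>[of n] by (simp add: hom_def)
  qed
  have kill_P: "sh \<odot> u = Zero T S P" if S: "S \<in> Cpt \<nu>" and u: "u : S ~> P" "Q \<odot> u = Zero T S R" for S u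
  proof -
    obtain I' S' a P' \<iota>' h g where *: "I' \<subseteq> (UNIV::nat set) \<and> |I'| <o \<nu> \<and>
      (\<forall>i\<in>I'. S' i \<in> Cpt \<nu> \<and> a i : S' i ~> X i \<and> q i \<odot> a i = Zero T (S' i) Z) \<and>
      is_coproduct T I' S' P' \<iota>' \<and> h : P' ~> P \<and> (\<forall>i\<in>I'. h \<odot> \<iota>' i = \<iota> i \<odot> a i) \<and>
      g : S ~> P' \<and> u = h \<odot> g"
      using coprod_kernel_factor[OF S card_nat_less P R qh Q u] by blast
    then have h: "h : P' ~> P" and P': "is_coproduct T I' S' P' \<iota>'" and g: "g : S ~> P'" "u = h \<odot> g" by blast+
    have P'O: "P' \<in> Obj T" by (rule coprod_Obj[OF P'])
    have sh0: "sh \<odot> h = Zero T P' P"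
    proof (rule coprod_eqI[OF P' comp_hom[OF h sh(1)] zero_hom[OF P'O PO]])
      fix i assume i: "i \<in> I'"
      note \<iota>'i = coprod_inj[OF P' i]
      have a: "a i : S' i ~> X i" "s i \<odot> a i = Zero T (S' i) (X (Suc i))" "h \<odot> \<iota>' i = \<iota> i \<odot> a i"
        using * i kill by blast+
      have "(sh \<odot> h) \<odot> \<iota>' i = sh \<odot> (\<iota> i \<odot> a i)" using sh(1) h a \<iota>'i by (simp add: hom_def)
      also have "\<dots> = \<iota> (Suc i) \<odot> (s i \<odot> a i)"
        using comp_reduce[OF sh(2)[of i], of "a i"] sh(1) \<iota>[of i] \<iota>[of "Suc i"] s(1)[of i] a(1) by (simp add: hom_def)
      also have "\<dots> = Zero T P' P \<odot> \<iota>' i" unfolding a(2) using \<iota>[of "Suc i"] \<iota>'i PO hom_Obj[OF \<iota>'i] by (simp add: hom_def)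
      finally show "(sh \<odot> h) \<odot> \<iota>' i = Zero T P' P \<odot> \<iota>' i" .
    qed
    show ?thesis using comp_reduce[OF sh0, of g] sh(1) h g PO by (simp add: hom_def)
  qed
  obtain \<phi> where \<phi>: "\<phi> : P ~> P" "Ident T P = sh \<oplus> \<phi>" using difference[OF id_hom[OF PO] sh(1)] .
  have split: "f = (f \<odot> sh) \<oplus> (f \<odot> \<phi>)" if "f : P ~> W" for f W
  proof -
    have "f = f \<odot> (sh \<oplus> \<phi>)" unfolding \<phi>(2)[symmetric] using that by (simp add: hom_def)
    then show ?thesis using that sh(1) \<phi>(1) by (simp add: hom_def)
  qed
  have split': "u = (sh \<odot> u) \<oplus> (\<phi> \<odot> u)" if "u : S ~> P" for u S
  proof -
    have "u = (sh \<oplus> \<phi>) \<odot> u" unfolding \<phi>(2)[symmetric] using that by (simp add: hom_def)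
    then show ?thesis using that sh(1) \<phi>(1) by (simp add: hom_def)
  qed
  \<comment> \<open>If \<open>u = sh \<odot> u\<close>, then \<open>Q \<odot> u\<close> is fixed by \<open>sh'\<close>, hence zero by the splitting, and so \<open>sh\<close> kills \<open>u\<close>.\<close>
  have inj_\<phi>: "u = Zero T S P" if S: "S \<in> Cpt \<nu>" and u: "u : S ~> P" "\<phi> \<odot> u = Zero T S P" for S u
  proof -
    have SO: "S \<in> Obj T" by (rule Cpt_Obj[OF S])
    have ush: "sh \<odot> u = u" using split'[OF u(1)] u(2) sh(1) u(1) by (simp add: hom_def)
    have v: "Q \<odot> u : S ~> R" using comp_hom[OF u(1) Q(1)] .
    have "sh' \<odot> (Q \<odot> u) = Q \<odot> (sh \<odot> u)" using comp_reduce[OF Qsh, of u] Q(1) sh(1) sh'(1) u(1) by (simp add: hom_def)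
    then have "\<psi> \<odot> (Q \<odot> u) = \<psi> \<odot> (sh' \<odot> (Q \<odot> u))" using ush by simp
    also have "\<dots> = (\<psi> \<odot> (Q \<odot> u)) \<oplus> (Q \<odot> u)"
      using comp_reduce[OF \<psi>1, of "Q \<odot> u"] \<psi>(1) sh'(1) v RO Q(1) u(1) by (simp add: hom_def)
    finally have "(\<psi> \<odot> (Q \<odot> u)) \<oplus> (Q \<odot> u) = (\<psi> \<odot> (Q \<odot> u)) \<oplus> Zero T S R"
      using comp_hom[OF v \<psi>(1)] by (simp add: hom_def)
    then have "Q \<odot> u = Zero T S R" using add_left_cancel comp_hom[OF v \<psi>(1)] v zero_hom[OF SO RO] by blast
    then show ?thesis using kill_P[OF S u(1)] ush by simp
  qed
  obtain H g h where t: "exact_triangle T P P H \<phi> g h" using cone_exists[OF \<phi>(1)] .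
  note tt = triangle_hom[OF t]
  have HO: "H \<in> Obj T" using tt hom_Obj by blast
  have gsh: "g \<odot> sh = g" using split[OF tt(2)] triangle_comp_zero[OF t] tt(2) sh(1) PO HO by (simp add: hom_def)
  have qb: "d \<odot> Q : P ~> Z" using comp_hom[OF Q(1) d(1)] .
  have qbsh: "(d \<odot> Q) \<odot> sh = d \<odot> Q"
    using comp_reduce[OF dsh', of Q] Qsh d(1) Q(1) sh(1) sh'(1) by (simp add: hom_def)
  have "(d \<odot> Q) \<oplus> ((d \<odot> Q) \<odot> \<phi>) = (d \<odot> Q) \<oplus> Zero T P Z"
    using split[OF qb] qbsh qb by (simp add: hom_def)
  then have "(d \<odot> Q) \<odot> \<phi> = Zero T P Z"
    using add_left_cancel qb comp_hom[OF \<phi>(1) qb] zero_hom[OF PO ZO] by blast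
  then obtain k where k: "k : H ~> Z" "d \<odot> Q = k \<odot> g" using triangle_extend[OF t qb] by blast
  \<comment> \<open>With \<open>w = Q \<odot> u\<close>, the splitting gives \<open>w = sh' \<odot> w' - w'\<close> for \<open>w' = \<psi> \<odot> w\<close>. Lift \<open>w'\<close> to \<open>u2\<close>;
    then \<open>u2 \<oplus> u\<close> and \<open>sh \<odot> u2\<close> agree up to \<open>e\<close>, which \<open>Q\<close> kills, and \<open>g\<close> does not distinguish
    \<open>x\<close> from \<open>sh \<odot> x\<close>.\<close>
  have mid: "g \<odot> u = Zero T S H" if S: "S \<in> Cpt \<nu>" and u: "u : S ~> P" "(d \<odot> Q) \<odot> u = Zero T S Z" for S u
  proof -
    have SO: "S \<in> Obj T" by (rule Cpt_Obj[OF S])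
    have w: "Q \<odot> u : S ~> R" using comp_hom[OF u(1) Q(1)] .
    have w2: "\<psi> \<odot> (Q \<odot> u) : S ~> R" using comp_hom[OF w \<psi>(1)] .
    have dw: "d \<odot> (Q \<odot> u) = Zero T S Z" using u d(1) Q(1) by (simp add: hom_def)
    have "((sh' \<odot> \<psi>) \<oplus> (\<zeta> 0 \<odot> d)) \<odot> (Q \<odot> u) = sh' \<odot> (\<psi> \<odot> (Q \<odot> u))"
      using dw sh'(1) \<psi>(1) \<zeta>[of 0] d(1) Q(1) u(1) SO by (simp add: hom_def)
    then have shw: "sh' \<odot> (\<psi> \<odot> (Q \<odot> u)) = (\<psi> \<odot> (Q \<odot> u)) \<oplus> (Q \<odot> u)"
      unfolding \<psi>2 using \<psi>(1) Q(1) u(1) RO by (simp add: hom_def)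
    obtain u2 where u2: "u2 : S ~> P" "Q \<odot> u2 = \<psi> \<odot> (Q \<odot> u)" using ontoE[OF ontoQ S w2] .
    have a: "u2 \<oplus> u : S ~> P" and b: "sh \<odot> u2 : S ~> P" using add_hom comp_hom u2(1) u(1) sh(1) by blast+
    obtain e where e: "e : S ~> P" "u2 \<oplus> u = (sh \<odot> u2) \<oplus> e" using difference[OF a b] .
    have "(Q \<odot> (sh \<odot> u2)) \<oplus> (Q \<odot> e) = Q \<odot> (u2 \<oplus> u)" unfolding e(2) using Q(1) sh(1) u2(1) e(1) by (simp add: hom_def)
    also have "\<dots> = sh' \<odot> (Q \<odot> u2)" using shw u2 Q(1) u(1) by (simp add: hom_def)
    also have "\<dots> = (Q \<odot> (sh \<odot> u2)) \<oplus> Zero T S R"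
      using comp_reduce[OF Qsh, of u2] Q(1) sh(1) sh'(1) u2(1) by (simp add: hom_def)
    finally have "Q \<odot> e = Zero T S R"
      using add_left_cancel comp_hom[OF b Q(1)] comp_hom[OF e(1) Q(1)] zero_hom[OF SO RO] by blast
    then have she: "sh \<odot> e = Zero T S P" using kill_P[OF S e(1)] by blast
    have gs: "g \<odot> (sh \<odot> x) = g \<odot> x" if "x : S ~> P" for x
      using comp_reduce[OF gsh, of x] tt(2) sh(1) that by (simp add: hom_def)
    have "g \<odot> e = g \<odot> (sh \<odot> e)" using gs[OF e(1)] by simp
    also have "\<dots> = Zero T S H" unfolding she using tt(2) SO by (simp add: hom_def)
    finally have ge: "g \<odot> e = Zero T S H" .
    have "(g \<odot> u2) \<oplus> (g \<odot> u) = g \<odot> ((sh \<odot> u2) \<oplus> e)" unfolding e(2)[symmetric] using tt(2) u2(1) u(1) by (simp add: hom_def)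
    also have "\<dots> = (g \<odot> u2) \<oplus> Zero T S H" using gs[OF u2(1)] ge tt(2) sh(1) u2(1) e(1) by (simp add: hom_def)
    finally show ?thesis using add_left_cancel comp_hom[OF _ tt(2)] u2(1) u(1) zero_hom[OF SO HO] by blast
  qed
  have inj_k: "y = Zero T S H" if S: "S \<in> Cpt \<nu>" and y: "y : S ~> H" "k \<odot> y = Zero T S Z" for S y
  proof -
    have SO: "S \<in> Obj T" by (rule Cpt_Obj[OF S])
    have "\<sigma> \<phi> \<odot> (h \<odot> y) = Zero T S (\<Sigma> P)"
      using comp_reduce[OF triangle_comp_zero3[OF t], of y] tt \<phi>(1) y(1) PO by (simp add: hom_def)
    then have "h \<odot> y = Zero T S (\<Sigma> P)"
      using shift_mono_test[OF \<phi>(1) inj_\<phi> S comp_hom[OF y(1) tt(3)]] by blast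
    then obtain u where u: "u : S ~> P" "y = g \<odot> u" using triangle_lift2[OF t y(1)] by blast
    have "(d \<odot> Q) \<odot> u = Zero T S Z" unfolding k(2) using y(2) u k(1) tt(2) by (simp add: hom_def)
    then show ?thesis using mid[OF S u(1)] u(2) by simp
  qed
  obtain E b e where tE: "exact_triangle T H Z E k b e" using cone_exists[OF k(1)] .
  note ttE = triangle_hom[OF tE]
  have E: "E \<in> Obj T" using ttE hom_Obj by blast
  have E0: "is_zero_object T E"
  proof (rule generate[OF E])
    fix S x assume S: "S \<in> Cpt \<nu>" and x: "x : S ~> E"
    have SO: "S \<in> Obj T" by (rule Cpt_Obj[OF S])
    have "\<sigma> k \<odot> (e \<odot> x) = Zero T S (\<Sigma> Z)"
      using comp_reduce[OF triangle_comp_zero3[OF tE], of x] ttE x ZO by (simp add: hom_def)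
    then have "e \<odot> x = Zero T S (\<Sigma> H)"
      using shift_mono_test[OF k(1) inj_k S comp_hom[OF x ttE(3)]] by blast
    then obtain z where z: "z : S ~> Z" "x = b \<odot> z" using triangle_lift2[OF tE x] by blast
    obtain z' where z': "z' : S ~> X 0" "q 0 \<odot> z' = z" using ontoE[OF q S z(1)] .
    have k0: "k \<odot> (g \<odot> \<iota> 0) = q 0"
    proof -
      have "k \<odot> (g \<odot> \<iota> 0) = (d \<odot> Q) \<odot> \<iota> 0" unfolding k(2) using k(1) tt(2) \<iota>[of 0] by (simp add: hom_def)
      also have "\<dots> = d \<odot> (\<zeta> 0 \<odot> q 0)" using d(1) Q(1) Q(2)[of 0] \<iota>[of 0] by (simp add: hom_def)
      also have "\<dots> = q 0" using comp_reduce[OF d(2)[of 0], of "q 0"] d(1) \<zeta>[of 0] qh[of 0] by (simp add: hom_def)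
      finally show ?thesis .
    qed
    have "z = k \<odot> (g \<odot> (\<iota> 0 \<odot> z'))"
      unfolding z'(2)[symmetric] k0[symmetric] using k(1) tt(2) \<iota>[of 0] z'(1) by (simp add: hom_def)
    then have "x = (b \<odot> k) \<odot> (g \<odot> (\<iota> 0 \<odot> z'))" using z(2) ttE tt(2) \<iota>[of 0] z'(1) by (simp add: hom_def)
    then show "x = Zero T S E" unfolding triangle_comp_zero[OF tE]
      using tt(2) \<iota>[of 0] z'(1) E SO by (simp add: hom_def)
  qed
  have "b \<odot> Ident T Z = Zero T Z E" using zero_object_hom(2)[OF E0 ttE(2)] ttE(2) E ZO by simp
  then obtain r where "r : Z ~> H" "Ident T Z = k \<odot> r" using triangle_lift[OF tE id_hom[OF ZO]] by blast
  then show ?thesis using t k(1) by metis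
qed

text \<open>
  The sequence is constructed by dependent choice: \<open>X'\<close> is the cone of a cover of the fibre of
  \<open>X \<rightarrow> Z\<close>, so that everything from a compact object that dies in \<open>Z\<close> dies in \<open>X'\<close>. All
  stages and their homotopy colimit lie in \<open>D\<close>, while the fibres only have to lie in \<open>C\<close>.
\<close>

lemma generation:
  assumes generate: "\<And>E. E \<in> Obj T \<Longrightarrow> (\<And>S a. S \<in> Cpt \<nu> \<Longrightarrow> a : S ~> E \<Longrightarrow> a = Zero T S E) \<Longrightarrow> is_zero_object T E"
    and coneD: "\<And>x y z f g h. exact_triangle T x y z f g h \<Longrightarrow> x \<in> D \<Longrightarrow> y \<in> D \<Longrightarrow> z \<in> D"
    and retractD: "\<And>x z i r. x \<in> D \<Longrightarrow> i : z ~> x \<Longrightarrow> r : x ~> z \<Longrightarrow> r \<odot> i = Ident T z \<Longrightarrow> z \<in> D"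
    and coprodD: "\<And>(X::nat \<Rightarrow> 'o) P \<iota>. (\<And>n. X n \<in> D) \<Longrightarrow> is_coproduct T UNIV X P \<iota> \<Longrightarrow> P \<in> D"
    and fibreC: "\<And>w x z f g h. exact_triangle T w x z f g h \<Longrightarrow> x \<in> D \<Longrightarrow> z \<in> C \<Longrightarrow> w \<in> C"
    and cover: "\<And>W. W \<in> C \<Longrightarrow> \<exists>V\<in>D. \<exists>v. onto \<nu> V W v"
  shows "C \<subseteq> D"
proof
  fix Z assume Z: "Z \<in> C"
  define good where "good = (\<lambda>(X, q). X \<in> D \<and> onto \<nu> X Z q)"
  define kills where "kills X s q X' \<longleftrightarrow> (\<forall>S\<in>Cpt \<nu>. \<forall>a. a : S ~> X \<and> q \<odot> a = Zero T S Z \<longrightarrow> s \<odot> a = Zero T S X')" for X s q X'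
  define step where "step = (\<lambda>(X, q) (X', q'). \<exists>s. s : X ~> X' \<and> q' \<odot> s = q \<and> kills X s q X')"
  have 1: "\<exists>x. good x" using cover[OF Z] by (auto simp: good_def)
  have 2: "\<exists>y. good y \<and> step x y" if "good x" for x
  proof -
    obtain X q where x: "x = (X, q)" by (rule prod.exhaust)
    then have X: "X \<in> D" and q: "onto \<nu> X Z q" using that by (auto simp: good_def)
    note qh = onto_hom[OF q]
    obtain w a b where tw: "exact_triangle T w X Z a q b" using fibre_exists[OF qh] .
    note ttw = triangle_hom[OF tw]
    have wC: "w \<in> C" using fibreC[OF tw X Z] .
    obtain V v where V: "V \<in> D" "onto \<nu> V w v" using cover[OF wC] by blast
    note vh = onto_hom[OF V(2)]
    have av: "a \<odot> v : V ~> X" using comp_hom[OF vh ttw(1)] .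
    obtain X' s e where tX: "exact_triangle T V X X' (a \<odot> v) s e" using cone_exists[OF av] .
    note ttX = triangle_hom[OF tX]
    have ZO: "Z \<in> Obj T" "X' \<in> Obj T" "V \<in> Obj T" using qh ttX hom_Obj by blast+
    have "q \<odot> (a \<odot> v) = Zero T V Z"
      using comp_reduce[OF triangle_comp_zero[OF tw], of v] qh ttw vh ZO by (simp add: hom_def)
    then obtain q' where q': "q' : X' ~> Z" "q = q' \<odot> s" using triangle_extend[OF tX qh] by blast
    have "onto \<nu> X' Z q'"
      unfolding onto_def
    proof (intro conjI ballI allI impI q'(1))
      fix S c assume S: "S \<in> Cpt \<nu>" "c : S ~> Z"
      obtain c' where c': "c' : S ~> X" "q \<odot> c' = c" using ontoE[OF q S] .
      have "q' \<odot> (s \<odot> c') = c" using c' q' ttX(2) by (simp add: hom_def)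
      then show "\<exists>b. b : S ~> X' \<and> q' \<odot> b = c" using comp_hom[OF c'(1) ttX(2)] by blast
    qed
    moreover have "kills X s q X'"
      unfolding kills_def
    proof (intro ballI allI impI)
      fix S c assume S: "S \<in> Cpt \<nu>" and c: "c : S ~> X \<and> q \<odot> c = Zero T S Z"
      obtain l where l: "l : S ~> w" "c = a \<odot> l" using triangle_lift[OF tw] c by blast
      obtain l' where l': "l' : S ~> V" "v \<odot> l' = l" using ontoE[OF V(2) S l(1)] .
      have "c = (a \<odot> v) \<odot> l'" unfolding l(2) l'(2)[symmetric] using ttw(1) vh l'(1) by (simp add: hom_def)
      then have "s \<odot> c = (s \<odot> (a \<odot> v)) \<odot> l'" using ttX(2) av l'(1) ttw(1) vh by (simp add: hom_def)
      then show "s \<odot> c = Zero T S X'" unfolding triangle_comp_zero[OF tX] using l'(1) ZO by (simp add: hom_def)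
    qed
    moreover have "X' \<in> D" using coneD[OF tX V(1) X] .
    ultimately have "good (X', q') \<and> step x (X', q')" using q' ttX(2) x by (auto simp: good_def step_def)
    then show ?thesis by blast
  qed
  obtain F where F: "\<And>n. good (F n)" "\<And>n. step (F n) (F (Suc n))"
    using dependent_nat_choice[of "\<lambda>_. good" "\<lambda>_. step"] 1 2 by blast
  define X where "X n = fst (F n)" for n
  define q where "q n = snd (F n)" for n
  have XD: "X n \<in> D" and q: "onto \<nu> (X n) Z (q n)" for n
    using F(1)[of n] by (auto simp: good_def X_def q_def split: prod.splits)
  have "\<forall>n. \<exists>s. s : X n ~> X (Suc n) \<and> q (Suc n) \<odot> s = q n \<and> kills (X n) s (q n) (X (Suc n))"
    using F(2) by (auto simp: step_def X_def q_def split_beta)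
  then obtain s where s: "\<And>n. s n : X n ~> X (Suc n)" "\<And>n. q (Suc n) \<odot> s n = q n"
    "\<And>n. kills (X n) (s n) (q n) (X (Suc n))" by metis
  have XO: "X n \<in> Obj T" for n using onto_hom[OF q] hom_Obj by blast
  obtain P \<iota> where P: "is_coproduct T (UNIV::nat set) X P \<iota>" by (rule coprod_exists[OF card_nat_less XO])
  have kill: "s n \<odot> a = Zero T S (X (Suc n))"
    if "S \<in> Cpt \<nu>" "a : S ~> X n" "q n \<odot> a = Zero T S Z" for n S a
    using s(3)[of n] that unfolding kills_def by blast
  obtain \<phi> H g h t r where H: "exact_triangle T P P H \<phi> g h" "r : Z ~> H" "t : H ~> Z" "t \<odot> r = Ident T Z"
    using hocolim_retract[OF generate q s(1,2) kill P] by blast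
  have "P \<in> D" using coprodD[OF XD P] .
  then show "Z \<in> D" using retractD[OF coneD[OF H(1)] H(2,3,4)] by blast
qed

end

context cocomplete_triangulated
begin

section \<open>Objects with few morphisms from compact objects\<close>

lemma hom_card_retract:
  assumes "i : x ~> y" "r : y ~> x" "r \<odot> i = Ident T x" "z \<in> Obj T"
  shows "|Hom T x z| \<le>o |Hom T y z|" "|Hom T z x| \<le>o |Hom T z y|"
proof -
  have xy: "x \<in> Obj T" "y \<in> Obj T" using assms hom_Obj by blast+
  have "inj_on (\<lambda>f. f \<odot> r) (Hom T x z)"
  proof (rule inj_on_inverseI)
    fix f assume "f \<in> Hom T x z"
    then have "f : x ~> z" using xy assms homI by blast
    then show "(f \<odot> r) \<odot> i = f" using assms by (simp add: hom_def)
  qed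
  then show "|Hom T x z| \<le>o |Hom T y z|"
    by (rule card_of_ordLeqI) (rule hom_Obj(3)[OF comp_hom[OF assms(2) homI[OF xy(1) assms(4)]]])
  have "inj_on (\<lambda>f. i \<odot> f) (Hom T z x)"
  proof (rule inj_on_inverseI)
    fix f assume "f \<in> Hom T z x"
    then have f: "f : z ~> x" using xy assms homI by blast
    show "r \<odot> (i \<odot> f) = f" using comp_reduce[OF assms(3), of f] f assms by (simp add: hom_def)
  qed
  then show "|Hom T z x| \<le>o |Hom T z y|"
    by (rule card_of_ordLeqI) (rule hom_Obj(3)[OF comp_hom[OF homI[OF assms(4) xy(1)] assms(1)]])
qed

lemma hom_card_shift:
  assumes "x \<in> Obj T" "y \<in> Obj T" shows "|Hom T x y| =o |Hom T (\<Sigma> x) (\<Sigma> y)|"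
  using card_of_ordIsoI ShiftM_bij[OF assms] .

end

text \<open>
  The consequences of the hypotheses on \<open>T\<close>, \<open>\<alpha>\<close> and \<open>\<beta>\<close> from which the description of the
  \<open>\<beta>\<close>-compact objects follows.
\<close>

locale bounded_setting = cocomplete_triangulated T \<kappa>
  for T :: "('o, 'm, 'z) triangulated_data_scheme" (structure) and \<kappa> :: "'u rel" +
  fixes \<alpha> \<beta> :: "'u rel" and R :: "'o set"
  assumes \<alpha>: "regular_cardinal \<alpha>" and \<beta>: "regular_cardinal \<beta>" and \<alpha>\<beta>: "\<alpha> <o \<beta>" and \<beta>\<kappa>: "\<beta> <o \<kappa>"
    and generate: "\<And>E. E \<in> Obj T \<Longrightarrow> (\<And>S a. S \<in> Cpt \<alpha> \<Longrightarrow> a : S ~> E \<Longrightarrow> a = Zero T S E) \<Longrightarrow> is_zero_object T E"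
    and R_Cpt: "R \<subseteq> Cpt \<alpha>" and R_iso: "\<And>S. S \<in> Cpt \<alpha> \<Longrightarrow> \<exists>Y\<in>R. isomorphic T S Y"
    and R_card: "|SIGMA (x, y) : R \<times> R. Hom T x y| <o \<beta>"
    and few_subsets: "\<And>N :: 'u set. |N| <o \<beta> \<Longrightarrow> |{G. G \<subseteq> N \<and> |G| <o \<alpha>}| <o \<beta>"
begin

notation hom (\<open>_ : _ ~> _\<close> [51, 51, 51] 50) and add (infixl \<open>\<oplus>\<close> 65)

lemma \<alpha>\<beta>': "\<alpha> \<le>o \<beta>" and \<alpha>\<kappa>: "\<alpha> \<le>o \<kappa>" and \<beta>\<kappa>': "\<beta> \<le>o \<kappa>"
  using \<alpha>\<beta> \<beta>\<kappa> ordLess_transitive ordLess_imp_ordLeq by blast+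

lemma R_Obj: "Y \<in> R \<Longrightarrow> Y \<in> Obj T" using R_Cpt Cpt_Obj by blast

lemma R_obtain:
  assumes "S \<in> Cpt \<alpha>"
  obtains Y f g where "Y \<in> R" "f : S ~> Y" "g : Y ~> S" "g \<odot> f = Ident T S" "f \<odot> g = Ident T Y"
proof -
  obtain Y where Y: "Y \<in> R" "isomorphic T S Y" using R_iso[OF assms] by blast
  then show thesis using isomorphic_obtain[OF Y(2) Cpt_Obj[OF assms] R_Obj[OF Y(1)]] that by blast
qed

lemma R_small: "|R| <o \<beta>"
proof -
  have "|R| \<le>o |SIGMA (x, y) : R \<times> R. Hom T x y|"
    by (rule card_of_ordLeqI[of "\<lambda>x. ((x, x), Ident T x)"]) (auto simp: inj_on_def R_Obj Ident_closed)
  then show ?thesis using R_card ordLeq_ordLess_trans by blast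
qed

lemma cover_exists:
  assumes W: "W \<in> Obj T"
  shows "\<exists>V \<iota> v. is_coproduct T (Sigma R (\<lambda>Y. Hom T Y W)) fst V \<iota> \<and> onto \<alpha> V W v"
proof -
  let ?J = "Sigma R (\<lambda>Y. Hom T Y W)"
  have J: "|?J| <o \<kappa>"
    by (rule card_Sigma_less[OF regular_\<kappa> ordLess_transitive[OF R_small \<beta>\<kappa>]])
       (use lsmall R_Obj W in \<open>auto simp: locally_small_def\<close>)
  have Jh: "snd j : fst j ~> W" if "j \<in> ?J" for j using that R_Obj W by (auto intro: homI)
  obtain V \<iota> where V: "is_coproduct T ?J fst V \<iota>"
    by (rule coprod_exists[OF J, of fst]) (use hom_Obj(1)[OF Jh] in blast)+
  note \<iota> = coprod_inj[OF V]
  obtain v where v: "v : V ~> W" "\<And>j. j \<in> ?J \<Longrightarrow> v \<odot> \<iota> j = snd j" using coprod_ex[OF V W Jh] by blast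
  have "onto \<alpha> V W v"
    unfolding onto_def
  proof (intro conjI ballI allI impI v(1))
    fix S a assume S: "S \<in> Cpt \<alpha>" and a: "a : S ~> W"
    obtain Y f g where Y: "Y \<in> R" "f : S ~> Y" "g : Y ~> S" "g \<odot> f = Ident T S"
      using R_obtain[OF S] by blast
    have j: "(Y, a \<odot> g) \<in> ?J" using Y(1) comp_hom[OF Y(3) a] hom_Obj by blast
    have \<iota>j: "\<iota> (Y, a \<odot> g) : Y ~> V" using \<iota>[OF j] by simp
    have "v \<odot> (\<iota> (Y, a \<odot> g) \<odot> f) = (a \<odot> g) \<odot> f"
      using comp_reduce[OF v(2)[OF j], of f] v(1) \<iota>j Y(2) by (simp add: hom_def)
    also have "\<dots> = a" using a Y by (simp add: hom_def)
    finally show "\<exists>b. b : S ~> V \<and> v \<odot> b = a" using comp_hom[OF Y(2) \<iota>j] by blast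
  qed
  then show ?thesis using V by blast
qed

definition hom_bounded :: "'o set" where
  "hom_bounded = {Z \<in> Obj T. \<forall>Y\<in>Cpt \<alpha>. |Hom T Y Z| <o \<beta>}"

lemma hom_bounded_Obj: "Z \<in> hom_bounded \<Longrightarrow> Z \<in> Obj T" by (simp add: hom_bounded_def)

lemma hom_bounded_card: "Z \<in> hom_bounded \<Longrightarrow> Y \<in> Cpt \<alpha> \<Longrightarrow> |Hom T Y Z| <o \<beta>" by (simp add: hom_bounded_def)

lemma hom_boundedI: "Z \<in> Obj T \<Longrightarrow> (\<And>Y. Y \<in> Cpt \<alpha> \<Longrightarrow> |Hom T Y Z| <o \<beta>) \<Longrightarrow> Z \<in> hom_bounded"
  by (simp add: hom_bounded_def)

lemma hom_bounded_retract:
  assumes "x \<in> hom_bounded" "i : z ~> x" "r : x ~> z" "r \<odot> i = Ident T z"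
  shows "z \<in> hom_bounded"
proof (rule hom_boundedI)
  show "z \<in> Obj T" using assms hom_Obj by blast
  fix Y assume Y: "Y \<in> Cpt \<alpha>"
  show "|Hom T Y z| <o \<beta>"
    using hom_card_retract(2)[OF assms(2-4) Cpt_Obj[OF Y]] hom_bounded_card[OF assms(1) Y] ordLeq_ordLess_trans by blast
qed

lemma hom_bounded_shift:
  assumes "x \<in> hom_bounded" shows "\<Sigma> x \<in> hom_bounded"
proof (rule hom_boundedI)
  have x: "x \<in> Obj T" using hom_bounded_Obj[OF assms] .
  then show "\<Sigma> x \<in> Obj T" by simp
  fix Y assume Y: "Y \<in> Cpt \<alpha>"
  obtain S u v where u: "S \<in> Obj T" "u : \<Sigma> S ~> Y" "v : Y ~> \<Sigma> S"
    "v \<odot> u = Ident T (\<Sigma> S)" "u \<odot> v = Ident T Y" using unshift[OF Cpt_Obj[OF Y]] .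
  have S: "S \<in> Cpt \<alpha>" using Cpt_unshift[OF u(1) Cpt_iso[OF Y isomorphicI[OF u(2,3,4,5)]]] u(1) by simp
  have "|Hom T (\<Sigma> S) (\<Sigma> x)| <o \<beta>"
    using hom_card_shift[OF u(1) x] hom_bounded_card[OF assms S] ordIso_ordLess_trans ordIso_symmetric by blast
  then show "|Hom T Y (\<Sigma> x)| <o \<beta>"
    using hom_card_retract(1)[OF u(3,2,5), of "\<Sigma> x"] x ordLeq_ordLess_trans by (metis shift_Obj)
qed

lemma hom_bounded_unshift:
  assumes "x \<in> Obj T" "\<Sigma> x \<in> hom_bounded" shows "x \<in> hom_bounded"
proof (rule hom_boundedI[OF assms(1)])
  fix Y assume Y: "Y \<in> Cpt \<alpha>"
  show "|Hom T Y x| <o \<beta>"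
    using hom_card_shift[OF Cpt_Obj[OF Y] assms(1)] hom_bounded_card[OF assms(2) Cpt_shift[OF Y]] ordIso_ordLess_trans by blast
qed

text \<open>A fibre of \<open>Hom(Y, y) \<rightarrow> Hom(Y, z)\<close> is either empty or a coset of the image of \<open>Hom(Y, x)\<close>.\<close>

lemma hom_bounded_extension:
  assumes t: "exact_triangle T x y z f g h" and x: "x \<in> hom_bounded" and z: "z \<in> hom_bounded"
  shows "y \<in> hom_bounded"
proof (rule hom_boundedI)
  note tt = triangle_hom[OF t]
  show yO: "y \<in> Obj T" using tt hom_Obj by blast
  fix Y assume Y: "Y \<in> Cpt \<alpha>"
  have YO: "Y \<in> Obj T" by (rule Cpt_Obj[OF Y])
  define rep where "rep c = (SOME k. k : Y ~> y \<and> g \<odot> k = c)" for c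
  have "Hom T Y y \<subseteq> (\<Union>c\<in>Hom T Y z. (\<lambda>l. rep c \<oplus> (f \<odot> l)) ` Hom T Y x)"
  proof
    fix k assume "k \<in> Hom T Y y"
    then have k: "k : Y ~> y" using YO yO homI by blast
    have r: "rep (g \<odot> k) : Y ~> y \<and> g \<odot> rep (g \<odot> k) = g \<odot> k"
      unfolding rep_def by (rule someI[of _ k]) (use k in blast)
    obtain l where "l : Y ~> x" "k = rep (g \<odot> k) \<oplus> (f \<odot> l)"
      using triangle_lift_diff[OF t k, of "rep (g \<odot> k)"] r by metis
    then show "k \<in> (\<Union>c\<in>Hom T Y z. (\<lambda>l. rep c \<oplus> (f \<odot> l)) ` Hom T Y x)"
      using hom_Obj(3)[OF comp_hom[OF k tt(2)]] hom_Obj(3) by blast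
  qed
  moreover have "|\<Union>c\<in>Hom T Y z. (\<lambda>l. rep c \<oplus> (f \<odot> l)) ` Hom T Y x| <o \<beta>"
    by (rule card_UN_less[OF \<beta> hom_bounded_card[OF z Y]]) (rule card_image_less[OF hom_bounded_card[OF x Y]])
  ultimately show "|Hom T Y y| <o \<beta>" using card_subset_less by blast
qed

lemma hom_bounded_cone:
  assumes "exact_triangle T x y z f g h" "x \<in> hom_bounded" "y \<in> hom_bounded"
  shows "z \<in> hom_bounded"
  using rotate[OF assms(1)] hom_bounded_extension[OF _ assms(3) hom_bounded_shift[OF assms(2)]] by metis

text \<open>The shift of a fibre is a cone.\<close>

lemma fibre_closed:
  assumes cone: "\<And>x y z f g h. exact_triangle T x y z f g h \<Longrightarrow> x \<in> D \<Longrightarrow> y \<in> D \<Longrightarrow> z \<in> D"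
    and unshift: "\<And>x. x \<in> Obj T \<Longrightarrow> \<Sigma> x \<in> D \<Longrightarrow> x \<in> D"
    and t: "exact_triangle T w x z f g h" "x \<in> D" "z \<in> D"
  shows "w \<in> D"
proof -
  obtain f' where "exact_triangle T x z (\<Sigma> w) g h f'" using rotate[OF t(1)] by blast
  then have "\<Sigma> w \<in> D" using cone t by blast
  moreover have "w \<in> Obj T" using triangle_hom(1)[OF t(1)] hom_Obj by blast
  ultimately show ?thesis using unshift by blast
qed

lemma Cpt_alpha_subset_hom_bounded: "Cpt \<alpha> \<subseteq> hom_bounded"
proof (intro subsetI hom_boundedI)
  fix Z Y assume Z: "Z \<in> Cpt \<alpha>"
  then show ZO: "Z \<in> Obj T" by (rule Cpt_Obj)
  assume Y: "Y \<in> Cpt \<alpha>"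
  obtain Z' a b where Z': "Z' \<in> R" "a : Z ~> Z'" "b : Z' ~> Z" "b \<odot> a = Ident T Z" using R_obtain[OF Z] by blast
  obtain Y' c d where Y': "Y' \<in> R" "c : Y ~> Y'" "d : Y' ~> Y" "d \<odot> c = Ident T Y" using R_obtain[OF Y] by blast
  have 1: "|Hom T Y Z| \<le>o |Hom T Y Z'|" using hom_card_retract(2)[OF Z'(2-4) Cpt_Obj[OF Y]] .
  have 2: "|Hom T Y Z'| \<le>o |Hom T Y' Z'|" using hom_card_retract(1)[OF Y'(2-4) R_Obj[OF Z'(1)]] .
  have 3: "|Hom T Y' Z'| \<le>o |SIGMA (x, y) : R \<times> R. Hom T x y|"
    by (rule card_of_ordLeqI[of "\<lambda>f. ((Y', Z'), f)"]) (use Y'(1) Z'(1) in \<open>auto simp: inj_on_def\<close>)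
  show "|Hom T Y Z| <o \<beta>"
    using ordLeq_transitive[OF 1 ordLeq_transitive[OF 2 3]] R_card ordLeq_ordLess_trans by blast
qed

text \<open>Transport of \<open>few_subsets\<close> to index sets of arbitrary type.\<close>

lemma few_subsets_poly:
  fixes N :: "'n set"
  assumes "|N| <o \<beta>" shows "|{G. G \<subseteq> N \<and> |G| <o \<alpha>}| <o \<beta>"
proof -
  obtain b :: "'n \<Rightarrow> 'u" where b: "bij_betw b N (b ` N)" using small_index ordLess_transitive[OF assms \<beta>\<kappa>] by blast
  have "|N| \<le>o |b ` N|" using card_of_ordIsoI[OF b] ordIso_imp_ordLeq by blast
  then have "|{G. G \<subseteq> N \<and> |G| <o \<alpha>}| \<le>o |{G. G \<subseteq> b ` N \<and> |G| <o \<alpha>}|" by (rule card_small_subsets_mono)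
  moreover have "|{G. G \<subseteq> b ` N \<and> |G| <o \<alpha>}| <o \<beta>" using few_subsets card_image_less[OF assms] by blast
  ultimately show ?thesis using ordLeq_ordLess_trans by blast
qed

text \<open>
  A morphism from a compact object \<open>Y\<close> to \<open>P\<close> factors through the coproduct \<open>Q G\<close> of a set \<open>G\<close> of
  fewer than \<open>\<alpha>\<close> morphisms from objects of \<open>R\<close> to the summands. There are fewer than \<open>\<beta>\<close> choices
  for \<open>G\<close>, and fewer than \<open>\<beta>\<close> morphisms from \<open>Y\<close> to each of the compact objects \<open>Q G\<close>.
\<close>

lemma hom_bounded_coprod:
  fixes K :: "'k set"
  assumes K: "|K| <o \<beta>" and P: "is_coproduct T K Z P \<iota>" and Z: "\<And>k. k \<in> K \<Longrightarrow> Z k \<in> hom_bounded"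
  shows "P \<in> hom_bounded"
proof (rule hom_boundedI)
  show PO: "P \<in> Obj T" by (rule coprod_Obj[OF P])
  note \<iota> = coprod_inj[OF P]
  define N where "N = Sigma K (\<lambda>k. Sigma R (\<lambda>Y. Hom T Y (Z k)))"
  have N: "|N| <o \<beta>" unfolding N_def
    by (intro card_Sigma_less[OF \<beta>] K R_small hom_bounded_card Z) (use R_Cpt in blast)+
  define obj where "obj n = fst (snd n)" for n :: "'k \<times> 'o \<times> 'm"
  define mor where "mor n = \<iota> (fst n) \<odot> snd (snd n)" for n :: "'k \<times> 'o \<times> 'm"
  have mor: "mor n : obj n ~> P" "obj n \<in> R" if "n \<in> N" for n
  proof -
    obtain k Y p where n: "n = (k, Y, p)" by (rule prod_cases3)
    then have k: "k \<in> K" "Y \<in> R" "p \<in> Hom T Y (Z k)" using that by (auto simp: N_def)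
    show "mor n : obj n ~> P" "obj n \<in> R"
      using comp_hom[OF homI[OF R_Obj[OF k(2)] hom_bounded_Obj[OF Z[OF k(1)]] k(3)] \<iota>[OF k(1)]] k(2)
      by (simp_all add: n mor_def obj_def)
  qed
  have "\<exists>Q \<rho> h. is_coproduct T G obj Q \<rho> \<and> h : Q ~> P \<and> (\<forall>n\<in>G. h \<odot> \<rho> n = mor n)"
    if G: "G \<subseteq> N" for G
  proof -
    have G\<kappa>: "|G| <o \<kappa>" using card_subset_less[OF G N] \<beta>\<kappa> ordLess_transitive by blast
    have mG: "mor n : obj n ~> P" if "n \<in> G" for n using mor G that by blast
    obtain Q \<rho> where Q: "is_coproduct T G obj Q \<rho>" by (rule coprod_exists[OF G\<kappa> hom_Obj(1)[OF mG]])
    show ?thesis using coprod_ex[OF Q PO mG] Q by blast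
  qed
  then obtain Q \<rho> h where Q: "\<And>G. G \<subseteq> N \<Longrightarrow> is_coproduct T G obj (Q G) (\<rho> G)"
    "\<And>G. G \<subseteq> N \<Longrightarrow> h G : Q G ~> P" "\<And>G n. G \<subseteq> N \<Longrightarrow> n \<in> G \<Longrightarrow> h G \<odot> \<rho> G n = mor n" by metis
  fix Y assume Y: "Y \<in> Cpt \<alpha>"
  have YO: "Y \<in> Obj T" by (rule Cpt_Obj[OF Y])
  let ?\<G> = "{G. G \<subseteq> N \<and> |G| <o \<alpha>}"
  have "Hom T Y P \<subseteq> (\<Union>G\<in>?\<G>. (\<lambda>g. h G \<odot> g) ` Hom T Y (Q G))"
  proof
    fix f assume "f \<in> Hom T Y P"
    then have f: "f : Y ~> P" using YO PO homI by blast
    have K\<kappa>: "|K| <o \<kappa>" using ordLess_transitive[OF K \<beta>\<kappa>] .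
    obtain K' S p Q0 \<iota>' h0 g where *: "K' \<subseteq> K" "|K'| <o \<alpha>" "\<And>i. i \<in> K' \<Longrightarrow> S i \<in> Cpt \<alpha>"
      "\<And>i. i \<in> K' \<Longrightarrow> p i : S i ~> Z i" "is_coproduct T K' S Q0 \<iota>'" "h0 : Q0 ~> P"
      "\<And>i. i \<in> K' \<Longrightarrow> h0 \<odot> \<iota>' i = \<iota> i \<odot> p i" "g : Y ~> Q0" "f = h0 \<odot> g"
      by (rule factorsE[OF factoring_toD[OF Cpt_factoring[OF Y] K\<kappa> P f] f]) blast
    note \<iota>' = coprod_inj[OF *(5)]
    have "\<forall>i\<in>K'. \<exists>Y a b. Y \<in> R \<and> a : S i ~> Y \<and> b : Y ~> S i \<and> b \<odot> a = Ident T (S i)"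
      using R_obtain[OF *(3)] by metis
    then obtain Y' a b where Y': "\<And>i. i \<in> K' \<Longrightarrow> Y' i \<in> R" "\<And>i. i \<in> K' \<Longrightarrow> a i : S i ~> Y' i"
      "\<And>i. i \<in> K' \<Longrightarrow> b i : Y' i ~> S i" "\<And>i. i \<in> K' \<Longrightarrow> b i \<odot> a i = Ident T (S i)" by metis
    define nn where "nn i = (i, Y' i, p i \<odot> b i)" for i
    define G where "G = nn ` K'"
    have "nn i \<in> N" if "i \<in> K'" for i
      using *(1) Y'(1)[OF that] that hom_Obj(3)[OF comp_hom[OF Y'(3)[OF that] *(4)[OF that]]] by (auto simp: N_def nn_def)
    then have GN: "G \<subseteq> N" by (auto simp: G_def)
    have G\<alpha>: "|G| <o \<alpha>" unfolding G_def by (rule card_image_less[OF *(2)])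
    note \<rho> = coprod_inj[OF Q(1)[OF GN]]
    have nG: "nn i \<in> G" if "i \<in> K'" for i using that by (simp add: G_def)
    have \<rho>': "\<rho> G (nn i) : Y' i ~> Q G" if "i \<in> K'" for i using \<rho>[OF nG[OF that]] by (simp add: obj_def nn_def)
    have "\<exists>t. t : Q0 ~> Q G \<and> (\<forall>i\<in>K'. t \<odot> \<iota>' i = \<rho> G (nn i) \<odot> a i)"
      by (rule coprod_ex[OF *(5) coprod_Obj[OF Q(1)[OF GN]]]) (rule comp_hom[OF Y'(2) \<rho>'])
    then obtain t where t: "t : Q0 ~> Q G" "\<And>i. i \<in> K' \<Longrightarrow> t \<odot> \<iota>' i = \<rho> G (nn i) \<odot> a i" by blast
    have ht: "h G \<odot> t = h0"
    proof (rule coprod_eqI[OF *(5) comp_hom[OF t(1) Q(2)[OF GN]] *(6)])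
      fix i assume i: "i \<in> K'"
      have \<iota>i: "\<iota> i : Z i ~> P" using \<iota> *(1) i by blast
      have "(h G \<odot> t) \<odot> \<iota>' i = h G \<odot> (\<rho> G (nn i) \<odot> a i)" using Q(2)[OF GN] t(1) t(2)[OF i] \<iota>'[OF i] by (simp add: hom_def)
      also have "\<dots> = mor (nn i) \<odot> a i"
        using comp_reduce[OF Q(3)[OF GN nG[OF i]], of "a i"] Q(2)[OF GN] \<rho>'[OF i] Y'(2)[OF i] by (simp add: hom_def)
      also have "\<dots> = \<iota> i \<odot> (p i \<odot> (b i \<odot> a i))" unfolding mor_def nn_def
        using \<iota>i *(4)[OF i] Y'(2,3)[OF i] by (simp add: hom_def)
      also have "\<dots> = \<iota> i \<odot> p i" unfolding Y'(4)[OF i] using *(4)[OF i] by (simp add: hom_def)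
      finally show "(h G \<odot> t) \<odot> \<iota>' i = h0 \<odot> \<iota>' i" using *(7)[OF i] by simp
    qed
    have "f = h G \<odot> (t \<odot> g)" using comp_reduce[OF ht, of g] Q(2)[OF GN] t(1) *(8,9) by (simp add: hom_def)
    moreover have "t \<odot> g \<in> Hom T Y (Q G)" using comp_hom[OF *(8) t(1)] hom_Obj by blast
    ultimately show "f \<in> (\<Union>G\<in>?\<G>. (\<lambda>g. h G \<odot> g) ` Hom T Y (Q G))" using GN G\<alpha> by blast
  qed
  moreover have "|\<Union>G\<in>?\<G>. (\<lambda>g. h G \<odot> g) ` Hom T Y (Q G)| <o \<beta>"
  proof (rule card_UN_less[OF \<beta> few_subsets_poly[OF N]], rule card_image_less)
    fix G assume "G \<in> ?\<G>"
    then have G: "G \<subseteq> N" "|G| <o \<alpha>" by auto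
    have "Q G \<in> Cpt \<alpha>"
      by (rule coprod_closedD[OF Cpt_coprod_closed[OF \<alpha> \<alpha>\<kappa>] \<alpha>\<kappa> G(2) _ Q(1)[OF G(1)]])
         (use mor(2) G(1) R_Cpt in blast)
    then show "|Hom T Y (Q G)| <o \<beta>" using hom_bounded_card Cpt_alpha_subset_hom_bounded Y by blast
  qed
  ultimately show "|Hom T Y P| <o \<beta>" using card_subset_less by blast
qed

section \<open>Comparison with the \<open>\<beta>\<close>-compact objects\<close>

text \<open>
  For a hom-bounded object \<open>W\<close> the coproduct of all objects of \<open>R\<close> over \<open>W\<close> has fewer than \<open>\<beta>\<close>
  summands, hence is itself hom-bounded and \<open>\<beta>\<close>-compact.
\<close>

lemma hom_bounded_subset_Cpt_beta: "hom_bounded \<subseteq> Cpt \<beta>"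
proof -
  let ?D = "hom_bounded \<inter> Cpt \<beta>"
  have nat: "|UNIV::nat set| <o \<beta>"
  proof -
    have "natLeq \<le>o \<alpha>" using \<alpha> natLeq_ordLeq_cinfinite unfolding regular_cardinal_def by blast
    then show ?thesis using \<alpha>\<beta> card_of_nat ordIso_ordLeq_trans ordLeq_ordLess_trans by blast
  qed
  have "hom_bounded \<subseteq> ?D"
  proof (rule generation[OF generate])
    fix x y z f g h assume "exact_triangle T x y z f g h" "x \<in> ?D" "y \<in> ?D"
    then show "z \<in> ?D" using hom_bounded_cone Cpt_cone[OF \<beta> \<beta>\<kappa>'] by blast
  next
    fix x z i r assume "x \<in> ?D" "i : z ~> x" "r : x ~> z" "r \<odot> i = Ident T z"
    then show "z \<in> ?D" using hom_bounded_retract Cpt_retract by blast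
  next
    fix X :: "nat \<Rightarrow> 'o" and P \<iota> assume X: "\<And>n. X n \<in> ?D" and P: "is_coproduct T UNIV X P \<iota>"
    show "P \<in> ?D"
      using hom_bounded_coprod[OF nat P] coprod_closedD[OF Cpt_coprod_closed[OF \<beta> \<beta>\<kappa>'] \<beta>\<kappa>' nat _ P] X by blast
  next
    fix w x z f g h assume "exact_triangle T w x z f g h" "x \<in> ?D" "z \<in> hom_bounded"
    then show "w \<in> hom_bounded"
      by (intro fibre_closed[of hom_bounded w x z f g h]) (use hom_bounded_cone hom_bounded_unshift in auto)
  next
    fix W assume W: "W \<in> hom_bounded"
    obtain V \<iota> v where V: "is_coproduct T (Sigma R (\<lambda>Y. Hom T Y W)) fst V \<iota>" "onto \<alpha> V W v"
      using cover_exists[OF hom_bounded_Obj[OF W]] by blast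
    have J: "|Sigma R (\<lambda>Y. Hom T Y W)| <o \<beta>"
      by (rule card_Sigma_less[OF \<beta> R_small hom_bounded_card[OF W]]) (use R_Cpt in blast)
    have RD: "fst j \<in> ?D" if "j \<in> Sigma R (\<lambda>Y. Hom T Y W)" for j
      using that R_Cpt Cpt_alpha_subset_hom_bounded Cpt_mono[OF \<alpha>\<beta>'] by auto
    have "V \<in> ?D"
      using hom_bounded_coprod[OF J V(1)] coprod_closedD[OF Cpt_coprod_closed[OF \<beta> \<beta>\<kappa>'] \<beta>\<kappa>' J _ V(1)] RD by blast
    then show "\<exists>V\<in>?D. \<exists>v. onto \<alpha> V W v" using V(2) by blast
  qed (use generate in blast)
  then show ?thesis by blast
qed

definition bounded_Cpt :: "'o set" where "bounded_Cpt = hom_bounded \<inter> Cpt \<beta>"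

text \<open>
  The targets of those morphisms from \<open>\<beta>\<close>-compact objects that admit an interpolation by
  an object that is both hom-bounded and \<open>\<beta>\<close>-compact.
\<close>

definition interpolating :: "'o set" where
  "interpolating = {z \<in> Obj T. \<forall>x\<in>Cpt \<beta>. \<forall>f. f : x ~> z \<longrightarrow>
     (\<exists>d\<in>bounded_Cpt. \<exists>a b. b : x ~> d \<and> a : d ~> z \<and> f = a \<odot> b)}"

lemma bounded_Cpt_cone: "exact_triangle T x y z f g h \<Longrightarrow> x \<in> bounded_Cpt \<Longrightarrow> y \<in> bounded_Cpt \<Longrightarrow> z \<in> bounded_Cpt"
  using hom_bounded_cone Cpt_cone[OF \<beta> \<beta>\<kappa>'] unfolding bounded_Cpt_def by blast

lemma bounded_Cpt_fibre: "exact_triangle T w x z f g h \<Longrightarrow> x \<in> bounded_Cpt \<Longrightarrow> z \<in> bounded_Cpt \<Longrightarrow> w \<in> bounded_Cpt"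
  by (rule fibre_closed[of bounded_Cpt w x z f g h]) (use bounded_Cpt_cone hom_bounded_unshift Cpt_unshift in \<open>auto simp: bounded_Cpt_def\<close>)

lemma bounded_Cpt_shift: "x \<in> bounded_Cpt \<Longrightarrow> \<Sigma> x \<in> bounded_Cpt"
  using hom_bounded_shift Cpt_shift unfolding bounded_Cpt_def by blast

lemma bounded_Cpt_coprod:
  fixes J :: "'j set"
  assumes "|J| <o \<beta>" "is_coproduct T J X P \<iota>" "\<And>j. j \<in> J \<Longrightarrow> X j \<in> bounded_Cpt"
  shows "P \<in> bounded_Cpt"
  using hom_bounded_coprod[OF assms(1,2)] coprod_closedD[OF Cpt_coprod_closed[OF \<beta> \<beta>\<kappa>'] \<beta>\<kappa>' assms(1) _ assms(2)] assms(3)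
  unfolding bounded_Cpt_def by blast

lemma interpolatingI:
  assumes "z \<in> Obj T" "\<And>x f. x \<in> Cpt \<beta> \<Longrightarrow> f : x ~> z \<Longrightarrow>
    \<exists>d\<in>bounded_Cpt. \<exists>a b. b : x ~> d \<and> a : d ~> z \<and> f = a \<odot> b"
  shows "z \<in> interpolating"
  using assms unfolding interpolating_def by blast

lemma interpolatingE:
  assumes "z \<in> interpolating" "x \<in> Cpt \<beta>" "f : x ~> z"
  obtains d a b where "d \<in> bounded_Cpt" "b : x ~> d" "a : d ~> z" "f = a \<odot> b"
  using assms unfolding interpolating_def by blast

lemma bounded_Cpt_interpolating: "bounded_Cpt \<subseteq> interpolating"
proof (intro subsetI interpolatingI)
  fix z assume z: "z \<in> bounded_Cpt"
  then show zO: "z \<in> Obj T" using hom_bounded_Obj by (simp add: bounded_Cpt_def)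
  fix x f assume f: "f : x ~> z"
  have "f = Ident T z \<odot> f" using f by (simp add: hom_def)
  then show "\<exists>d\<in>bounded_Cpt. \<exists>a b. b : x ~> d \<and> a : d ~> z \<and> f = a \<odot> b" using z f id_hom[OF zO] by blast
qed

lemma interpolating_Obj: "z \<in> interpolating \<Longrightarrow> z \<in> Obj T" by (simp add: interpolating_def)

lemma interpolating_retract:
  assumes "x \<in> interpolating" "i : z ~> x" "r : x ~> z" "r \<odot> i = Ident T z"
  shows "z \<in> interpolating"
proof (rule interpolatingI)
  show "z \<in> Obj T" using assms hom_Obj by blast
  fix c f assume c: "c \<in> Cpt \<beta>" "f : c ~> z"
  obtain d a b where d: "d \<in> bounded_Cpt" "b : c ~> d" "a : d ~> x" "i \<odot> f = a \<odot> b"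
    using interpolatingE[OF assms(1) c(1) comp_hom[OF c(2) assms(2)]] .
  have "f = r \<odot> (i \<odot> f)" using comp_reduce[OF assms(4), of f] assms(2,3) c(2) by (simp add: hom_def)
  then have "f = (r \<odot> a) \<odot> b" unfolding d(4) using assms(3) d(2,3) by (simp add: hom_def)
  then show "\<exists>d\<in>bounded_Cpt. \<exists>a b. b : c ~> d \<and> a : d ~> z \<and> f = a \<odot> b"
    using d(1,2) comp_hom[OF d(3) assms(3)] by blast
qed

lemma interpolating_shift:
  assumes "z \<in> interpolating" shows "\<Sigma> z \<in> interpolating"
proof (rule interpolatingI)
  have z: "z \<in> Obj T" by (rule interpolating_Obj[OF assms])
  then show "\<Sigma> z \<in> Obj T" by simp
  fix x f assume x: "x \<in> Cpt \<beta>" and f: "f : x ~> \<Sigma> z"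
  obtain y u v where u: "y \<in> Obj T" "u : \<Sigma> y ~> x" "v : x ~> \<Sigma> y"
    "v \<odot> u = Ident T (\<Sigma> y)" "u \<odot> v = Ident T x" using unshift[OF Cpt_Obj[OF x]] .
  have y: "y \<in> Cpt \<beta>" using Cpt_unshift[OF u(1) Cpt_iso[OF x isomorphicI[OF u(2,3,4,5)]]] u(1) by simp
  obtain f' where f': "f' : y ~> z" "f \<odot> u = \<sigma> f'" using shift_full[OF comp_hom[OF u(2) f] u(1) z] .
  obtain d a b where d: "d \<in> bounded_Cpt" "b : y ~> d" "a : d ~> z" "f' = a \<odot> b" using interpolatingE[OF assms y f'(1)] .
  have "f = f \<odot> (u \<odot> v)" unfolding u(5) using f by (simp add: hom_def)
  also have "\<dots> = (f \<odot> u) \<odot> v" using f u(2,3) by (simp add: hom_def)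
  also have "\<dots> = \<sigma> a \<odot> (\<sigma> b \<odot> v)" unfolding f'(2) d(4) using d(2,3) u(3) by (simp add: hom_def)
  finally show "\<exists>d\<in>bounded_Cpt. \<exists>a b. b : x ~> d \<and> a : d ~> \<Sigma> z \<and> f = a \<odot> b"
    using bounded_Cpt_shift[OF d(1)] comp_hom[OF u(3) shift_hom[OF d(2)]] shift_hom[OF d(3)] by blast
qed

lemma interpolate_add:
  assumes "d1 \<in> bounded_Cpt" "b1 : x ~> d1" "a1 : d1 ~> z" "d2 \<in> bounded_Cpt" "b2 : x ~> d2" "a2 : d2 ~> z"
  shows "\<exists>d\<in>bounded_Cpt. \<exists>a b. b : x ~> d \<and> a : d ~> z \<and> (a1 \<odot> b1) \<oplus> (a2 \<odot> b2) = a \<odot> b"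
proof -
  have O: "d1 \<in> Obj T" "d2 \<in> Obj T" "z \<in> Obj T" using assms hom_Obj by blast+
  obtain d \<zeta> where d: "is_coproduct T (UNIV::bool set) (\<lambda>b. if b then d1 else d2) d \<zeta>"
    using binary_coproduct_exists[OF O(1,2)] by blast
  have \<zeta>: "\<zeta> True : d1 ~> d" "\<zeta> False : d2 ~> d" using coprod_inj[OF d, of True] coprod_inj[OF d, of False] by auto
  have "\<exists>a. a : d ~> z \<and> (\<forall>b\<in>UNIV. a \<odot> \<zeta> b = (if b then a1 else a2))"
    by (rule coprod_ex[OF d O(3)]) (use assms in simp)
  then obtain a where a: "a : d ~> z" "a \<odot> \<zeta> True = a1" "a \<odot> \<zeta> False = a2" by fastforce
  have b: "(\<zeta> True \<odot> b1) \<oplus> (\<zeta> False \<odot> b2) : x ~> d"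
    using add_hom[OF comp_hom[OF assms(2) \<zeta>(1)] comp_hom[OF assms(5) \<zeta>(2)]] .
  have "a \<odot> ((\<zeta> True \<odot> b1) \<oplus> (\<zeta> False \<odot> b2)) = (a1 \<odot> b1) \<oplus> (a2 \<odot> b2)"
    using comp_reduce[OF a(2), of b1] comp_reduce[OF a(3), of b2] a(1) \<zeta> assms(2,5) by (simp add: hom_def)
  moreover have "d \<in> bounded_Cpt" by (rule bounded_Cpt_coprod[OF card_finite_less[OF \<beta>] d]) (use assms in auto)
  ultimately show ?thesis using a(1) b by metis
qed

text \<open>
  Interpolate \<open>h \<odot> f : x \<rightarrow> \<Sigma> z1\<close> by \<open>c\<close>. The obstruction to lifting \<open>c \<rightarrow> \<Sigma> z1\<close> to \<open>z2\<close> is the morphism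
  \<open>c \<rightarrow> \<Sigma> z\<close>, which vanishes on \<open>x\<close>, so factors through the cone \<open>e\<close> of \<open>x \<rightarrow> c\<close>, and then
  through an interpolating object \<open>c2\<close>. On the fibre \<open>w\<close> of \<open>c \<rightarrow> c2\<close> the obstruction is gone, and \<open>x \<rightarrow> c\<close>
  factors through \<open>w\<close>. The resulting morphism \<open>x \<rightarrow> w \<rightarrow> z2\<close> differs from \<open>f\<close> by one that factors
  through \<open>z\<close>, which can be interpolated as well.
\<close>

lemma interpolating_cone:
  assumes t: "exact_triangle T z1 z z2 p q h" and z1: "z1 \<in> interpolating" and z: "z \<in> interpolating"
  shows "z2 \<in> interpolating"
proof (rule interpolatingI)
  note tt = triangle_hom[OF t]
  show z2O: "z2 \<in> Obj T" using tt hom_Obj by blast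
  fix x f assume x: "x \<in> Cpt \<beta>" and f: "f : x ~> z2"
  have zO: "z \<in> Obj T" "z1 \<in> Obj T" using tt hom_Obj by blast+
  have xO: "x \<in> Obj T" by (rule Cpt_Obj[OF x])
  obtain c a b where c: "c \<in> bounded_Cpt" "b : x ~> c" "a : c ~> \<Sigma> z1" "h \<odot> f = a \<odot> b"
    using interpolatingE[OF interpolating_shift[OF z1] x comp_hom[OF f tt(3)]] .
  obtain e g0 g1 where te: "exact_triangle T x c e b g0 g1" using cone_exists[OF c(2)] .
  note tte = triangle_hom[OF te]
  have e: "e \<in> Cpt \<beta>" using Cpt_cone[OF \<beta> \<beta>\<kappa>' te x] c(1) by (simp add: bounded_Cpt_def)
  have pa: "\<sigma> p \<odot> a : c ~> \<Sigma> z" using comp_hom[OF c(3) shift_hom[OF tt(1)]] .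
  have "(\<sigma> p \<odot> a) \<odot> b = \<sigma> p \<odot> (h \<odot> f)" unfolding c(4) using tt(1) c(2,3) by (simp add: hom_def)
  also have "\<dots> = Zero T x (\<Sigma> z)"
    using comp_reduce[OF triangle_comp_zero3[OF t], of f] tt f zO by (simp add: hom_def)
  finally obtain m where m: "m : e ~> \<Sigma> z" "\<sigma> p \<odot> a = m \<odot> g0" using triangle_extend[OF te pa] by blast
  obtain c2 a2 b2 where c2: "c2 \<in> bounded_Cpt" "b2 : e ~> c2" "a2 : c2 ~> \<Sigma> z" "m = a2 \<odot> b2"
    using interpolatingE[OF interpolating_shift[OF z] e m(1)] .
  have k: "b2 \<odot> g0 : c ~> c2" using comp_hom[OF tte(2) c2(2)] .
  obtain w j i where tw: "exact_triangle T w c c2 j (b2 \<odot> g0) i" using fibre_exists[OF k] .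
  note ttw = triangle_hom[OF tw]
  have wO: "w \<in> Obj T" "c2 \<in> Obj T" using ttw hom_Obj by blast+
  have w: "w \<in> bounded_Cpt" using bounded_Cpt_fibre[OF tw c(1) c2(1)] .
  have "(b2 \<odot> g0) \<odot> b = b2 \<odot> (g0 \<odot> b)" using c2(2) tte by (simp add: hom_def)
  also have "\<dots> = Zero T x c2" unfolding triangle_comp_zero[OF te] using c2(2) xO by (simp add: hom_def)
  finally obtain b' where b': "b' : x ~> w" "b = j \<odot> b'" using triangle_lift[OF tw c(2)] by blast
  have aj: "a \<odot> j : w ~> \<Sigma> z1" using comp_hom[OF ttw(1) c(3)] .
  have "\<sigma> p \<odot> (a \<odot> j) = (m \<odot> g0) \<odot> j" unfolding m(2)[symmetric] using tt(1) c(3) ttw(1) by (simp add: hom_def)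
  also have "\<dots> = a2 \<odot> ((b2 \<odot> g0) \<odot> j)" unfolding c2(4) using c2(2,3) tte ttw(1) by (simp add: hom_def)
  also have "\<dots> = Zero T w (\<Sigma> z)" unfolding triangle_comp_zero[OF tw] using c2(3) wO by (simp add: hom_def)
  finally obtain n where n: "n : w ~> z2" "a \<odot> j = h \<odot> n" using triangle_lift3[OF t aj] by blast
  have "h \<odot> f = (a \<odot> j) \<odot> b'" unfolding c(4) b'(2) using c(3) ttw(1) b'(1) by (simp add: hom_def)
  also have "\<dots> = h \<odot> (n \<odot> b')" unfolding n(2) using tt n(1) b'(1) by (simp add: hom_def)
  finally have eq: "h \<odot> f = h \<odot> (n \<odot> b')" .
  obtain h' where th: "exact_triangle T z z2 (\<Sigma> z1) q h h'" using rotate[OF t] by blast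
  obtain l where l: "l : x ~> z" "f = (n \<odot> b') \<oplus> (q \<odot> l)"
    using triangle_lift_diff[OF th f comp_hom[OF b'(1) n(1)] eq] .
  obtain c3 a3 b3 where c3: "c3 \<in> bounded_Cpt" "b3 : x ~> c3" "a3 : c3 ~> z" "l = a3 \<odot> b3" using interpolatingE[OF z x l(1)] .
  have "f = (n \<odot> b') \<oplus> ((q \<odot> a3) \<odot> b3)" using l(2) c3 tt(2) by (simp add: hom_def)
  then show "\<exists>d\<in>bounded_Cpt. \<exists>a b. b : x ~> d \<and> a : d ~> z2 \<and> f = a \<odot> b"
    using interpolate_add[OF w b'(1) n(1) c3(1,2) comp_hom[OF c3(3) tt(2)]] by simp
qed

text \<open>
  A morphism from a \<open>\<beta>\<close>-compact object to a coproduct factors through fewer than \<open>\<beta>\<close> morphisms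
  from \<open>\<beta>\<close>-compact objects to the summands; interpolate each of them.
\<close>

lemma interpolating_coprod:
  fixes I :: "'i set"
  assumes I: "|I| <o \<kappa>" and P: "is_coproduct T I X P \<iota>" and X: "\<And>i. i \<in> I \<Longrightarrow> X i \<in> interpolating"
  shows "P \<in> interpolating"
proof (rule interpolatingI)
  show PO: "P \<in> Obj T" by (rule coprod_Obj[OF P])
  note \<iota> = coprod_inj[OF P]
  fix x f assume x: "x \<in> Cpt \<beta>" and f: "f : x ~> P"
  obtain I' S p Q \<iota>' h g where *: "I' \<subseteq> I" "|I'| <o \<beta>" "\<And>i. i \<in> I' \<Longrightarrow> S i \<in> Cpt \<beta>"
    "\<And>i. i \<in> I' \<Longrightarrow> p i : S i ~> X i" "is_coproduct T I' S Q \<iota>'" "h : Q ~> P"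
    "\<And>i. i \<in> I' \<Longrightarrow> h \<odot> \<iota>' i = \<iota> i \<odot> p i" "g : x ~> Q" "f = h \<odot> g"
    by (rule factorsE[OF factoring_toD[OF Cpt_factoring[OF x] I P f] f]) blast
  note \<iota>' = coprod_inj[OF *(5)]
  have "\<forall>i\<in>I'. \<exists>d a b. d \<in> bounded_Cpt \<and> b : S i ~> d \<and> a : d ~> X i \<and> p i = a \<odot> b"
    using interpolatingE[OF X *(3,4)] *(1) by (metis subsetD)
  then obtain d a b where d: "\<And>i. i \<in> I' \<Longrightarrow> d i \<in> bounded_Cpt" "\<And>i. i \<in> I' \<Longrightarrow> b i : S i ~> d i"
    "\<And>i. i \<in> I' \<Longrightarrow> a i : d i ~> X i" "\<And>i. i \<in> I' \<Longrightarrow> p i = a i \<odot> b i" by metis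
  have I': "|I'| <o \<kappa>" using card_subset_less[OF *(1) I] .
  obtain E \<epsilon> where E: "is_coproduct T I' d E \<epsilon>" by (rule coprod_exists[OF I' hom_Obj(1)[OF d(3)]])
  note \<epsilon> = coprod_inj[OF E]
  have ED: "E \<in> bounded_Cpt" by (rule bounded_Cpt_coprod[OF *(2) E d(1)])
  have "\<exists>s. s : Q ~> E \<and> (\<forall>i\<in>I'. s \<odot> \<iota>' i = \<epsilon> i \<odot> b i)"
    by (rule coprod_ex[OF *(5) coprod_Obj[OF E]]) (rule comp_hom[OF d(2) \<epsilon>])
  then obtain s where s: "s : Q ~> E" "\<And>i. i \<in> I' \<Longrightarrow> s \<odot> \<iota>' i = \<epsilon> i \<odot> b i" by blast
  have "\<exists>r. r : E ~> P \<and> (\<forall>i\<in>I'. r \<odot> \<epsilon> i = \<iota> i \<odot> a i)"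
    by (rule coprod_ex[OF E PO]) (use comp_hom[OF d(3) \<iota>] *(1) in blast)
  then obtain r where r: "r : E ~> P" "\<And>i. i \<in> I' \<Longrightarrow> r \<odot> \<epsilon> i = \<iota> i \<odot> a i" by blast
  have rs: "r \<odot> s = h"
  proof (rule coprod_eqI[OF *(5) comp_hom[OF s(1) r(1)] *(6)])
    fix i assume i: "i \<in> I'"
    have \<iota>i: "\<iota> i : X i ~> P" using \<iota> *(1) i by blast
    have "(r \<odot> s) \<odot> \<iota>' i = r \<odot> (\<epsilon> i \<odot> b i)" using r(1) s(1) s(2)[OF i] \<iota>'[OF i] by (simp add: hom_def)
    also have "\<dots> = (\<iota> i \<odot> a i) \<odot> b i" using comp_reduce[OF r(2)[OF i], of "b i"] r(1) \<epsilon>[OF i] d(2)[OF i] by (simp add: hom_def)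
    also have "\<dots> = \<iota> i \<odot> p i" using d(2,3,4)[OF i] \<iota>i by (simp add: hom_def)
    finally show "(r \<odot> s) \<odot> \<iota>' i = h \<odot> \<iota>' i" using *(7)[OF i] by simp
  qed
  have "f = r \<odot> (s \<odot> g)" using comp_reduce[OF rs, of g] r(1) s(1) *(8,9) by (simp add: hom_def)
  then show "\<exists>d\<in>bounded_Cpt. \<exists>a b. b : x ~> d \<and> a : d ~> P \<and> f = a \<odot> b"
    using ED r(1) comp_hom[OF *(8) s(1)] by blast
qed

lemma everything_interpolating: "Obj T \<subseteq> interpolating"
proof (rule generation[OF generate interpolating_cone interpolating_retract])
  fix X :: "nat \<Rightarrow> 'o" and P \<iota> assume "\<And>n. X n \<in> interpolating" "is_coproduct T UNIV X P \<iota>"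
  then show "P \<in> interpolating" using interpolating_coprod[OF card_nat_less] by blast
next
  fix w x z f g h assume "exact_triangle T w x z f g h"
  then show "w \<in> Obj T" using triangle_hom(1) hom_Obj by blast
next
  fix W assume W: "W \<in> Obj T"
  obtain V \<iota> v where V: "is_coproduct T (Sigma R (\<lambda>Y. Hom T Y W)) fst V \<iota>" "onto \<alpha> V W v"
    using cover_exists[OF W] by blast
  have J: "|Sigma R (\<lambda>Y. Hom T Y W)| <o \<kappa>"
    by (rule card_Sigma_less[OF regular_\<kappa> ordLess_transitive[OF R_small \<beta>\<kappa>]])
       (use lsmall R_Obj W in \<open>auto simp: locally_small_def\<close>)
  have "V \<in> interpolating"
    by (rule interpolating_coprod[OF J V(1)]) (use R_Cpt Cpt_alpha_subset_hom_bounded Cpt_mono[OF \<alpha>\<beta>'] bounded_Cpt_interpolating in \<open>force simp: bounded_Cpt_def\<close>)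
  then show "\<exists>V\<in>interpolating. \<exists>v. onto \<alpha> V W v" using V(2) by blast
qed

lemma Cpt_beta_subset_hom_bounded: "Cpt \<beta> \<subseteq> hom_bounded"
proof
  fix Z assume Z: "Z \<in> Cpt \<beta>"
  have ZO: "Z \<in> Obj T" by (rule Cpt_Obj[OF Z])
  then have "Z \<in> interpolating" using everything_interpolating by blast
  then obtain d a b where d: "d \<in> bounded_Cpt" "b : Z ~> d" "a : d ~> Z" "Ident T Z = a \<odot> b"
    using interpolatingE[OF _ Z id_hom[OF ZO]] by blast
  then show "Z \<in> hom_bounded" using hom_bounded_retract[OF _ d(2,3) d(4)[symmetric]] by (simp add: bounded_Cpt_def)
qed

theorem Cpt_eq_hom_bounded: "Cpt \<beta> = {Z \<in> Obj T. \<forall>Y\<in>Cpt \<alpha>. |Hom T Y Z| <o \<beta>}"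
  using Cpt_beta_subset_hom_bounded hom_bounded_subset_Cpt_beta unfolding hom_bounded_def by blast

end

section \<open>Small subsets\<close>

lemma few_subsets_inaccessible:
  fixes \<beta> :: "'u rel" and N :: "'u set"
  assumes "inaccessible \<beta>" "|N| <o \<beta>"
  shows "|{G. G \<subseteq> N \<and> |G| <o r}| <o \<beta>"
proof -
  have "ctwo ^c |N| <o \<beta>" using assms card_of_Card_order[of N] unfolding inaccessible_def by blast
  moreover have "|Pow N| =o ctwo ^c |N|"
    using card_of_Pow_Func[of N] by (simp add: cexp_def ctwo_def Field_card_of)
  ultimately have "|Pow N| <o \<beta>" using ordIso_ordLess_trans by blast
  then show ?thesis by (rule card_subset_less[rotated]) blast
qed

lemma less_underS:
  assumes "Card_order r" "|G| <o r"
  obtains b where "b \<in> Field r" "|G| \<le>o |underS r b|"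
proof -
  have "Well_order r" using assms(1) card_order_on_well_order_on by blast
  then obtain b where b: "b \<in> Field r" "|G| =o Restr r (underS r b)"
    using assms(2) ordLess_iff_ordIso_Restr card_of_Well_order by blast
  have "|Field |G| | =o |Field (Restr r (underS r b))|" using card_of_cong[OF b(2)] .
  moreover have "|Field (Restr r (underS r b))| \<le>o |underS r b|"
    by (rule card_of_mono1) (auto simp: Field_def)
  ultimately show thesis using that b(1) ordIso_ordLeq_trans by (auto simp: Field_card_of)
qed

text \<open>Towards \<open>\<mu>^(<\<delta>) = \<mu>\<close> for \<open>\<mu> = \<gamma>^(<\<delta>)\<close>.\<close>

context
  fixes \<gamma> \<delta> \<mu> :: "'u rel"
  assumes \<gamma>: "Card_order \<gamma>" "ctwo \<le>o \<gamma>" and \<delta>: "regular_cardinal \<delta>" and \<mu>: "is_weak_power \<gamma> \<delta> \<mu>"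
begin

lemma \<delta>': "Cinfinite \<delta>" "Card_order \<delta>" "regularCard \<delta>" and \<mu>_card: "Card_order \<mu>"
  using \<delta> \<mu> by (simp_all add: regular_cardinal_def is_weak_power_def is_cardinal_sup_def)

lemma weak_power_ge: "Card_order l \<Longrightarrow> l <o \<delta> \<Longrightarrow> \<gamma> ^c l \<le>o \<mu>" for l :: "'u rel"
  using \<mu> unfolding is_weak_power_def is_cardinal_sup_def by blast

lemma weak_power_le:
  fixes n :: "'u rel"
  assumes "Card_order n" "\<And>l :: 'u rel. Card_order l \<Longrightarrow> l <o \<delta> \<Longrightarrow> \<gamma> ^c l \<le>o n" shows "\<mu> \<le>o n"
  using \<mu> assms unfolding is_weak_power_def is_cardinal_sup_def by blast

lemma card_Func_le:
  assumes "|B| <o \<delta>" shows "|Func B (Field \<gamma>)| \<le>o \<mu>"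
proof -
  obtain B' where B': "B' \<subseteq> Field \<delta>" "|B| =o |B'|"
    using internalize_card_of_ordLeq[of B \<delta>] ordLess_imp_ordLeq[OF assms] by blast
  have "|B'| <o \<delta>" using ordIso_ordLess_trans[OF ordIso_symmetric[OF B'(2)] assms] .
  then have "\<gamma> ^c |B'| \<le>o \<mu>" using weak_power_ge card_of_Card_order by blast
  moreover have "\<gamma> ^c |B| =o \<gamma> ^c |B'|" by (rule cexp_cong2[OF B'(2) \<gamma>(1) card_of_Card_order])
  ultimately have "\<gamma> ^c |B| \<le>o \<mu>" using ordIso_ordLeq_trans by blast
  then show ?thesis by (simp add: cexp_def Field_card_of)
qed

lemma card_Pow_le:
  assumes "|B| <o \<delta>" shows "|Pow B| \<le>o \<mu>"
proof -
  have "|Pow B| =o ctwo ^c |B|" using card_of_Pow_Func[of B] by (simp add: cexp_def ctwo_def Field_card_of)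
  moreover have "ctwo ^c |B| \<le>o \<gamma> ^c |B|" by (rule cexp_mono1[OF \<gamma>(2) card_of_Card_order])
  moreover have "\<gamma> ^c |B| \<le>o \<mu>" using card_Func_le[OF assms] by (simp add: cexp_def Field_card_of)
  ultimately show ?thesis using ordIso_ordLeq_trans ordLeq_transitive by blast
qed

lemma base_le_weak_power: "\<gamma> \<le>o \<mu>"
proof -
  let ?l = "|{undefined :: 'u}|"
  have "Cnotzero ?l" using card_of_ordIso_czero_iff_empty[of "{undefined :: 'u}"]
    by (simp add: card_of_card_order_on Field_card_of)
  then have "\<gamma> \<le>o \<gamma> ^c ?l" by (rule ordLeq_cexp1[OF _ \<gamma>(1)])
  moreover have "\<gamma> ^c ?l \<le>o \<mu>" by (rule weak_power_ge[OF card_of_Card_order card_finite_less[OF \<delta>]]) simp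
  ultimately show ?thesis by (rule ordLeq_transitive)
qed

text \<open>Otherwise \<open>\<mu>\<close> is an admissible exponent, and \<open>2^\<mu> \<le> \<gamma>^\<mu> \<le> \<mu>\<close>.\<close>

lemma \<delta>_le_\<mu>: "\<delta> \<le>o \<mu>"
proof (rule ccontr)
  assume "\<not> \<delta> \<le>o \<mu>"
  then have "\<mu> <o \<delta>"
    using not_ordLeq_iff_ordLess card_order_on_well_order_on \<delta>'(2) \<mu>_card by blast
  then have "\<gamma> ^c \<mu> \<le>o \<mu>" using weak_power_ge \<mu>_card by blast
  moreover have "ctwo ^c \<mu> \<le>o \<gamma> ^c \<mu>" by (rule cexp_mono1[OF \<gamma>(2) \<mu>_card])
  moreover have "\<mu> <o ctwo ^c \<mu>" by (rule ordLess_ctwo_cexp[OF \<mu>_card])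
  ultimately show False using ordLess_ordLeq_trans ordLeq_transitive not_ordLess_ordLeq by metis
qed

lemma \<mu>_inf: "Cinfinite \<mu>"
  using cinfinite_mono[OF \<delta>_le_\<mu>] \<delta>'(1) \<mu>_card by simp

lemma card_\<delta>: "|Field \<delta>| \<le>o \<mu>"
  using card_of_Field_ordIso[OF \<delta>'(2)] \<delta>_le_\<mu> ordIso_ordLeq_trans by blast

lemma card_Times_le: "|A| \<le>o \<mu> \<Longrightarrow> |B| \<le>o \<mu> \<Longrightarrow> |A \<times> B| \<le>o \<mu>"
  using card_of_Times_ordLeq_infinite_Field \<mu>_inf by (auto simp: cinfinite_def)

lemma card_underS: "b \<in> Field \<delta> \<Longrightarrow> |underS \<delta> b| <o \<delta>"
  by (rule card_of_underS[OF \<delta>'(2)])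

lemma card_under:
  assumes "a \<in> Field \<delta>" shows "|under \<delta> a| <o \<delta>"
proof -
  have "under \<delta> a \<subseteq> underS \<delta> a \<union> {a}" by (auto simp: under_def underS_def)
  moreover have "|underS \<delta> a \<union> {a}| <o \<delta>"
    by (rule Un_Cinfinite_bound_strict[OF card_underS[OF assms] card_finite_less[OF \<delta>] \<delta>'(1)]) simp
  ultimately show ?thesis by (rule card_subset_less)
qed

text \<open>
  A set of size \<open>\<mu>\<close> that is convenient for counting: it contains the graphs of functions to \<open>\<gamma>\<close>
  with fewer than \<open>\<delta>\<close> arguments, and the union of fewer than \<open>\<delta>\<close> members is again a member.
\<close>

definition fam :: "('u \<times> 'u) set set" where "fam = {G. G \<subseteq> Field \<delta> \<times> Field \<gamma> \<and> |G| <o \<delta>}"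

text \<open>
  Since \<open>\<delta>\<close> is regular, a member \<open>G\<close> is bounded in the first coordinate by some \<open>a\<close>, and it has at most
  as many elements as there are elements below some \<open>b\<close>. Number its elements by elements below
  \<open>b\<close>; then \<open>G\<close> is given by a relation \<open>W\<close> between \<open>b\<close> and \<open>a\<close>, the first coordinates, and a
  function \<open>f\<close> from \<open>b\<close> to \<open>\<gamma>\<close>, the second coordinates.
\<close>

lemma card_fam_le: "|fam| \<le>o \<mu>"
proof -
  define \<Phi> :: "('u \<times> 'u) set \<times> ('u \<Rightarrow> 'u) \<Rightarrow> ('u \<times> 'u) set"
    where "\<Phi> = (\<lambda>(W, f). {(x, f b) | b x. (b, x) \<in> W})"
  have "Field \<gamma> \<noteq> {}"
    using \<gamma>(2) card_of_mono2[OF \<gamma>(2)] card_of_empty3[of "UNIV :: bool set"] by (auto simp: ctwo_def Field_card_of)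
  then obtain c0 where c0: "c0 \<in> Field \<gamma>" by blast
  have "fam \<subseteq> (\<Union>a\<in>Field \<delta>. \<Union>b\<in>Field \<delta>. \<Phi> ` (Pow (underS \<delta> b \<times> under \<delta> a) \<times> Func (underS \<delta> b) (Field \<gamma>)))"
  proof
    fix G assume "G \<in> fam"
    then have G: "G \<subseteq> Field \<delta> \<times> Field \<gamma>" "|G| <o \<delta>" by (auto simp: fam_def)
    have wo: "wo_rel \<delta>" using \<delta>'(2) card_order_on_well_order_on wo_rel_def by blast
    have "relChain \<delta> (\<lambda>a. under \<delta> a \<times> Field \<gamma>)"
      unfolding relChain_def using wo_rel.TRANS[OF wo] by (auto simp: under_def dest: transD)
    moreover have "G \<subseteq> (\<Union>a\<in>Field \<delta>. under \<delta> a \<times> Field \<gamma>)"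
      using G(1) wo_rel.REFL[OF wo] by (fastforce simp: under_def refl_on_def)
    ultimately obtain a where a: "a \<in> Field \<delta>" "G \<subseteq> under \<delta> a \<times> Field \<gamma>"
      using regularCard_UNION[OF \<delta>'(2,3) _ _ G(2)] by metis
    obtain b where b: "b \<in> Field \<delta>" "|G| \<le>o |underS \<delta> b|" using less_underS[OF \<delta>'(2) G(2)] .
    then obtain i where i: "inj_on i G" "i ` G \<subseteq> underS \<delta> b" using card_of_ordLeq by metis
    define W where "W = (\<lambda>g. (i g, fst g)) ` G"
    define f where "f x = (if x \<in> i ` G then snd (inv_into G i x) else if x \<in> underS \<delta> b then c0 else undefined)" for x
    have W: "W \<in> Pow (underS \<delta> b \<times> under \<delta> a)" using i(2) a(2) by (auto simp: W_def)
    have f: "f \<in> Func (underS \<delta> b) (Field \<gamma>)"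
    proof -
      have "snd (inv_into G i x) \<in> Field \<gamma>" if "x \<in> i ` G" for x using inv_into_into[OF that] G(1) by auto
      then show ?thesis using i(2) c0 by (auto simp: Func_def f_def)
    qed
    have fi: "f (i g) = snd g" if "g \<in> G" for g using that i(1) by (simp add: f_def)
    have "\<Phi> (W, f) = G"
    proof (intro equalityI subsetI)
      fix g assume "g \<in> \<Phi> (W, f)"
      then obtain g' where "g' \<in> G" "g = (fst g', f (i g'))" by (auto simp: \<Phi>_def W_def)
      then show "g \<in> G" using fi by simp
    next
      fix g assume g: "g \<in> G"
      then have "(i g, fst g) \<in> W" "g = (fst g, f (i g))" using fi by (auto simp: W_def)
      then show "g \<in> \<Phi> (W, f)" unfolding \<Phi>_def by blast
    qed
    then show "G \<in> (\<Union>a\<in>Field \<delta>. \<Union>b\<in>Field \<delta>. \<Phi> ` (Pow (underS \<delta> b \<times> under \<delta> a) \<times> Func (underS \<delta> b) (Field \<gamma>)))"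
      using a(1) b(1) W f by blast
  qed
  moreover have "|\<Union>a\<in>Field \<delta>. \<Union>b\<in>Field \<delta>. \<Phi> ` (Pow (underS \<delta> b \<times> under \<delta> a) \<times> Func (underS \<delta> b) (Field \<gamma>))| \<le>o \<mu>"
  proof (intro UNION_Cinfinite_bound[OF card_\<delta> _ \<mu>_inf] ballI)
    fix a b assume ab: "a \<in> Field \<delta>" "b \<in> Field \<delta>"
    have "|underS \<delta> b \<times> under \<delta> a| <o \<delta>"
      by (rule card_Sigma_less[OF \<delta> card_underS[OF ab(2)] card_under[OF ab(1)]])
    then have "|Pow (underS \<delta> b \<times> under \<delta> a) \<times> Func (underS \<delta> b) (Field \<gamma>)| \<le>o \<mu>"
      by (intro card_Times_le card_Pow_le card_Func_le card_underS ab)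
    then show "|\<Phi> ` (Pow (underS \<delta> b \<times> under \<delta> a) \<times> Func (underS \<delta> b) (Field \<gamma>))| \<le>o \<mu>"
      using card_of_image ordLeq_transitive by blast
  qed
  ultimately show ?thesis by (rule ordLeq_transitive[OF card_of_mono1])
qed

lemma \<mu>_le_fam: "\<mu> \<le>o |fam|"
proof -
  obtain B where B: "B \<subseteq> Field \<mu>" "|fam| =o |B|" using internalize_card_of_ordLeq[of fam \<mu>] card_fam_le by blast
  have "\<mu> \<le>o |B|"
  proof (rule weak_power_le[OF card_of_Card_order])
    fix l :: "'u rel" assume l: "Card_order l" "l <o \<delta>"
    have Fl: "|Field l| <o \<delta>" using ordLess_Field[OF l(2)] .
    have "|Field l| \<le>o |Field \<delta>|" using card_of_mono2[OF ordLess_imp_ordLeq[OF l(2)]] .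
    then obtain i where i: "inj_on i (Field l)" "i ` Field l \<subseteq> Field \<delta>" using card_of_ordLeq by metis
    have "|Func (Field l) (Field \<gamma>)| \<le>o |fam|"
    proof (rule card_of_ordLeqI[of "\<lambda>f. (\<lambda>x. (i x, f x)) ` Field l"])
      show "inj_on (\<lambda>f. (\<lambda>x. (i x, f x)) ` Field l) (Func (Field l) (Field \<gamma>))"
      proof (rule inj_onI)
        fix f g assume f: "f \<in> Func (Field l) (Field \<gamma>)" and g: "g \<in> Func (Field l) (Field \<gamma>)"
          and eq: "(\<lambda>x. (i x, f x)) ` Field l = (\<lambda>x. (i x, g x)) ` Field l"
        show "f = g"
        proof
          fix x show "f x = g x"
          proof (cases "x \<in> Field l")
            case True
            then have "(i x, f x) \<in> (\<lambda>x. (i x, g x)) ` Field l" using eq by blast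
            then show ?thesis using i(1) True by (auto simp: inj_on_def)
          next
            case False
            then show ?thesis using f g by (simp add: Func_def)
          qed
        qed
      qed
      show "(\<lambda>x. (i x, f x)) ` Field l \<in> fam" if "f \<in> Func (Field l) (Field \<gamma>)" for f
        using that i(2) card_image_less[OF Fl] by (auto simp: fam_def Func_def)
    qed
    then show "\<gamma> ^c l \<le>o |B|" unfolding cexp_def using B(2) ordLeq_ordIso_trans by blast
  qed
  then show ?thesis using B(2) ordLeq_ordIso_trans ordIso_symmetric by blast
qed

text \<open>
  A family of fewer than \<open>\<delta>\<close> subsets of \<open>U\<close> is the family of sections of a relation \<open>W\<close> between
  the elements below some \<open>b\<close> and \<open>U\<close>; there are at most \<open>\<mu>\<close> such relations.
\<close>

lemma card_small_subsets_Pow: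
  fixes U :: "'b set"
  assumes U: "|U| <o \<delta>" shows "|{\<G>. \<G> \<subseteq> Pow U \<and> |\<G>| <o \<delta>}| \<le>o \<mu>"
proof -
  define \<Phi> :: "('u \<times> 'b) set \<times> 'u set \<Rightarrow> 'b set set" where "\<Phi> = (\<lambda>(W, V). (\<lambda>b. W `` {b}) ` V)"
  have "{\<G>. \<G> \<subseteq> Pow U \<and> |\<G>| <o \<delta>} \<subseteq> (\<Union>b\<in>Field \<delta>. \<Phi> ` (Pow (underS \<delta> b \<times> U) \<times> Pow (underS \<delta> b)))"
  proof
    fix \<G> assume "\<G> \<in> {\<G>. \<G> \<subseteq> Pow U \<and> |\<G>| <o \<delta>}"
    then have \<G>: "\<G> \<subseteq> Pow U" "|\<G>| <o \<delta>" by auto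
    obtain b where b: "b \<in> Field \<delta>" "|\<G>| \<le>o |underS \<delta> b|" using less_underS[OF \<delta>'(2) \<G>(2)] .
    then obtain i where i: "inj_on i \<G>" "i ` \<G> \<subseteq> underS \<delta> b" using card_of_ordLeq by metis
    define W where "W = {(i G, x) | G x. G \<in> \<G> \<and> x \<in> G}"
    have "W `` {i G} = G" if "G \<in> \<G>" for G using i(1) that by (auto simp: W_def inj_on_def)
    then have "\<Phi> (W, i ` \<G>) = \<G>" by (simp add: \<Phi>_def image_image)
    moreover have "(W, i ` \<G>) \<in> Pow (underS \<delta> b \<times> U) \<times> Pow (underS \<delta> b)" using i(2) \<G>(1) by (auto simp: W_def)
    ultimately show "\<G> \<in> (\<Union>b\<in>Field \<delta>. \<Phi> ` (Pow (underS \<delta> b \<times> U) \<times> Pow (underS \<delta> b)))" using b(1) by blast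
  qed
  moreover have "|\<Union>b\<in>Field \<delta>. \<Phi> ` (Pow (underS \<delta> b \<times> U) \<times> Pow (underS \<delta> b))| \<le>o \<mu>"
  proof (intro UNION_Cinfinite_bound[OF card_\<delta> _ \<mu>_inf] ballI)
    fix b assume b: "b \<in> Field \<delta>"
    have "|underS \<delta> b \<times> U| <o \<delta>" by (rule card_Sigma_less[OF \<delta> card_underS[OF b] U])
    then have "|Pow (underS \<delta> b \<times> U) \<times> Pow (underS \<delta> b)| \<le>o \<mu>"
      by (intro card_Times_le card_Pow_le card_underS b)
    then show "|\<Phi> ` (Pow (underS \<delta> b \<times> U) \<times> Pow (underS \<delta> b))| \<le>o \<mu>"
      using card_of_image ordLeq_transitive by blast
  qed
  ultimately show ?thesis by (rule ordLeq_transitive[OF card_of_mono1])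
qed

text \<open>
  Embed \<open>N\<close> into \<open>fam\<close>. A set \<open>\<G>\<close> of fewer than \<open>\<delta>\<close> members of \<open>fam\<close> consists of subsets of its
  union \<open>\<Union>\<G>\<close>, which is a member of \<open>fam\<close>.
\<close>

lemma few_subsets_weak_power:
  assumes "|N| \<le>o \<mu>" shows "|{G. G \<subseteq> N \<and> |G| <o \<delta>}| \<le>o \<mu>"
proof -
  have "{\<G>. \<G> \<subseteq> fam \<and> |\<G>| <o \<delta>} \<subseteq> (\<Union>U\<in>fam. {\<G>. \<G> \<subseteq> Pow U \<and> |\<G>| <o \<delta>})"
  proof
    fix \<G> assume "\<G> \<in> {\<G>. \<G> \<subseteq> fam \<and> |\<G>| <o \<delta>}"
    then have \<G>: "\<G> \<subseteq> fam" "|\<G>| <o \<delta>" by auto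
    have "|\<Union>G\<in>\<G>. G| <o \<delta>" by (rule card_UN_less[OF \<delta> \<G>(2)]) (use \<G>(1) in \<open>auto simp: fam_def\<close>)
    then have "\<Union>\<G> \<in> fam" using \<G>(1) by (auto simp: fam_def)
    then show "\<G> \<in> (\<Union>U\<in>fam. {\<G>. \<G> \<subseteq> Pow U \<and> |\<G>| <o \<delta>})" using \<G>(2) by blast
  qed
  moreover have "|\<Union>U\<in>fam. {\<G>. \<G> \<subseteq> Pow U \<and> |\<G>| <o \<delta>}| \<le>o \<mu>"
    by (intro UNION_Cinfinite_bound[OF card_fam_le _ \<mu>_inf] ballI card_small_subsets_Pow) (simp add: fam_def)
  ultimately have "|{\<G>. \<G> \<subseteq> fam \<and> |\<G>| <o \<delta>}| \<le>o \<mu>" by (rule ordLeq_transitive[OF card_of_mono1])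
  moreover have "|{G. G \<subseteq> N \<and> |G| <o \<delta>}| \<le>o |{\<G>. \<G> \<subseteq> fam \<and> |\<G>| <o \<delta>}|"
    by (rule card_small_subsets_mono[OF ordLeq_transitive[OF assms \<mu>_le_fam]])
  ultimately show ?thesis by (rule ordLeq_transitive[rotated])
qed

end

lemma card_less_cardSuc_iff:
  assumes "Card_order \<mu>" "\<beta> =o cardSuc \<mu>" shows "|A| <o \<beta> \<longleftrightarrow> |A| \<le>o \<mu>"
proof -
  have "|A| <o \<beta> \<longleftrightarrow> |A| <o cardSuc \<mu>"
    using ordLess_ordIso_trans[OF _ assms(2)] ordLess_ordIso_trans[OF _ ordIso_symmetric[OF assms(2)]] by blast
  then show ?thesis using cardSuc_ordLeq_ordLess[OF assms(1) card_of_Card_order] by simp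
qed

section \<open>The size of the category of compact objects\<close>

context category
begin

lemma representative_set_exists:
  assumes "A \<subseteq> Obj C" shows "\<exists>R. is_representative_set C A R"
proof -
  define rep where "rep x = (SOME y. y \<in> A \<and> isomorphic C x y)" for x
  have rep: "rep x \<in> A" "isomorphic C x (rep x)" if "x \<in> A" for x
    using someI[of "\<lambda>y. y \<in> A \<and> isomorphic C x y" x] isomorphic_refl[of x] that assms unfolding rep_def by auto
  have eq: "rep x = rep y" if "x \<in> A" "y \<in> A" "isomorphic C x y" for x y
  proof -
    have "isomorphic C x z \<longleftrightarrow> isomorphic C y z" if z: "z \<in> A" for z
      using isomorphic_trans[of x y z] isomorphic_trans[of y x z] isomorphic_sym[of x y] that \<open>x \<in> A\<close> \<open>y \<in> A\<close>
        \<open>isomorphic C x y\<close> assms by blast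
    then have "(\<lambda>z. z \<in> A \<and> isomorphic C x z) = (\<lambda>z. z \<in> A \<and> isomorphic C y z)" by blast
    then show ?thesis by (simp add: rep_def)
  qed
  have "is_representative_set C A (rep ` A)"
    unfolding is_representative_set_def
  proof (intro conjI ballI)
    show "rep ` A \<subseteq> A" using rep by blast
    fix x assume x: "x \<in> A"
    show "\<exists>!y. y \<in> rep ` A \<and> isomorphic C x y"
    proof (rule ex1I[of _ "rep x"])
      show "rep x \<in> rep ` A \<and> isomorphic C x (rep x)" using rep x by blast
      fix y assume "y \<in> rep ` A \<and> isomorphic C x y"
      then obtain z where z: "z \<in> A" "y = rep z" "isomorphic C x (rep z)" by blast
      have "isomorphic C (rep z) z" using isomorphic_sym[of z "rep z"] rep[OF z(1)] z(1) assms by blast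
      then have "isomorphic C x z" using isomorphic_trans[of x "rep z" z] z x rep[OF z(1)] assms by blast
      then show "y = rep x" using eq[OF x z(1)] z(2) by simp
    qed
  qed
  then show ?thesis by blast
qed

end

context cocomplete_triangulated
begin

text \<open>If the category of compact objects had fewer than \<open>\<alpha>\<close> morphisms, then a coproduct of
  that many copies of a non-zero compact object \<open>S\<close> would be compact, but it has too many morphisms to \<open>S\<close>.\<close>

lemma card_Cpt_ge:
  assumes \<alpha>: "regular_cardinal \<alpha>" "\<alpha> \<le>o \<kappa>"
    and S: "S \<in> Cpt \<alpha>" "Ident T S \<noteq> Zero T S S"
    and R: "R \<subseteq> Cpt \<alpha>" "\<And>S. S \<in> Cpt \<alpha> \<Longrightarrow> \<exists>Y\<in>R. isomorphic T S Y"
  shows "\<alpha> \<le>o |SIGMA (x, y) : R \<times> R. Hom T x y|"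
proof (rule ccontr)
  let ?M = "SIGMA (x, y) : R \<times> R. Hom T x y"
  assume "\<not> \<alpha> \<le>o |?M|"
  moreover have "Well_order \<alpha>" using \<alpha>(1) card_order_on_well_order_on by (auto simp: regular_cardinal_def)
  ultimately have M: "|?M| <o \<alpha>" using not_ordLeq_iff_ordLess card_of_Well_order by blast
  have SO: "S \<in> Obj T" by (rule Cpt_Obj[OF S(1)])
  obtain Q \<iota> where Q: "is_coproduct T ?M (\<lambda>_. S) Q \<iota>"
    by (rule coprod_exists[OF ordLess_ordLeq_trans[OF M \<alpha>(2)], of "\<lambda>_. S"]) (use SO in auto)
  have QC: "Q \<in> Cpt \<alpha>" by (rule coprod_closedD[OF Cpt_coprod_closed[OF \<alpha>] \<alpha>(2) M _ Q]) (rule S(1))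
  have "\<exists>e. e : Q ~> S \<and> (\<forall>m\<in>?M. e \<odot> \<iota> m = (if m \<in> V then Ident T S else Zero T S S))" for V
    by (rule coprod_ex[OF Q SO]) (use id_hom[OF SO] zero_hom[OF SO SO] in auto)
  then obtain e where e: "\<And>V. e V : Q ~> S"
    "\<And>V m. m \<in> ?M \<Longrightarrow> e V \<odot> \<iota> m = (if m \<in> V then Ident T S else Zero T S S)" by metis
  have 1: "|Pow ?M| \<le>o |Hom T Q S|"
  proof (rule card_of_ordLeqI[of e])
    show "inj_on e (Pow ?M)"
    proof (rule inj_onI)
      fix V W assume V: "V \<in> Pow ?M" and W: "W \<in> Pow ?M" and eq: "e V = e W"
      have "m \<in> V \<longleftrightarrow> m \<in> W" if "m \<in> ?M" for m using e(2)[OF that, of V] e(2)[OF that, of W] eq S(2) by metis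
      then show "V = W" using V W by blast
    qed
  qed (use e(1) hom_Obj(3) in blast)
  obtain Y where Y: "Y \<in> R" "isomorphic T Q Y" using R(2)[OF QC] by blast
  obtain Y' where Y': "Y' \<in> R" "isomorphic T S Y'" using R(2)[OF S(1)] by blast
  have YO: "Y \<in> Obj T" "Y' \<in> Obj T" using Y(1) Y'(1) R(1) Cpt_Obj by blast+
  obtain a b where ab: "a : Q ~> Y" "b : Y ~> Q" "b \<odot> a = Ident T Q"
    using isomorphic_obtain[OF Y(2) Cpt_Obj[OF QC] YO(1)] by blast
  obtain c d where cd: "c : S ~> Y'" "d : Y' ~> S" "d \<odot> c = Ident T S"
    using isomorphic_obtain[OF Y'(2) SO YO(2)] by blast
  have 2: "|Hom T Q S| \<le>o |Hom T Y S|" using hom_card_retract(1)[OF ab SO] .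
  have 3: "|Hom T Y S| \<le>o |Hom T Y Y'|" using hom_card_retract(2)[OF cd YO(1)] .
  have 4: "|Hom T Y Y'| \<le>o |?M|"
    by (rule card_of_ordLeqI[of "\<lambda>f. ((Y, Y'), f)"]) (use Y(1) Y'(1) in \<open>auto simp: inj_on_def\<close>)
  have "|Pow ?M| \<le>o |?M|"
    using ordLeq_transitive[OF 1 ordLeq_transitive[OF 2 ordLeq_transitive[OF 3 4]]] .
  then show False using card_of_Pow[of ?M] not_ordLess_ordLeq by blast
qed

end

section \<open>Description of the \<open>\<beta>\<close>-compact objects\<close>

theorem theorem8p1:
  fixes \<kappa> \<alpha> \<beta> :: "'u rel"
    and T :: "('o, 'm) triangulated_data"
  assumes "inaccessible \<kappa>"
    and "triangulated_category T" and "locally_small \<kappa> T" and "has_small_coproducts \<kappa> T"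
    and "\<exists>X\<in>Obj T. \<not> is_zero_object T X"
    and "regular_cardinal \<alpha>" and "\<alpha> <o \<kappa>"
    and "compactly_generated \<kappa> \<alpha> T"
    and "Card_order \<beta>" and "\<beta> <o \<kappa>"
    and "(\<exists>(\<gamma>::'u rel) (\<delta>::'u rel) (\<mu>::'u rel).
            Card_order \<gamma> \<and> \<gamma> <o \<kappa> \<and> category_card T (compact_objects \<kappa> \<alpha> T) \<le>o \<gamma> \<and>
            regular_cardinal \<delta> \<and> \<delta> <o \<kappa> \<and> \<alpha> \<le>o \<delta> \<and>
            is_weak_power \<gamma> \<delta> \<mu> \<and> \<beta> =o cardSuc \<mu>)
       \<or> (inaccessible \<beta> \<and> category_card T (compact_objects \<kappa> \<alpha> T) <o \<beta>)"
  shows "compact_objects \<kappa> \<beta> T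
       = {Z \<in> Obj T. \<forall>Y\<in>compact_objects \<kappa> \<alpha> T. |Hom T Y Z| <o \<beta>}"
proof -
  interpret triangulated_category T by (rule assms(2))
  interpret cocomplete_triangulated T \<kappa> by unfold_locales (rule assms(1,3,4))+
  have \<alpha>\<kappa>: "\<alpha> \<le>o \<kappa>" using assms(7) ordLess_imp_ordLeq by blast
  obtain \<S> where \<S>: "|\<S>| <o \<kappa>" "\<And>S. S \<in> \<S> \<Longrightarrow> small_object \<kappa> \<alpha> T S"
    "\<And>X. X \<in> Obj T \<Longrightarrow> is_zero_object T X \<longleftrightarrow> (\<forall>S\<in>\<S>. Hom T S X = {Zero T S X})"
    "\<And>(I::'u set) X Y f P \<iota> Q \<iota>' h. |I| <o \<kappa> \<Longrightarrow> (\<forall>i\<in>I. f i \<in> Hom T (X i) (Y i)) \<Longrightarrow>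
           is_coproduct T I X P \<iota> \<Longrightarrow> is_coproduct T I Y Q \<iota>' \<Longrightarrow> is_coproduct_map T I f P \<iota> Q \<iota>' h \<Longrightarrow>
           (\<forall>i\<in>I. \<forall>S\<in>\<S>. hom_surjective T S (X i) (Y i) (f i)) \<Longrightarrow> (\<forall>S\<in>\<S>. hom_surjective T S P Q h)"
    using assms(8) unfolding compactly_generated_def by (elim exE conjE) blast
  have \<S>_Cpt: "\<S> \<subseteq> Cpt \<alpha>" by (rule generators_compact[OF assms(6) \<alpha>\<kappa> \<S>(1,2)]) (use \<S>(4) in blast)+
  have generate: "is_zero_object T E"
    if E: "E \<in> Obj T" and zero: "\<And>S a. S \<in> Cpt \<alpha> \<Longrightarrow> a : S ~> E \<Longrightarrow> a = Zero T S E" for E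
  proof -
    have "Hom T S E = {Zero T S E}" if "S \<in> \<S>" for S
    proof -
      have S: "S \<in> Cpt \<alpha>" using \<S>_Cpt that by blast
      then show ?thesis using zero[OF S homI[OF Cpt_Obj[OF S] E]] hom_Obj(3)[OF zero_hom[OF Cpt_Obj[OF S] E]] by blast
    qed
    then show ?thesis using \<S>(3)[OF E] by blast
  qed
  define R where "R = (SOME R. is_representative_set T (Cpt \<alpha>) R)"
  have "is_representative_set T (Cpt \<alpha>) R"
    unfolding R_def using representative_set_exists[of "Cpt \<alpha>"] Cpt_Obj by (metis someI_ex subsetI)
  then have R: "R \<subseteq> Cpt \<alpha>" "\<And>S. S \<in> Cpt \<alpha> \<Longrightarrow> \<exists>Y\<in>R. isomorphic T S Y"
    unfolding is_representative_set_def by blast+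
  let ?M = "SIGMA (x, y) : R \<times> R. Hom T x y"
  have card: "category_card T (Cpt \<alpha>) = |?M|" by (simp add: category_card_def R_def Let_def)
  obtain X where X: "X \<in> Obj T" "\<not> is_zero_object T X" using assms(5) by blast
  then obtain S a where S: "S \<in> Cpt \<alpha>" "a : S ~> X" "a \<noteq> Zero T S X" using generate by blast
  have "Ident T S \<noteq> Zero T S S"
  proof
    assume "Ident T S = Zero T S S"
    then have "a = a \<odot>\<^bsub>T\<^esub> Zero T S S" using S(2) comp_id[of a S] by (simp add: hom_def)
    then show False using S(2,3) Cpt_Obj[OF S(1)] by (simp add: hom_def)
  qed
  then have \<alpha>M: "\<alpha> \<le>o |?M|" using card_Cpt_ge[OF assms(6) \<alpha>\<kappa> S(1) _ R] by blast
  have "regular_cardinal \<beta> \<and> |?M| <o \<beta> \<and> (\<forall>N :: 'u set. |N| <o \<beta> \<longrightarrow> |{G. G \<subseteq> N \<and> |G| <o \<alpha>}| <o \<beta>)"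
    using assms(11)
  proof (elim disjE exE conjE)
    assume "inaccessible \<beta>" "category_card T (Cpt \<alpha>) <o \<beta>"
    then show ?thesis using few_subsets_inaccessible card by (auto simp: inaccessible_def)
  next
    fix \<gamma> \<delta> \<mu> :: "'u rel"
    assume \<gamma>: "Card_order \<gamma>" "category_card T (Cpt \<alpha>) \<le>o \<gamma>" and \<delta>: "regular_cardinal \<delta>" "\<alpha> \<le>o \<delta>"
      and \<mu>: "is_weak_power \<gamma> \<delta> \<mu>" "\<beta> =o cardSuc \<mu>"
    have \<alpha>\<gamma>: "\<alpha> \<le>o \<gamma>" using ordLeq_transitive[OF \<alpha>M] \<gamma>(2) card by simp
    \<comment> \<open>Cardinal arithmetic with base \<open>\<gamma>\<close> needs \<open>2 \<le> \<gamma>\<close>, which holds because \<open>T \<noteq> 0\<close>.\<close>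
    have "ctwo \<le>o \<alpha>" using assms(6) ctwo_ordLeq_Cinfinite unfolding regular_cardinal_def by blast
    then have two: "ctwo \<le>o \<gamma>" using \<alpha>\<gamma> ordLeq_transitive by blast
    note few = few_subsets_weak_power[OF \<gamma>(1) two \<delta>(1) \<mu>(1)]
    have \<mu>_inf: "Cinfinite \<mu>" and \<mu>_co: "Card_order \<mu>"
      using \<mu>_inf[OF \<gamma>(1) two \<delta>(1) \<mu>(1)] by blast+
    note suc = card_less_cardSuc_iff[OF \<mu>_co \<mu>(2)]
    have "regular_cardinal \<beta>"
      using regularCard_ordIso[OF ordIso_symmetric[OF \<mu>(2)]] Cinfinite_cong[OF ordIso_symmetric[OF \<mu>(2)]]
        Cinfinite_cardSuc[OF \<mu>_inf] regularCard_cardSuc[OF \<mu>_inf] by (simp add: regular_cardinal_def)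
    moreover have "|?M| \<le>o \<mu>"
      using ordLeq_transitive[OF \<gamma>(2) base_le_weak_power[OF \<gamma>(1) two \<delta>(1) \<mu>(1)]] card by simp
    moreover have "|{G. G \<subseteq> N \<and> |G| <o \<alpha>}| \<le>o \<mu>" if "|N| \<le>o \<mu>" for N :: "'u set"
    proof -
      have "{G. G \<subseteq> N \<and> |G| <o \<alpha>} \<subseteq> {G. G \<subseteq> N \<and> |G| <o \<delta>}"
        using ordLess_ordLeq_trans[OF _ \<delta>(2)] by blast
      then show ?thesis by (rule ordLeq_transitive[OF card_of_mono1 few[OF that]])
    qed
    ultimately show ?thesis by (simp add: suc)
  qed
  then have \<beta>: "regular_cardinal \<beta>" "|?M| <o \<beta>" and few: "\<And>N :: 'u set. |N| <o \<beta> \<Longrightarrow> |{G. G \<subseteq> N \<and> |G| <o \<alpha>}| <o \<beta>"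
    by blast+
  interpret bounded_setting T \<kappa> \<alpha> \<beta> R
    using assms(6,10) \<beta> ordLeq_ordLess_trans[OF \<alpha>M \<beta>(2)] generate R few by unfold_locales blast+
  show ?thesis by (rule Cpt_eq_hom_bounded)
qed

end
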